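(* Let $\Omega,\widetilde{\Omega}\subset\mathbb{R}^n$ be bounded domains, let $\varphi:\Omega\to\widetilde{\Omega}$ be a homeomorphism of finite distortion with $\varphi\in L^1_\infty(\Omega)$, and let $1\le s<\infty$. Then the inverse mapping $\varphi^{-1}:\widetilde{\Omega}\to\Omega$ generates a bounded composition operator $$(\varphi^{-1})^{\ast}:L^1_\infty(\Omega)\to L^1_s(\widetilde{\Omega})$$ if and only if $\varphi^{-1}\in L^1_s(\widetilde{\Omega})$, $\varphi^{-1}$ possesses the Luzin $N^{-1}$-property (equivalently, $\varphi$ possesses the Luzin $N$-property), and $$K^{I}_{\infty,s}(\Omega)=\left(\int_{\Omega}K^{I}_{s}(x,\varphi)^{s}\,dx\right)^{1/s}<\infty .$$
   Context: For an open set $U\subset\mathbb{R}^n$ and $1\le p\le\infty$, $L^1_p(U)$ denotes the homogeneous Sobolev space of locally integrable, weakly differentiable functions $f:U\to\mathbb{R}$ with finite seminorm $\|f\mid L^1_p(U)\|=\|\nabla f\mid L_p(U)\|$; a mapping belongs to $L^1_p$ if each coordinate function does. Functions in $L^1_p$ are always taken in their quasicontinuous (refined) representative. For a weakly differentiable $\varphi$, $D\varphi(x)$ is the (a.e. defined) Jacobi matrix, $J(x,\varphi)=\det D\varphi(x)$, and $l(D\varphi(x))=\min\{|D\varphi(x)h|:|h|=1\}$. $\varphi$ has finite distortion if $D\varphi(x)=0$ for a.e. $x$ in $\{x: J(x,\varphi)=0\}$. A homeomorphism $\psi:U\to V$ generates a bounded composition operator $\psi^{\ast}:L^1_p(V)\to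 L^1_q(U)$, $\psi^{\ast}(f)=f\circ\psi$, if for every $f\in L^1_p(V)$ the composition $f\circ\psi$ is defined quasi-everywhere in $U$, belongs to $L^1_q(U)$, and $\|f\circ\psi\mid L^1_q(U)\|\le K\|f\mid L^1_p(V)\|$ with a constant $K<\infty$ independent of $f$. $\varphi$ has the Luzin $N$-property if it maps Lebesgue null sets to null sets; $\varphi^{-1}$ has the Luzin $N^{-1}$-property if preimages under $\varphi^{-1}$ of null sets are null. The normalized inner $s$-distortion is $K^I_s(x,\varphi)=|J(x,\varphi)|^{1/s}/l(D\varphi(x))$ if $J(x,\varphi)\neq0$ and $0$ otherwise. *)

theory Defs
  imports "HOL-Analysis.Analysis"
begin

definition pderiv_i :: "'n::finite \<Rightarrow> (real^'n \<Rightarrow> real) \<Rightarrow> real^'n \<Rightarrow> real" where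
  "pderiv_i i f x = frechet_derivative f (at x) (axis i 1)"

fun Ck_fun :: "nat \<Rightarrow> (real^'n::finite \<Rightarrow> real) \<Rightarrow> bool" where
  "Ck_fun 0 f = continuous_on UNIV f"
| "Ck_fun (Suc k) f = ((\<forall>x. f differentiable (at x)) \<and> continuous_on UNIV f \<and>
                       (\<forall>i. Ck_fun k (pderiv_i i f)))"

definition smooth_fun :: "(real^'n::finite \<Rightarrow> real) \<Rightarrow> bool" where
  "smooth_fun f \<longleftrightarrow> (\<forall>k. Ck_fun k f)"

definition test_fun :: "(real^'n::finite) set \<Rightarrow> (real^'n \<Rightarrow> real) \<Rightarrow> bool" where
  "test_fun U \<psi> \<longleftrightarrow> smooth_fun \<psi> \<and> compact (closure {x. \<psi> x \<noteq> 0})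
                     \<and> closure {x. \<psi> x \<noteq> 0} \<subseteq> U"

definition loc_integrable :: "(real^'n::finite) set \<Rightarrow> (real^'n \<Rightarrow> real) \<Rightarrow> bool" where
  "loc_integrable U f \<longleftrightarrow> (\<forall>K. compact K \<and> K \<subseteq> U \<longrightarrow> set_integrable lebesgue K f)"

definition weak_grad :: "(real^'n::finite) set \<Rightarrow> (real^'n \<Rightarrow> real) \<Rightarrow> (real^'n \<Rightarrow> real^'n) \<Rightarrow> bool" where
  "weak_grad U f g \<longleftrightarrow> loc_integrable U f \<and> (\<forall>i. loc_integrable U (\<lambda>x. g x $ i)) \<and>
     (\<forall>\<psi> i. test_fun U \<psi> \<longrightarrow>
        (LINT x:U|lebesgue. f x * pderiv_i i \<psi> x) = - (LINT x:U|lebesgue. g x $ i * \<psi> x))"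

definition weakly_diff :: "(real^'n::finite) set \<Rightarrow> (real^'n \<Rightarrow> real) \<Rightarrow> bool" where
  "weakly_diff U f \<longleftrightarrow> (\<exists>g. weak_grad U f g)"

text \<open>The (a.e. determined) weak gradient.\<close>
definition wgrad :: "(real^'n::finite) set \<Rightarrow> (real^'n \<Rightarrow> real) \<Rightarrow> real^'n \<Rightarrow> real^'n" where
  "wgrad U f = (SOME g. weak_grad U f g)"

definition in_L1p :: "(real^'n::finite) set \<Rightarrow> real \<Rightarrow> (real^'n \<Rightarrow> real) \<Rightarrow> bool" where
  "in_L1p U s f \<longleftrightarrow> weakly_diff U f \<and>
     (\<integral>\<^sup>+ x \<in> U. ennreal (norm (wgrad U f x) powr s) \<partial>lebesgue) < \<infinity>"

definition L1p_seminorm :: "(real^'n::finite) set \<Rightarrow> real \<Rightarrow> (real^'n \<Rightarrow> real) \<Rightarrow> real" where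
  "L1p_seminorm U s f =
     enn2real (\<integral>\<^sup>+ x \<in> U. ennreal (norm (wgrad U f x) powr s) \<partial>lebesgue) powr (1 / s)"

definition in_L1inf :: "(real^'n::finite) set \<Rightarrow> (real^'n \<Rightarrow> real) \<Rightarrow> bool" where
  "in_L1inf U f \<longleftrightarrow> weakly_diff U f \<and>
     (\<exists>C. AE x in lebesgue. x \<in> U \<longrightarrow> norm (wgrad U f x) \<le> C)"

definition L1inf_seminorm :: "(real^'n::finite) set \<Rightarrow> (real^'n \<Rightarrow> real) \<Rightarrow> real" where
  "L1inf_seminorm U f = Inf {C. C \<ge> 0 \<and> (AE x in lebesgue. x \<in> U \<longrightarrow> norm (wgrad U f x) \<le> C)}"

definition map_in_L1p :: "(real^'n::finite) set \<Rightarrow> real \<Rightarrow> (real^'n \<Rightarrow> real^'n) \<Rightarrow> bool" where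
  "map_in_L1p U s \<phi> \<longleftrightarrow> (\<forall>i. in_L1p U s (\<lambda>x. \<phi> x $ i))"

definition map_in_L1inf :: "(real^'n::finite) set \<Rightarrow> (real^'n \<Rightarrow> real^'n) \<Rightarrow> bool" where
  "map_in_L1inf U \<phi> \<longleftrightarrow> (\<forall>i. in_L1inf U (\<lambda>x. \<phi> x $ i))"

definition weak_jac :: "(real^'n::finite) set \<Rightarrow> (real^'n \<Rightarrow> real^'n) \<Rightarrow> real^'n \<Rightarrow> real^'n^'n" where
  "weak_jac U \<phi> x = (\<chi> i. wgrad U (\<lambda>y. \<phi> y $ i) x)"

definition jac_det :: "(real^'n::finite) set \<Rightarrow> (real^'n \<Rightarrow> real^'n) \<Rightarrow> real^'n \<Rightarrow> real" where
  "jac_det U \<phi> x = det (weak_jac U \<phi> x)"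

definition min_stretch :: "real^'n^'n::finite \<Rightarrow> real" where
  "min_stretch A = Inf {norm (A *v h) | h. norm h = 1}"

definition finite_distortion :: "(real^'n::finite) set \<Rightarrow> (real^'n \<Rightarrow> real^'n) \<Rightarrow> bool" where
  "finite_distortion U \<phi> \<longleftrightarrow> (\<forall>i. weakly_diff U (\<lambda>x. \<phi> x $ i)) \<and>
     (AE x in lebesgue. x \<in> U \<and> jac_det U \<phi> x = 0 \<longrightarrow> weak_jac U \<phi> x = 0)"

definition inner_dist :: "real \<Rightarrow> (real^'n::finite) set \<Rightarrow> (real^'n \<Rightarrow> real^'n) \<Rightarrow> real^'n \<Rightarrow> real" where
  "inner_dist s U \<phi> x =
     (if jac_det U \<phi> x \<noteq> 0
      then \<bar>jac_det U \<phi> x\<bar> powr (1 / s) / min_stretch (weak_jac U \<phi> x) else 0)"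

definition luzin_N :: "(real^'n::finite) set \<Rightarrow> (real^'n \<Rightarrow> real^'n) \<Rightarrow> bool" where
  "luzin_N U \<phi> \<longleftrightarrow> (\<forall>E. E \<subseteq> U \<and> E \<in> null_sets lebesgue \<longrightarrow> \<phi> ` E \<in> null_sets lebesgue)"

definition luzin_N_inv :: "(real^'n::finite) set \<Rightarrow> (real^'n \<Rightarrow> real^'n) \<Rightarrow> bool" where
  "luzin_N_inv V \<psi> \<longleftrightarrow> (\<forall>E. E \<in> null_sets lebesgue \<longrightarrow> {y \<in> V. \<psi> y \<in> E} \<in> null_sets lebesgue)"

text \<open>The homeomorphism psi : V -> U generates a bounded composition operator
  psi^* : L^1_infinity(U) -> L^1_s(V).  Elements of L^1_infinity(U) are taken in their
  refined representative, which is the continuous (locally Lipschitz) one; compositions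
  are then defined everywhere on V.\<close>
definition bdd_comp_op_inf :: "(real^'n::finite) set \<Rightarrow> (real^'n \<Rightarrow> real^'n) \<Rightarrow> (real^'n) set \<Rightarrow> real \<Rightarrow> bool" where
  "bdd_comp_op_inf V \<psi> U s \<longleftrightarrow> (\<exists>K::real. \<forall>f. continuous_on U f \<and> in_L1inf U f \<longrightarrow>
       in_L1p V s (f \<circ> \<psi>) \<and> L1p_seminorm V s (f \<circ> \<psi>) \<le> K * L1inf_seminorm U f)"

end

theory Submission
  imports Defs
begin

text \<open>
  A continuous function with bounded weak gradient is locally Lipschitz and, at every Lebesgue point of the
  gradient, differentiable with that derivative. Hence \<open>\<phi>\<close> maps null sets to null sets, so \<open>\<psi>\<close> sends
  almost every point of \<open>\<Omega>'\<close> to a point where a given \<open>f \<in> L\<^sup>1\<^sub>\<infinity>(\<Omega>)\<close> is differentiable; mollifying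
  \<open>f\<close> and \<open>\<psi>\<close> then gives the weak chain rule \<open>\<nabla>(f \<circ> \<psi>) = \<Sum>\<^sub>k \<partial>\<^sub>k f(\<psi>) \<nabla>\<psi>\<^sub>k\<close>, so that \<open>\<psi> \<in> L\<^sup>1\<^sub>s\<close> bounds the operator.

  In the other direction the coordinate functions show \<open>\<psi> \<in> L\<^sup>1\<^sub>s\<close>. Where \<open>D\<phi>\<close> is invertible, \<open>\<psi>\<close> is differentiable
  at the image point with derivative \<open>(D\<phi>)\<^sup>-\<^sup>1\<close>, which must agree almost everywhere with the weak derivative of \<open>\<psi>\<close>.
  Since \<open>1 / l(D\<phi>)\<close> is at most the sum of the norms of the rows of \<open>(D\<phi>)\<^sup>-\<^sup>1\<close>, the change of variables \<open>y = \<phi> x\<close>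
  turns \<open>\<integral> K\<^sup>I\<^sub>s(x, \<phi>)\<^sup>s dx\<close> into an integral dominated by \<open>\<integral> |D\<psi>|\<^sup>s dy\<close>.
\<close>

section \<open>Lebesgue points\<close>


text \<open>Weak gradients are determined only up to null sets, so \<open>\<nabla>f(\<psi>)\<close>
  has a meaning only if null sets have null preimages under \<open>\<psi>\<close>. That is the role
  of the Luzin condition: it keeps the almost everywhere convergence of the mollified gradients of
  \<open>f\<close> alive after composition. Convergence in L1 alone would not suffice, since the
  chain rule multiplies these gradients by the merely integrable gradients of \<open>\<psi>\<close>;
  the uniform bound on them, special to the exponent infinity, supplies the dominating function.
  Lebesgue points are the common device behind both directions: at such points mollifications
  converge, a bounded weak gradient becomes a classical one, and a weak gradient coincides with any
  classical derivative that happens to exist. In the estimate of the inner distortion the set where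
  the Jacobian determinant vanishes costs nothing, because \<open>inner_dist\<close> is 0 there by
  definition. What remains is a set on which \<open>\<phi>\<close> is injective and differentiable
  with invertible derivative, so a change of variables for pointwise differentiable maps is
  enough.\<close>

definition lebesgue_point :: "('a::euclidean_space \<Rightarrow> real) \<Rightarrow> 'a \<Rightarrow> bool" where
  "lebesgue_point f x \<longleftrightarrow> (\<forall>e>0. \<exists>d>0. \<forall>r. 0 < r \<and> r < d \<longrightarrow>
     (\<integral>\<^sup>+ z\<in>ball x r. ennreal \<bar>f z - f x\<bar> \<partial>lebesgue) \<le> ennreal e * emeasure lebesgue (ball x r))"

text \<open>A measurable function is an almost everywhere limit of continuous functions
  \<open>g n\<close>. Truncating values at height \<open>N\<close> by \<open>T\<close> and cutting
  off outside the ball of radius \<open>N + 1\<close> by \<open>c\<close> preserves continuity and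
  makes the result integrable. Dominated convergence is used twice: for the truncations
  \<open>F N\<close> of \<open>f\<close>, and then, with \<open>M\<close> fixed, for the truncations
  \<open>G n\<close> of \<open>g n\<close>.\<close>

lemma continuous_dense_L1:
  fixes f :: "'a::euclidean_space \<Rightarrow> real"
  assumes f: "integrable lebesgue f" and "e > 0"
  obtains g where "continuous_on UNIV g" "integrable lebesgue g" "(LINT x|lebesgue. \<bar>f x - g x\<bar>) < e"
proof -
  have fm: "f \<in> borel_measurable lebesgue" using f by auto
  have "f measurable_on UNIV"
    by (rule lebesgue_measurable_imp_measurable_on[OF fm]) simp
  then obtain N g where N: "negligible N" and gc: "\<And>n. continuous_on UNIV (g n)"
    and lim: "\<And>x. x \<notin> N \<Longrightarrow> (\<lambda>n::nat. g n x) \<longlonglongrightarrow> f x"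
    unfolding measurable_on_def by auto
  define c where "c N x = max 0 (min 1 (real N + 1 - norm x))" for N::nat and x :: 'a
  define T where "T N y = max (- real N) (min (real N) y)" for N::nat and y
  define F where "F N x = T N (f x) * c N x" for N x
  have gm: "g n \<in> borel_measurable lebesgue" for n
    using gc[of n] by (simp add: borel_measurable_continuous_onI measurable_completion)
  have cm: "c N \<in> borel_measurable lebesgue" for N
    unfolding c_def by (intro measurable_completion) (simp add: borel_measurable_continuous_onI continuous_intros)
  have Fm: "F N \<in> borel_measurable lebesgue" for N
    unfolding F_def T_def using fm cm by measurable
  have Tle: "\<bar>T N y\<bar> \<le> \<bar>y\<bar>" "\<bar>T N y\<bar> \<le> real N" for N y by (auto simp: T_def)
  have cle: "0 \<le> c N x" "c N x \<le> 1" for N x by (auto simp: c_def)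
  have Fle: "\<bar>F N x\<bar> \<le> \<bar>f x\<bar>" for N x
    using mult_mono[OF Tle(1)[of N "f x"] cle(2)[of N x]] cle[of N x] by (simp add: F_def abs_mult)
  have Flim: "(\<lambda>N. F N x) \<longlonglongrightarrow> f x" for x
  proof (rule tendsto_eventually)
    show "\<forall>\<^sub>F N in sequentially. F N x = f x"
    proof (rule eventually_sequentiallyI)
      fix M assume "M \<ge> nat \<lceil>\<bar>f x\<bar> + norm x\<rceil>"
      then have "\<bar>f x\<bar> + norm x \<le> real M" by linarith
      then have "- real M \<le> f x" "f x \<le> real M" "norm x \<le> real M" using norm_ge_zero[of x] by linarith+
      then show "F M x = f x"
        using norm_ge_zero[of x] by (auto simp: F_def T_def c_def)
    qed
  qed
  have "(\<lambda>N. LINT x|lebesgue. \<bar>f x - F N x\<bar>) \<longlonglongrightarrow> (LINT x|(lebesgue::'a measure). 0)"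
  proof (rule integral_dominated_convergence[where w="\<lambda>x. 2 * \<bar>f x\<bar>"])
    show "AE x in lebesgue. (\<lambda>N. \<bar>f x - F N x\<bar>) \<longlonglongrightarrow> 0"
      using Flim by (auto intro!: AE_I2 tendsto_eq_intros)
    show "AE x in lebesgue. norm \<bar>f x - F N x\<bar> \<le> 2 * \<bar>f x\<bar>" for N
    proof (rule AE_I2)
      fix x show "norm \<bar>f x - F N x\<bar> \<le> 2 * \<bar>f x\<bar>" using Fle[of N x] by auto
    qed
  qed (use f fm Fm in auto)
  then have "\<forall>\<^sub>F N in sequentially. (LINT x|lebesgue. \<bar>f x - F N x\<bar>) < e/2"
    using \<open>e > 0\<close> by (intro order_tendstoD) auto
  then obtain M where M: "(LINT x|lebesgue. \<bar>f x - F M x\<bar>) < e/2"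
    unfolding eventually_sequentially by blast
  define G where "G n x = T M (g n x) * c M x" for n x
  have Gc: "continuous_on UNIV (G n)" for n
    unfolding G_def T_def c_def using gc[of n] by (intro continuous_intros) auto
  have Gm: "G n \<in> borel_measurable lebesgue" for n
    using Gc[of n] by (simp add: borel_measurable_continuous_onI measurable_completion)
  define w where "w x = real M * indicator (cball (0::'a) (real M + 1)) x" for x
  have wi: "integrable lebesgue w"
    unfolding w_def
  proof (intro integrable_mult_right integrable_real_indicator)
    show "emeasure lebesgue (cball (0::'a) (real M + 1)) < \<infinity>"
      using emeasure_lborel_cball_finite by (simp add: emeasure_completion)
  qed simp
  have bd: "\<bar>T M y * c M x\<bar> \<le> w x" for x y
  proof (cases "norm x \<le> real M + 1")
    case True then show ?thesis using mult_mono[OF Tle(2)[of M y] cle(2)[of M x]] cle[of M x] by (simp add: w_def abs_mult)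
  next
    case False then show ?thesis by (simp add: w_def c_def)
  qed
  have Gi: "integrable lebesgue (G n)" for n
    by (rule Bochner_Integration.integrable_bound[OF wi Gm]) (use bd in \<open>auto simp: G_def intro: order_trans[OF _ abs_ge_self]\<close>)
  have Fi: "integrable lebesgue (F M)"
    by (rule Bochner_Integration.integrable_bound[OF f Fm]) (use Fle in auto)
  have Nnull: "N \<in> null_sets lebesgue" using N by (simp add: negligible_iff_null_sets)
  have "(\<lambda>n. LINT x|lebesgue. \<bar>F M x - G n x\<bar>) \<longlonglongrightarrow> (LINT x|(lebesgue::'a measure). 0)"
  proof (rule integral_dominated_convergence[where w="\<lambda>x. 2 * w x"])
    show "AE x in lebesgue. (\<lambda>n. \<bar>F M x - G n x\<bar>) \<longlonglongrightarrow> 0"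
    proof (rule AE_I'[OF Nnull], safe)
      fix x assume "\<not> (\<lambda>n. \<bar>F M x - G n x\<bar>) \<longlonglongrightarrow> 0"
      moreover have "(\<lambda>n. \<bar>F M x - G n x\<bar>) \<longlonglongrightarrow> 0" if "x \<notin> N"
      proof -
        have "(\<lambda>n. \<bar>F M x - G n x\<bar>) \<longlonglongrightarrow> \<bar>F M x - F M x\<bar>"
          unfolding F_def G_def T_def
          by (intro tendsto_rabs tendsto_diff tendsto_mult tendsto_max tendsto_min tendsto_const lim[OF that])
        then show ?thesis by simp
      qed
      ultimately show "x \<in> N" by blast
    qed
    show "AE x in lebesgue. norm \<bar>F M x - G n x\<bar> \<le> 2 * w x" for n
    proof (rule AE_I2)
      fix x show "norm \<bar>F M x - G n x\<bar> \<le> 2 * w x"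
        using bd[of "f x" x] bd[of "g n x" x] unfolding F_def G_def by auto
    qed
  qed (use wi Gm Fm in \<open>auto intro: borel_measurable_diff\<close>)
  then have "\<forall>\<^sub>F n in sequentially. (LINT x|lebesgue. \<bar>F M x - G n x\<bar>) < e/2"
    using \<open>e > 0\<close> by (intro order_tendstoD) auto
  then obtain m where m: "(LINT x|lebesgue. \<bar>F M x - G m x\<bar>) < e/2"
    unfolding eventually_sequentially by blast
  have "(LINT x|lebesgue. \<bar>f x - G m x\<bar>) \<le> (LINT x|lebesgue. \<bar>f x - F M x\<bar> + \<bar>F M x - G m x\<bar>)"
    by (rule integral_mono) (use f Fi Gi in auto)
  also have "\<dots> = (LINT x|lebesgue. \<bar>f x - F M x\<bar>) + (LINT x|lebesgue. \<bar>F M x - G m x\<bar>)"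
    by (rule Bochner_Integration.integral_add) (use f Fi Gi in auto)
  also have "\<dots> < e" using M m by simp
  finally show ?thesis using that Gc Gi by blast
qed

text \<open>The weak type bound for the maximal function, with constant 1: the offending balls at a
  point can be taken arbitrarily small, so Vitali's theorem covers \<open>A\<close> by disjoint ones
  up to a null set, without enlarging any ball. \<open>A\<close> is not known to be measurable,
  hence the measurable superset \<open>T\<close>.\<close>

lemma maximal_function_weak_bound:
  fixes h :: "'a::euclidean_space \<Rightarrow> real"
  assumes hm: "h \<in> borel_measurable lebesgue" and a: "a > 0"
  defines "A \<equiv> {x. \<forall>d>0. \<exists>r. 0 < r \<and> r < d \<and>
      ennreal a * emeasure lebesgue (ball x r) < (\<integral>\<^sup>+ z\<in>ball x r. ennreal \<bar>h z\<bar> \<partial>lebesgue)}"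
  obtains T where "T \<in> sets lebesgue" "A \<subseteq> T" "ennreal a * emeasure lebesgue T \<le> (\<integral>\<^sup>+ z. ennreal \<bar>h z\<bar> \<partial>lebesgue)"
proof -
  define K where "K = {(x,r). x \<in> A \<and> 0 < r \<and> 
     ennreal a * emeasure lebesgue (ball x r) < (\<integral>\<^sup>+ z\<in>ball x r. ennreal \<bar>h z\<bar> \<partial>lebesgue)}"
  have "\<exists>i. i \<in> K \<and> x \<in> ball (fst i) (snd i) \<and> snd i < d" if "x \<in> A" "0 < d" for x d
  proof -
    obtain r where "0 < r" "r < d" "ennreal a * emeasure lebesgue (ball x r) < (\<integral>\<^sup>+ z\<in>ball x r. ennreal \<bar>h z\<bar> \<partial>lebesgue)"
      using \<open>x \<in> A\<close> \<open>d > 0\<close> unfolding A_def by blast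
    then show ?thesis using \<open>x \<in> A\<close> by (intro exI[of _ "(x,r)"]) (auto simp: K_def)
  qed
  then obtain C where C: "countable C" "C \<subseteq> K" 
    and disj: "pairwise (\<lambda>i j. disjnt (ball (fst i) (snd i)) (ball (fst j) (snd j))) C"
    and neg: "negligible (A - (\<Union>i\<in>C. ball (fst i) (snd i)))"
    by (rule Vitali_covering_theorem_balls[where S=A and K=K and a=fst and r=snd]) auto
  let ?B = "\<lambda>i. ball (fst i) (snd i) :: 'a set"
  let ?n = "density lebesgue (\<lambda>z. ennreal \<bar>h z\<bar>)"
  have dj: "disjoint_family_on ?B C"
    using disj unfolding disjoint_family_on_def pairwise_def disjnt_def by blast
  have U: "(\<Union>i\<in>C. ?B i) \<in> sets lebesgue" by (intro sets.countable_UN' C) auto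
  have "ennreal a * emeasure lebesgue (\<Union>i\<in>C. ?B i) = ennreal a * (\<integral>\<^sup>+ i. emeasure lebesgue (?B i) \<partial>count_space C)"
    by (subst emeasure_UN_countable) (use C dj in auto)
  also have "\<dots> = (\<integral>\<^sup>+ i. ennreal a * emeasure lebesgue (?B i) \<partial>count_space C)"
    by (subst nn_integral_cmult) auto
  also have "\<dots> \<le> (\<integral>\<^sup>+ i. emeasure ?n (?B i) \<partial>count_space C)"
  proof (rule nn_integral_mono)
    fix i assume "i \<in> space (count_space C)"
    then have "i \<in> K" using C by auto
    then show "ennreal a * emeasure lebesgue (?B i) \<le> emeasure ?n (?B i)"
      using hm by (auto simp: K_def emeasure_density)
  qed
  also have "\<dots> = emeasure ?n (\<Union>i\<in>C. ?B i)"
    by (subst emeasure_UN_countable) (use C dj in auto)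
  also have "\<dots> \<le> emeasure ?n (space ?n)" by (rule emeasure_space)
  also have "\<dots> = (\<integral>\<^sup>+ z. ennreal \<bar>h z\<bar> \<partial>lebesgue)"
    using hm by (simp add: emeasure_density)
  finally have *: "ennreal a * emeasure lebesgue (\<Union>i\<in>C. ?B i) \<le> (\<integral>\<^sup>+ z. ennreal \<bar>h z\<bar> \<partial>lebesgue)" .
  let ?Z = "A - (\<Union>i\<in>C. ?B i)"
  have Z: "?Z \<in> null_sets lebesgue" using neg by (simp add: negligible_iff_null_sets)
  show ?thesis
  proof
    show "(\<Union>i\<in>C. ?B i) \<union> ?Z \<in> sets lebesgue" using U null_setsD2[OF Z] by (rule sets.Un)
    show "A \<subseteq> (\<Union>i\<in>C. ?B i) \<union> ?Z" by blast
    show "ennreal a * emeasure lebesgue ((\<Union>i\<in>C. ?B i) \<union> ?Z) \<le> (\<integral>\<^sup>+ z. ennreal \<bar>h z\<bar> \<partial>lebesgue)"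
      using * emeasure_Un_null_set[OF U Z] by simp
  qed
qed

lemma isCont_imp_lebesgue_point:
  assumes "isCont f x"
  shows "lebesgue_point f x"
  unfolding lebesgue_point_def
proof (intro allI impI)
  fix e :: real assume e: "e > 0"
  then obtain d where d: "d > 0" "\<And>z. dist z x < d \<Longrightarrow> dist (f z) (f x) < e"
    using assms unfolding continuous_at_eps_delta by meson
  have "(\<integral>\<^sup>+ z\<in>ball x r. ennreal \<bar>f z - f x\<bar> \<partial>lebesgue) \<le> ennreal e * emeasure lebesgue (ball x r)"
    if "r < d" for r
  proof -
    have "(\<integral>\<^sup>+ z\<in>ball x r. ennreal \<bar>f z - f x\<bar> \<partial>lebesgue) \<le> (\<integral>\<^sup>+ z. ennreal e * indicator (ball x r) z \<partial>lebesgue)"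
    proof (rule nn_integral_mono)
      fix z show "ennreal \<bar>f z - f x\<bar> * indicator (ball x r) z \<le> ennreal e * indicator (ball x r) z"
        using d(2)[of z] that by (cases "z \<in> ball x r") (auto simp: dist_commute dist_real_def intro!: ennreal_leI)
    qed
    then show ?thesis by (simp add: nn_integral_cmult_indicator)
  qed
  then show "\<exists>d>0. \<forall>r. 0 < r \<and> r < d \<longrightarrow>
     (\<integral>\<^sup>+ z\<in>ball x r. ennreal \<bar>f z - f x\<bar> \<partial>lebesgue) \<le> ennreal e * emeasure lebesgue (ball x r)"
    using d(1) by blast
qed

text \<open>Write \<open>f = g + h\<close> with \<open>g\<close> continuous and \<open>h\<close>
  small in L1. On small balls \<open>g\<close> hardly oscillates, so a mean oscillation of
  \<open>f\<close> above \<open>e\<close> has only two possible sources: averages of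
  \<open>|h|\<close> above \<open>e/3\<close>, controlled by the maximal bound, and
  \<open>|h x| \<ge> e/3\<close>, controlled by Markov's inequality.\<close>

theorem AE_lebesgue_point:
  fixes f :: "'a::euclidean_space \<Rightarrow> real"
  assumes f: "integrable lebesgue f"
  shows "AE x in lebesgue. lebesgue_point f x"
proof -
  define N where "N e = {x. \<not> (\<exists>d>0. \<forall>r. 0 < r \<and> r < d \<longrightarrow>
     (\<integral>\<^sup>+ z\<in>ball x r. ennreal \<bar>f z - f x\<bar> \<partial>lebesgue) \<le> ennreal e * emeasure lebesgue (ball x r))}" for e
  have fm: "f \<in> borel_measurable lebesgue" using f by auto
  have Nneg: "negligible (N e)" if e: "e > 0" for e
    unfolding negligible_outer_le
  proof (intro allI impI)
    fix t :: real assume t: "t > 0"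
    \<comment> \<open>Each of the two exceptional sets has measure at most the L1 norm of
      \<open>h\<close> divided by \<open>e/3\<close>, which this choice makes at most
      \<open>t/2\<close>.\<close>
    have "0 < e * t / 6" using e t by simp
    then obtain g where gc: "continuous_on UNIV g" and gi: "integrable lebesgue g" 
      and fg: "(LINT x|lebesgue. \<bar>f x - g x\<bar>) < e*t/6"
      using continuous_dense_L1[OF f] by blast
    define h where "h x = f x - g x" for x
    have hi: "integrable lebesgue h" unfolding h_def using f gi by auto
    then have hm: "h \<in> borel_measurable lebesgue" by auto
    have hI: "(\<integral>\<^sup>+ z. ennreal \<bar>h z\<bar> \<partial>lebesgue) \<le> ennreal (e*t/6)"
      using fg integrable_abs[OF hi] by (subst nn_integral_eq_integral) (auto simp flip: h_def intro!: ennreal_leI)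
    obtain T where T: "T \<in> sets lebesgue" and AT: "{x. \<forall>d>0. \<exists>r. 0 < r \<and> r < d \<and>
      ennreal (e/3) * emeasure lebesgue (ball x r) < (\<integral>\<^sup>+ z\<in>ball x r. ennreal \<bar>h z\<bar> \<partial>lebesgue)} \<subseteq> T"
      and Tm: "ennreal (e/3) * emeasure lebesgue T \<le> (\<integral>\<^sup>+ z. ennreal \<bar>h z\<bar> \<partial>lebesgue)"
      using maximal_function_weak_bound[OF hm, of "e/3"] e by auto
    define H where "H = {x. \<bar>h x\<bar> \<ge> e/3}"
    have Hs: "H \<in> sets lebesgue"
      using borel_measurable_le[OF borel_measurable_const borel_measurable_abs[OF hm], of "e/3"] by (simp add: H_def)
    have Hm: "ennreal (e/3) * emeasure lebesgue H \<le> (\<integral>\<^sup>+ z. ennreal \<bar>h z\<bar> \<partial>lebesgue)"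
    proof -
      have "ennreal (e/3) * emeasure lebesgue H = (\<integral>\<^sup>+ z. ennreal (e/3) * indicator H z \<partial>lebesgue)"
        using Hs by (simp add: nn_integral_cmult_indicator)
      also have "\<dots> \<le> (\<integral>\<^sup>+ z. ennreal \<bar>h z\<bar> \<partial>lebesgue)"
        by (rule nn_integral_mono) (auto simp: H_def indicator_def intro!: ennreal_leI)
      finally show ?thesis .
    qed
    have small: "emeasure lebesgue X \<le> ennreal (t/2)" if "ennreal (e/3) * emeasure lebesgue X \<le> (\<integral>\<^sup>+ z. ennreal \<bar>h z\<bar> \<partial>lebesgue)" for X
    proof -
      have "ennreal (3/e) * (ennreal (e/3) * emeasure lebesgue X) \<le> ennreal (3/e) * ennreal (e*t/6)"
        using that hI by (intro mult_left_mono) auto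
      then show ?thesis using e t by (simp add: mult.assoc[symmetric] ennreal_mult[symmetric])
    qed
    have "emeasure lebesgue (T \<union> H) \<le> emeasure lebesgue T + emeasure lebesgue H"
      by (rule emeasure_subadditive) (use T Hs in auto)
    also have "\<dots> \<le> ennreal (t/2) + ennreal (t/2)" by (intro add_mono small Tm Hm)
    also have "\<dots> = ennreal t" using t by (simp flip: ennreal_plus)
    finally have TH: "emeasure lebesgue (T \<union> H) \<le> ennreal t" .
    have sub: "N e \<subseteq> T \<union> H"
    proof (rule subsetI, rule ccontr)
      fix x assume x: "x \<in> N e" "x \<notin> T \<union> H"
      then have "x \<notin> T" by auto
      then have "\<not> (\<forall>d>0. \<exists>r. 0 < r \<and> r < d \<and>
          ennreal (e/3) * emeasure lebesgue (ball x r) < (\<integral>\<^sup>+ z\<in>ball x r. ennreal \<bar>h z\<bar> \<partial>lebesgue))"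
        using AT by blast
      then obtain d where d0: "d > 0" and nd: "\<not> (\<exists>r. 0 < r \<and> r < d \<and>
          ennreal (e/3) * emeasure lebesgue (ball x r) < (\<integral>\<^sup>+ z\<in>ball x r. ennreal \<bar>h z\<bar> \<partial>lebesgue))"
        by blast
      have d: "(\<integral>\<^sup>+ z\<in>ball x r. ennreal \<bar>h z\<bar> \<partial>lebesgue) \<le> ennreal (e/3) * emeasure lebesgue (ball x r)"
        if "0 < r" "r < d" for r
        by (rule leI) (use nd that in blast)
      have hx: "\<bar>h x\<bar> < e/3" using x by (auto simp: H_def)
      have "isCont g x" using gc by (simp add: continuous_on_eq_continuous_at)
      then obtain d' where d': "d' > 0" "\<And>z. dist x z < d' \<Longrightarrow> \<bar>g z - g x\<bar> < e/3"
      proof -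
        obtain d' where "d' > 0" "\<And>z. dist z x < d' \<Longrightarrow> dist (g z) (g x) < e/3"
          using \<open>isCont g x\<close>[unfolded continuous_at_eps_delta, rule_format, of "e/3"] e by auto
        then show ?thesis using that[of d'] by (auto simp: dist_commute dist_real_def)
      qed
      have "(\<integral>\<^sup>+ z\<in>ball x r. ennreal \<bar>f z - f x\<bar> \<partial>lebesgue) \<le> ennreal e * emeasure lebesgue (ball x r)"
        if r: "0 < r" "r < min d d'" for r
      proof -
        have "(\<integral>\<^sup>+ z\<in>ball x r. ennreal \<bar>f z - f x\<bar> \<partial>lebesgue)
           \<le> (\<integral>\<^sup>+ z. ennreal \<bar>h z\<bar> * indicator (ball x r) z + ennreal (2*e/3) * indicator (ball x r) z \<partial>lebesgue)"
        proof (rule nn_integral_mono)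
          fix z
          have "ennreal \<bar>f z - f x\<bar> \<le> ennreal \<bar>h z\<bar> + ennreal (2*e/3)" if "z \<in> ball x r"
          proof -
            have "\<bar>g z - g x\<bar> < e/3" using d' that r by auto
            then have "\<bar>f z - f x\<bar> \<le> \<bar>h z\<bar> + 2*e/3" using hx unfolding h_def by linarith
            then show ?thesis using e by (simp add: ennreal_leI flip: ennreal_plus)
          qed
          then show "ennreal \<bar>f z - f x\<bar> * indicator (ball x r) z \<le> ennreal \<bar>h z\<bar> * indicator (ball x r) z + ennreal (2*e/3) * indicator (ball x r) z"
            by (auto simp: indicator_def)
        qed
        also have "\<dots> = (\<integral>\<^sup>+ z\<in>ball x r. ennreal \<bar>h z\<bar> \<partial>lebesgue) + ennreal (2*e/3) * emeasure lebesgue (ball x r)"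
        proof (subst nn_integral_add)
          have b: "ball x r \<in> sets lebesgue" by simp
          show "(\<lambda>z. ennreal \<bar>h z\<bar> * indicator (ball x r) z) \<in> borel_measurable lebesgue"
            by (rule borel_measurable_times_ennreal[OF measurable_compose[OF borel_measurable_abs[OF hm] measurable_ennreal] borel_measurable_indicator[OF b]])
          show "(\<lambda>z. ennreal (2 * e / 3) * indicator (ball x r) z) \<in> borel_measurable lebesgue"
            by (rule borel_measurable_times_ennreal[OF borel_measurable_const borel_measurable_indicator[OF b]])
        qed (simp add: nn_integral_cmult_indicator)
        also have "\<dots> \<le> ennreal (e/3) * emeasure lebesgue (ball x r) + ennreal (2*e/3) * emeasure lebesgue (ball x r)"
          using d r by (intro add_mono) auto
        also have "\<dots> = ennreal e * emeasure lebesgue (ball x r)"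
          using e by (simp flip: distrib_right ennreal_plus)
        finally show ?thesis .
      qed
      moreover have "min d d' > 0" using d0 d'(1) by simp
      ultimately have "x \<notin> N e" unfolding N_def by blast
      then show False using x by simp
    qed
    have fin: "T \<union> H \<in> lmeasurable" using TH T Hs by (auto simp: fmeasurable_def intro: le_less_trans)
    have "measure lebesgue (T \<union> H) \<le> t"
      using TH t by (simp add: measure_def enn2real_leI)
    then show "\<exists>Ta. N e \<subseteq> Ta \<and> Ta \<in> lmeasurable \<and> measure lebesgue Ta \<le> t"
      using sub fin by blast
  qed
  have "negligible (\<Union>n. N (1 / real (Suc n)))" by (rule negligible_countable_Union) (use Nneg in auto)
  then have "(\<Union>n. N (1 / real (Suc n))) \<in> null_sets lebesgue" by (simp add: negligible_iff_null_sets)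
  then show ?thesis
  proof (rule AE_I', safe)
    fix x assume "\<not> lebesgue_point f x"
    then obtain e where e: "e > 0" "x \<in> N e" unfolding lebesgue_point_def N_def by auto
    then obtain n where n: "1 / real (Suc n) < e" using nat_approx_posE by blast
    have "ennreal (1 / real (Suc n)) * c \<le> ennreal e * c" for c
      using n by (intro mult_right_mono ennreal_leI) auto
    then have "N e \<subseteq> N (1 / real (Suc n))" unfolding N_def by (blast intro: order_trans)
    then show "x \<in> (\<Union>n. N (1 / real (Suc n)))" using e by blast
  qed
qed

section \<open>Smooth functions\<close>

definition grad :: "(real^'n::finite \<Rightarrow> real) \<Rightarrow> real^'n \<Rightarrow> real^'n" where
  "grad f x = (\<chi> i. pderiv_i i f x)"

lemma pderiv_i_eq: "(f has_derivative f') (at x) \<Longrightarrow> pderiv_i i f x = f' (axis i 1)"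
  unfolding pderiv_i_def by (metis frechet_derivative_at)

lemma has_derivative_grad:
  assumes "f differentiable (at x)"
  shows "(f has_derivative (\<lambda>h. grad f x \<bullet> h)) (at x)"
proof -
  obtain f' where f': "(f has_derivative f') (at x)" using assms by (auto simp: differentiable_def)
  have lin: "linear f'" using f' has_derivative_linear by blast
  have "f' h = grad f x \<bullet> h" for h
  proof -
    have "f' h = f' (\<Sum>i\<in>UNIV. h $ i *\<^sub>R axis i 1)" by (simp add: basis_expansion scalar_mult_eq_scaleR[symmetric])
    also have "\<dots> = (\<Sum>i\<in>UNIV. h $ i * f' (axis i 1))"
      by (simp add: linear_sum[OF lin] linear_cmul[OF lin])
    also have "\<dots> = grad f x \<bullet> h"
      by (simp add: grad_def inner_vec_def pderiv_i_eq[OF f'] mult.commute)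
    finally show ?thesis .
  qed
  then have "f' = (\<lambda>h. grad f x \<bullet> h)" by blast
  then show ?thesis using f' by simp
qed

lemma grad_eq:
  assumes "(f has_derivative (\<lambda>h. v \<bullet> h)) (at x)"
  shows "grad f x = v"
  by (simp add: vec_eq_iff grad_def pderiv_i_eq[OF assms] inner_axis)

lemma onorm_inner_le: "norm v \<le> B \<Longrightarrow> onorm ((\<bullet>) v) \<le> B"
proof (rule onorm_bound)
  assume v: "norm v \<le> B"
  show "0 \<le> B" using v norm_ge_zero[of v] by linarith
  show "norm (v \<bullet> h) \<le> B * norm h" for h
    using Cauchy_Schwarz_ineq2[of v h] mult_right_mono[OF v norm_ge_zero[of h]] by simp
qed

lemma Ck_fun_cont: "Ck_fun k f \<Longrightarrow> continuous_on UNIV f"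
  by (cases k) auto

lemma Ck_fun_SucD: "Ck_fun (Suc k) f \<Longrightarrow> Ck_fun k f"
  by (induction k arbitrary: f) auto

lemma Ck_fun_const: "Ck_fun k (\<lambda>x. c)"
proof (induction k arbitrary: c)
  case (Suc k)
  have "pderiv_i i (\<lambda>x::real^'a. c) = (\<lambda>x. 0)" for i
    by (rule ext, subst pderiv_i_eq[OF has_derivative_const]) simp
  then show ?case using Suc by simp
qed auto

lemma Ck_fun_component: "Ck_fun k (\<lambda>x. x $ i)"
proof (cases k)
  case (Suc m)
  have D: "((\<lambda>x::real^'a. x $ i) has_derivative (\<lambda>h. h $ i)) (at x)" for x
    by (intro bounded_linear_imp_has_derivative bounded_linear_vec_nth)
  have "pderiv_i j (\<lambda>x::real^'a. x $ i) = (\<lambda>x. axis j 1 $ i)" for j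
    by (rule ext, subst pderiv_i_eq[OF D]) simp
  moreover have "(\<lambda>x::real^'a. x $ i) differentiable (at x)" for x using D by (rule differentiableI)
  ultimately show ?thesis using Suc Ck_fun_const by (auto intro!: continuous_intros)
qed (auto intro: continuous_intros)

lemma Ck_fun_add: "Ck_fun k f \<Longrightarrow> Ck_fun k g \<Longrightarrow> Ck_fun k (\<lambda>x. f x + g x)"
proof (induction k arbitrary: f g)
  case (Suc k)
  have "pderiv_i i (\<lambda>x. f x + g x) = (\<lambda>x. pderiv_i i f x + pderiv_i i g x)" for i
  proof
    fix x
    have "((\<lambda>x. f x + g x) has_derivative (\<lambda>h. grad f x \<bullet> h + grad g x \<bullet> h)) (at x)"
      using Suc.prems by (intro has_derivative_add has_derivative_grad) auto
    from pderiv_i_eq[OF this] show "pderiv_i i (\<lambda>x. f x + g x) x = pderiv_i i f x + pderiv_i i g x"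
      by (simp add: inner_axis grad_def)
  qed
  then show ?case using Suc by (auto intro!: continuous_intros)
qed (auto intro: continuous_intros)

lemma Ck_fun_mult: "Ck_fun k f \<Longrightarrow> Ck_fun k g \<Longrightarrow> Ck_fun k (\<lambda>x. f x * g x)"
proof (induction k arbitrary: f g)
  case (Suc k)
  have "pderiv_i i (\<lambda>x. f x * g x) = (\<lambda>x. f x * pderiv_i i g x + pderiv_i i f x * g x)" for i
  proof
    fix x
    have "((\<lambda>x. f x * g x) has_derivative (\<lambda>h. f x * (grad g x \<bullet> h) + (grad f x \<bullet> h) * g x)) (at x)"
      using Suc.prems by (intro has_derivative_mult has_derivative_grad) auto
    from pderiv_i_eq[OF this] show "pderiv_i i (\<lambda>x. f x * g x) x = f x * pderiv_i i g x + pderiv_i i f x * g x"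
      by (simp add: inner_axis grad_def)
  qed
  moreover have "Ck_fun k f" "Ck_fun k g" using Suc.prems Ck_fun_SucD by blast+
  ultimately show ?case using Suc by (auto intro!: continuous_intros Ck_fun_add)
qed (auto intro: continuous_intros)

lemma Ck_fun_affine: "Ck_fun k f \<Longrightarrow> Ck_fun k (\<lambda>x. f (c *\<^sub>R x + d))"
proof (induction k arbitrary: f)
  case (Suc k)
  have D: "((\<lambda>x. f (c *\<^sub>R x + d)) has_derivative (\<lambda>h. grad f (c *\<^sub>R x + d) \<bullet> (c *\<^sub>R h))) (at x)" for x
  proof (rule has_derivative_compose[where f="\<lambda>x. c *\<^sub>R x + d" and f'="\<lambda>h. c *\<^sub>R h"])
    show "((\<lambda>x. c *\<^sub>R x + d) has_derivative (\<lambda>h. c *\<^sub>R h)) (at x)"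
      by (auto intro!: derivative_eq_intros)
    show "(f has_derivative (\<lambda>h. grad f (c *\<^sub>R x + d) \<bullet> h)) (at (c *\<^sub>R x + d))"
      using Suc.prems by (intro has_derivative_grad) auto
  qed
  have "pderiv_i i (\<lambda>x. f (c *\<^sub>R x + d)) = (\<lambda>x. c * pderiv_i i f (c *\<^sub>R x + d))" for i
    by (rule ext, subst pderiv_i_eq[OF D]) (simp add: inner_axis grad_def)
  moreover have "continuous_on UNIV f" using Suc.prems by simp
  then have "continuous_on UNIV (\<lambda>x. f (c *\<^sub>R x + d))"
    by (rule continuous_on_compose2) (auto intro!: continuous_intros)
  moreover have "(\<lambda>x. f (c *\<^sub>R x + d)) differentiable (at x)" for x using D by (rule differentiableI)
  ultimately show ?case using Suc by (auto intro!: Ck_fun_mult Ck_fun_const)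
next
  case 0
  then have "continuous_on UNIV f" by simp
  then have "continuous_on UNIV (\<lambda>x. f (c *\<^sub>R x + d))"
    by (rule continuous_on_compose2) (auto intro!: continuous_intros)
  then show ?case by simp
qed

section \<open>A smooth bump supported in the closed unit ball\<close>

definition flat_exp :: "nat \<Rightarrow> real \<Rightarrow> real" where
  "flat_exp m t = (if t > 0 then (1/t)^m * exp (- (1/t)) else 0)"

text \<open>The factor \<open>(1/t)^m\<close> in \<open>flat_exp\<close> makes the family closed
  under differentiation: differentiating the exponential raises the power by two, differentiating
  the power raises it by one. At 0 every derivative vanishes because the exponential beats all
  powers.\<close>

lemma DERIV_flat_exp:
  "(flat_exp m has_real_derivative (flat_exp (m+2) t - real m * flat_exp (m+1) t)) (at t)"
proof -
  consider "t > 0" | "t < 0" | "t = 0" by linarith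
  then show ?thesis
  proof cases
    case 1
    have "((\<lambda>t. (1/t)^m * exp (- (1/t))) has_real_derivative (flat_exp (m+2) t - real m * flat_exp (m+1) t)) (at t)"
    proof -
      have u: "((\<lambda>t. 1/t) has_real_derivative - ((1/t)^2)) (at t)"
        using 1 by (auto intro!: derivative_eq_intros simp: power2_eq_square)
      have X: "((\<lambda>t. (1/t)^m * exp (- (1/t))) has_real_derivative
          (real m * (- ((1/t)^2) * (1/t) ^ (m - Suc 0))) * exp (- (1/t)) + (exp (- (1/t)) * - (- ((1/t)^2))) * (1/t)^m) (at t)"
        by (rule DERIV_mult[OF DERIV_power[OF u] DERIV_chain2[OF DERIV_exp DERIV_minus[OF u]]])
      \<comment> \<open>For \<open>m = 0\<close> the truncated exponent \<open>m - Suc 0\<close> is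
        harmless, as the factor \<open>real m\<close> vanishes.\<close>
      have "real m * (- ((1/t)^2) * (1/t) ^ (m - Suc 0)) = - (real m * (1/t)^(m+1))"
        by (cases m) (simp_all add: power2_eq_square)
      note X' = X[unfolded this]
      have "- (real m * (1/t)^(m+1)) * exp (- (1/t)) + (exp (- (1/t)) * - (- ((1/t)^2))) * (1/t)^m
         = flat_exp (m+2) t - real m * flat_exp (m+1) t"
        using 1 by (simp add: flat_exp_def power_add power2_eq_square mult_ac)
      then show ?thesis using X' by (simp only:)
    qed
    then show ?thesis
      by (rule has_field_derivative_transform_within_open[where S="{0<..}"]) (use 1 in \<open>auto simp: flat_exp_def\<close>)
  next
    case 2
    have "((\<lambda>t. 0) has_real_derivative 0) (at t)" by simp
    then have "(flat_exp m has_real_derivative 0) (at t)"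
      by (rule has_field_derivative_transform_within_open[where S="{..<0}"]) (use 2 in \<open>auto simp: flat_exp_def\<close>)
    then show ?thesis using 2 by (simp add: flat_exp_def)
  next
    case 3
    have "((\<lambda>h. (flat_exp m (0 + h) - flat_exp m 0) / h) \<longlongrightarrow> 0) (at 0)"
      unfolding filterlim_at_split
    proof
      show "((\<lambda>h. (flat_exp m (0 + h) - flat_exp m 0) / h) \<longlongrightarrow> 0) (at_left 0)"
        by (rule tendsto_eventually) (auto simp: eventually_at_filter flat_exp_def)
      \<comment> \<open>With \<open>x = 1/h\<close> the difference quotient at 0 from the right is
        \<open>x^(m+1) * exp (-x)\<close>.\<close>
      have "((\<lambda>x. x ^ Suc m / exp x) \<longlongrightarrow> 0) (at_top :: real filter)"
        by (rule tendsto_power_div_exp_0)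
      then have "((\<lambda>h. inverse h ^ Suc m / exp (inverse h)) \<longlongrightarrow> 0) (at_right (0::real))"
        by (rule filterlim_compose[OF _ filterlim_inverse_at_top_right])
      then show "((\<lambda>h. (flat_exp m (0 + h) - flat_exp m 0) / h) \<longlongrightarrow> 0) (at_right 0)"
      proof (rule Lim_transform_eventually)
        show "\<forall>\<^sub>F h in at_right 0. inverse h ^ Suc m / exp (inverse h) = (flat_exp m (0 + h) - flat_exp m 0) / h"
          by (auto simp: eventually_at_filter flat_exp_def exp_minus field_simps)
      qed
    qed
    then show ?thesis using 3 by (simp add: DERIV_def flat_exp_def)
  qed
qed

text \<open>The standard mollifier \<open>exp (-1 / (1 - |x|^2))\<close> inside the unit ball; the
  inner product replaces the norm so that the inner function is a polynomial.\<close>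

definition bump :: "real^'n::finite \<Rightarrow> real" where
  "bump x = flat_exp 0 (1 - x \<bullet> x)"

text \<open>Induction on \<open>k\<close> for all \<open>m\<close> at once: a partial derivative is
  a linear factor times a combination of members of the family with larger \<open>m\<close>.\<close>

lemma Ck_fun_flat_exp: "Ck_fun k (\<lambda>x::real^'n::finite. flat_exp m (1 - x \<bullet> x))"
proof (induction k arbitrary: m)
  case 0
  have "isCont (flat_exp m) t" for t using DERIV_isCont[OF DERIV_flat_exp] .
  then have "continuous_on UNIV (flat_exp m)" by (simp add: continuous_on_eq_continuous_at)
  moreover have "continuous_on UNIV (\<lambda>x::real^'n. 1 - x \<bullet> x)" by (intro continuous_intros)
  ultimately have "continuous_on UNIV (\<lambda>x::real^'n. flat_exp m (1 - x \<bullet> x))"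
    by (rule continuous_on_compose2) auto
  then show ?case by simp
next
  case (Suc k)
  let ?d = "\<lambda>t. flat_exp (m+2) t - real m * flat_exp (m+1) t"
  have D: "((\<lambda>x. flat_exp m (1 - x \<bullet> x)) has_derivative (\<lambda>h. (- (2 * (x \<bullet> h))) * ?d (1 - x \<bullet> x))) (at x)" for x :: "real^'n"
  proof (rule has_derivative_compose[where f="\<lambda>x. 1 - x \<bullet> x" and f'="\<lambda>h. - (2 * (x \<bullet> h))" and g="flat_exp m" and g'="\<lambda>y. y * ?d (1 - x \<bullet> x)"])
    show "((\<lambda>x. 1 - x \<bullet> x) has_derivative (\<lambda>h. - (2 * (x \<bullet> h)))) (at x)"
      by (auto intro!: derivative_eq_intros simp: inner_commute)
    show "(flat_exp m has_derivative (\<lambda>y. y * ?d (1 - x \<bullet> x))) (at (1 - x \<bullet> x))"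
      using DERIV_flat_exp[of m "1 - x \<bullet> x"] by (simp add: has_field_derivative_def mult_commute_abs)
  qed
  have pd: "pderiv_i i (\<lambda>x::real^'n. flat_exp m (1 - x \<bullet> x)) 
     = (\<lambda>x. (-2 * x $ i) * (flat_exp (m+2) (1 - x \<bullet> x) + (- real m) * flat_exp (m+1) (1 - x \<bullet> x)))" for i
    by (rule ext, subst pderiv_i_eq[OF D]) (simp add: inner_axis)
  have "Ck_fun k (pderiv_i i (\<lambda>x::real^'n. flat_exp m (1 - x \<bullet> x)))" for i
    unfolding pd by (intro Ck_fun_mult Ck_fun_add Ck_fun_const Ck_fun_component Suc.IH)
  moreover have "continuous_on UNIV (\<lambda>x::real^'n. flat_exp m (1 - x \<bullet> x))"
    using Suc.IH Ck_fun_cont by blast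
  moreover have "(\<lambda>x::real^'n. flat_exp m (1 - x \<bullet> x)) differentiable (at x)" for x using D by (rule differentiableI)
  ultimately show ?case by simp
qed

lemma smooth_fun_bump: "smooth_fun bump"
  unfolding smooth_fun_def bump_def using Ck_fun_flat_exp by blast

lemma smooth_fun_has_derivative:
  assumes "smooth_fun f"
  shows "(f has_derivative (\<lambda>h. grad f x \<bullet> h)) (at x)"
    and "continuous_on UNIV f" and "continuous_on UNIV (grad f)"
proof -
  have C1: "Ck_fun (Suc 0) f" using assms by (auto simp: smooth_fun_def)
  then show "(f has_derivative (\<lambda>h. grad f x \<bullet> h)) (at x)" "continuous_on UNIV f"
    by (auto intro: has_derivative_grad)
  show "continuous_on UNIV (grad f)"
    using C1 unfolding grad_def by (intro continuous_on_vec_lambda) auto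
qed

lemma smooth_fun_scaled: "smooth_fun f \<Longrightarrow> smooth_fun (\<lambda>x. a * f (c *\<^sub>R x + d))"
  unfolding smooth_fun_def by (intro allI Ck_fun_mult Ck_fun_const Ck_fun_affine) blast

lemma grad_translate:
  assumes "f differentiable (at (x - y))"
  shows "grad (\<lambda>z. f (z - y)) x = grad f (x - y)"
proof (rule grad_eq)
  show "((\<lambda>z. f (z - y)) has_derivative (\<lambda>h. grad f (x - y) \<bullet> h)) (at x)"
    by (rule has_derivative_compose[where f="\<lambda>z. z - y" and f'="\<lambda>h. h"])
       (use has_derivative_grad[OF assms] in \<open>auto intro!: derivative_eq_intros\<close>)
qed

lemma bump_nonneg: "bump x \<ge> 0" and bump_le: "bump x \<le> 1" and bump_0: "norm x \<ge> 1 \<Longrightarrow> bump x = 0"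
  and bump_even: "bump (- x) = bump x"
  and bump_ge: "norm x \<le> 1/2 \<Longrightarrow> bump x \<ge> exp (-2)"
proof -
  show "norm x \<ge> 1 \<Longrightarrow> bump x = 0"
    using power_mono[of 1 "norm x" 2] by (simp add: bump_def flat_exp_def power2_norm_eq_inner)
  \<comment> \<open>On the half ball \<open>1 - x \<bullet> x\<close> is at least 1/2, so its
    reciprocal is at most 2; this is the origin of \<open>exp (-2)\<close>.\<close>
  assume "norm x \<le> 1/2"
  then have "x \<bullet> x \<le> (1/2)^2" using power_mono[of "norm x" "1/2" 2] by (simp add: power2_norm_eq_inner)
  then have "x \<bullet> x \<le> 1/2" by (simp add: power2_eq_square)
  then show "bump x \<ge> exp (-2)" by (auto simp: bump_def flat_exp_def field_simps)
qed (auto simp: bump_def flat_exp_def)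

section \<open>Mollifying kernels\<close>

lemma continuous_imp_measurable_lebesgue:
  fixes f :: "'a::euclidean_space \<Rightarrow> 'b::topological_space"
  shows "continuous_on UNIV f \<Longrightarrow> f \<in> borel_measurable lebesgue"
  by (simp add: borel_measurable_continuous_onI measurable_completion)

lemma lebesgue_integral_translate:
  fixes f :: "'a::euclidean_space \<Rightarrow> real"
  assumes "continuous_on UNIV f"
  shows "(LINT z|lebesgue. f (z + c)) = (LINT z|lebesgue. f z)"
proof -
  have 1: "f \<in> borel_measurable borel" using assms by (rule borel_measurable_continuous_onI)
  then have 2: "(\<lambda>z. f (z + c)) \<in> borel_measurable borel" by measurable
  have "(LINT z|lebesgue. f z) = (LINT z|lborel. f z)" using 1 by (simp add: integral_completion)
  also have "\<dots> = (LINT z|distr lborel borel ((+) c). f z)" by (simp add: lborel_distr_plus)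
  also have "\<dots> = (LINT z|lborel. f (z + c))"
    using 1 by (subst integral_distr) (auto simp: add.commute)
  also have "\<dots> = (LINT z|lebesgue. f (z + c))" using 2 by (simp add: integral_completion)
  finally show ?thesis ..
qed

lemma compact_support_bounded:
  fixes g :: "'a::euclidean_space \<Rightarrow> 'b::real_normed_vector"
  assumes "continuous_on UNIV g" "compact K" "\<And>x. x \<notin> K \<Longrightarrow> g x = 0"
  obtains B where "B > 0" "\<And>x. norm (g x) \<le> B"
proof -
  have "compact (g ` K)" using assms by (meson compact_continuous_image continuous_on_subset subset_UNIV)
  then have "bounded (g ` K)" by (rule compact_imp_bounded)
  then obtain B where B: "B > 0" "\<And>y. y \<in> g ` K \<Longrightarrow> norm y \<le> B"
    unfolding bounded_pos by auto
  have "norm (g x) \<le> B" for x using B assms(3)[of x] by (cases "x \<in> K") auto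
  then show ?thesis using that B by blast
qed

text \<open>Integrability of \<open>f\<close> is known only on \<open>K\<close>; the continuous
  factor is bounded and vanishes off \<open>K\<close>, which makes the product integrable on the
  whole space. Kernels and test functions are paired with locally integrable functions in this
  way.\<close>

lemma integrable_mult_compact_support:
  fixes f g :: "'a::euclidean_space \<Rightarrow> real"
  assumes f: "set_integrable lebesgue K f" and g: "continuous_on UNIV g" and K: "compact K"
    and 0: "\<And>x. x \<notin> K \<Longrightarrow> g x = 0"
  shows "integrable lebesgue (\<lambda>x. f x * g x)"
proof -
  obtain B where B: "B > 0" "\<And>x. norm (g x) \<le> B"
    using compact_support_bounded[OF g K 0] by blast
  have eq: "(\<lambda>x. f x * g x) = (\<lambda>x. (indicator K x *\<^sub>R f x) * g x)"
  proof
    fix x show "f x * g x = (indicator K x *\<^sub>R f x) * g x" using 0[of x] by (cases "x \<in> K") simp_all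
  qed
  have fK: "integrable lebesgue (\<lambda>x. indicator K x *\<^sub>R f x)" using f by (simp add: set_integrable_def)
  show ?thesis unfolding eq
  proof (rule Bochner_Integration.integrable_bound)
    show "integrable lebesgue (\<lambda>x. B * (indicator K x *\<^sub>R f x))" using fK by (rule integrable_mult_right)
    show "(\<lambda>x. indicator K x *\<^sub>R f x * g x) \<in> borel_measurable lebesgue"
      using borel_measurable_integrable[OF fK] continuous_imp_measurable_lebesgue[OF g] by (rule borel_measurable_times)
    show "AE x in lebesgue. norm (indicator K x *\<^sub>R f x * g x) \<le> norm (B * (indicator K x *\<^sub>R f x))"
    proof (rule AE_I2)
      fix x
      have "\<bar>indicator K x *\<^sub>R f x\<bar> * \<bar>g x\<bar> \<le> \<bar>indicator K x *\<^sub>R f x\<bar> * B"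
        using B(2)[of x] by (intro mult_left_mono) auto
      then show "norm (indicator K x *\<^sub>R f x * g x) \<le> norm (B * (indicator K x *\<^sub>R f x))"
        using B(1) by (simp add: abs_mult mult.commute mult.left_commute)
    qed
  qed
qed

lemma set_integrable_const_compact:
  "compact K \<Longrightarrow> set_integrable lebesgue K (\<lambda>x::'a::euclidean_space. c::real)"
  unfolding set_integrable_def
  by (intro integrable_scaleR_left integrable_real_indicator)
    (use emeasure_compact_finite[of K] in \<open>auto simp: emeasure_completion borel_compact\<close>)

lemma set_integrable_continuous_compact:
  fixes f :: "'a::euclidean_space \<Rightarrow> real"
  assumes "compact K" "continuous_on K f"
  shows "set_integrable lebesgue K f"
  using borel_integrable_compact[OF assms] unfolding set_integrable_def
  by (intro integrable_completion[THEN iffD2]) auto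

lemma integrable_compact_support:
  fixes g :: "'a::euclidean_space \<Rightarrow> real"
  assumes "continuous_on UNIV g" "compact K" "\<And>x. x \<notin> K \<Longrightarrow> g x = 0"
  shows "integrable lebesgue g"
  using integrable_mult_compact_support[OF set_integrable_const_compact[of K 1] assms(1,2,3)] assms by simp

definition kern_mass :: "'n::finite itself \<Rightarrow> real \<Rightarrow> real" where
  "kern_mass _ e = (LINT z|lebesgue. bump ((1/e) *\<^sub>R z :: real^'n))"

text \<open>The kernel is normalised by its integral rather than by \<open>e\<^sup>-\<^sup>n\<close>, so that no scaling of integrals is needed;
  \<open>kern_mass_ge\<close> compares the two. The summand \<open>0\<close> gives the argument the shape of \<open>smooth_fun_scaled\<close>.\<close>

definition kern :: "real \<Rightarrow> real^'n::finite \<Rightarrow> real" where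
  "kern e z = (1 / kern_mass TYPE('n) e) * bump ((1/e) *\<^sub>R z + 0)"

lemma bump_scaled_0: "e > 0 \<Longrightarrow> norm z \<ge> e \<Longrightarrow> bump ((1/e) *\<^sub>R z) = 0"
  by (rule bump_0) (simp add: field_simps)

lemma continuous_bump: "continuous_on UNIV bump"
  using smooth_fun_has_derivative(2)[OF smooth_fun_bump] .

lemma integrable_bump_scaled: "e > 0 \<Longrightarrow> integrable lebesgue (\<lambda>z::real^'n::finite. bump ((1/e) *\<^sub>R z))"
proof (rule integrable_compact_support[where K="cball 0 e"])
  show "continuous_on UNIV (\<lambda>z::real^'n. bump ((1/e) *\<^sub>R z))"
    by (rule continuous_on_compose2[OF continuous_bump]) (auto intro!: continuous_intros)
qed (auto simp: bump_scaled_0)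

lemma measure_ball_scale:
  assumes "a > 0" "b > 0"
  shows "measure lebesgue (ball (x::real^'n::finite) a) = (a/b) ^ CARD('n) * measure lebesgue (ball (y::real^'n) b)"
  using assms by (simp add: content_ball power_divide)

lemma measure_ball_pos: "e > 0 \<Longrightarrow> measure lebesgue (ball (x::'a::euclidean_space) e) > 0"
  by (simp add: content_ball_pos)

lemma emeasure_ball: "e \<ge> 0 \<Longrightarrow> emeasure lebesgue (ball (x::'a::euclidean_space) e) = ennreal (measure lebesgue (ball x e))"
  using emeasure_lborel_ball_finite[of x e]
  by (subst emeasure_eq_ennreal_measure) (auto simp: emeasure_completion)

text \<open>The loss in comparing the mass of the scaled bump with the volume of its ball:
  \<open>exp 2\<close> because the bump is at least \<open>exp (-2)\<close> on the ball of half the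
  radius, and \<open>2 ^ CARD('n)\<close> because of the ratio of the two volumes.\<close>

definition kern_const :: "'n::finite itself \<Rightarrow> real" where
  "kern_const _ = exp 2 * 2 ^ CARD('n)"

lemma kern_mass_ge:
  assumes e: "e > 0"
  shows "measure lebesgue (ball (0::real^'n::finite) e) \<le> kern_const TYPE('n) * kern_mass TYPE('n) e"
proof -
  have "exp (-2) * measure lebesgue (ball (0::real^'n) (e/2)) = (LINT z|lebesgue. exp (-2) * indicator (ball (0::real^'n) (e/2)) z)"
    by simp
  also have "\<dots> \<le> kern_mass TYPE('n) e" unfolding kern_mass_def
  proof (rule integral_mono)
    show "integrable lebesgue (\<lambda>z. exp (-2) * indicator (ball (0::real^'n) (e/2)) z :: real)"
      using emeasure_lborel_ball_finite[of "0::real^'n" "e/2"]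
      by (intro integrable_mult_right integrable_real_indicator) (auto simp: emeasure_completion)
    show "integrable lebesgue (\<lambda>z::real^'n. bump ((1/e) *\<^sub>R z))" using integrable_bump_scaled[OF e] .
    fix z :: "real^'n"
    show "exp (-2) * indicator (ball 0 (e/2)) z \<le> bump ((1/e) *\<^sub>R z)"
    proof (cases "norm z < e/2")
      case True
      then have "norm ((1/e) *\<^sub>R z) \<le> 1/2" using e by (simp add: field_simps)
      then show ?thesis using True bump_ge[of "(1/e) *\<^sub>R z"] by (simp add: indicator_def)
    qed (auto simp: indicator_def bump_nonneg)
  qed
  finally have "exp (-2) * measure lebesgue (ball (0::real^'n) (e/2)) \<le> kern_mass TYPE('n) e" .
  moreover have "measure lebesgue (ball (0::real^'n) e) = 2 ^ CARD('n) * measure lebesgue (ball (0::real^'n) (e/2))"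
    using measure_ball_scale[of e "e/2" "0::real^'n" 0] e by simp
  ultimately show ?thesis unfolding kern_const_def by (simp add: exp_minus field_simps)
qed

lemma kern_const_pos: "kern_const TYPE('n::finite) > 0" by (simp add: kern_const_def)

lemma kern_mass_pos: "e > 0 \<Longrightarrow> kern_mass TYPE('n::finite) e > 0"
  using kern_mass_ge[of e, where 'n='n] measure_ball_pos[of e "0::real^'n"] kern_const_pos[where 'n='n]
  by (smt (verit) mult_nonneg_nonpos)

context fixes e :: real assumes e: "e > 0" begin

lemma kern_nonneg: "kern e z \<ge> 0"
  using kern_mass_pos[OF e, where 'n='a] by (simp add: kern_def bump_nonneg)

lemma kern_0: "norm z \<ge> e \<Longrightarrow> kern e z = 0"
  by (simp add: kern_def bump_scaled_0[OF e])

lemma kern_even: "kern e (x - y) = kern e (y - x)"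
  using bump_even[of "(1/e) *\<^sub>R (x - y)"] by (simp add: kern_def flip: scaleR_minus_right)

lemma smooth_kern: "smooth_fun (kern e)"
  unfolding kern_def[abs_def] by (intro smooth_fun_scaled smooth_fun_bump)

lemma continuous_kern: "continuous_on UNIV (kern e)"
  using smooth_fun_has_derivative(2)[OF smooth_kern] .

lemma continuous_kern_shift: "continuous_on UNIV (\<lambda>z. kern e (z - y))"
  by (rule continuous_on_compose2[OF continuous_kern]) (auto intro!: continuous_intros)

lemma integrable_kern_shift: "integrable lebesgue (\<lambda>z. kern e (z - y))"
  by (rule integrable_compact_support[OF continuous_kern_shift compact_cball[of y e]])
    (auto simp: dist_norm norm_minus_commute intro!: kern_0)

lemma integral_kern: "(LINT z|lebesgue. kern e (z - y :: real^'n::finite)) = 1"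
proof -
  have "(LINT z|lebesgue. kern e (z - y)) = (LINT z|lebesgue. kern e (z :: real^'n))"
    using lebesgue_integral_translate[OF continuous_kern, of "- y"] by simp
  also have "\<dots> = 1" using kern_mass_pos[OF e, where 'n='n]
    by (simp add: kern_def) (simp add: kern_mass_def)
  finally show ?thesis .
qed

lemma kern_le: "kern e (z::real^'n::finite) \<le> kern_const TYPE('n) / measure lebesgue (ball (0::real^'n) e)"
proof -
  have "kern e z \<le> 1 / kern_mass TYPE('n) e"
    using kern_mass_pos[OF e, where 'n='n] bump_le[of "(1/e) *\<^sub>R z"] by (simp add: kern_def divide_right_mono)
  also have "\<dots> \<le> kern_const TYPE('n) / measure lebesgue (ball (0::real^'n) e)"
    using kern_mass_ge[OF e, where 'n='n] kern_mass_pos[OF e, where 'n='n] measure_ball_pos[OF e, of "0::real^'n"]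
    by (simp add: field_simps)
  finally show ?thesis .
qed

lemma grad_kern: "grad (kern e) (z::real^'n::finite) = (1 / (e * kern_mass TYPE('n) e)) *\<^sub>R grad bump ((1/e) *\<^sub>R z)"
proof (rule grad_eq)
  have "((\<lambda>z. (1 / kern_mass TYPE('n) e) * bump ((1/e) *\<^sub>R z)) has_derivative
     (\<lambda>h. (1 / kern_mass TYPE('n) e) * (grad bump ((1/e) *\<^sub>R z) \<bullet> ((1/e) *\<^sub>R h)))) (at z)"
  proof (rule has_derivative_mult_right, rule has_derivative_compose[where f="\<lambda>z. (1/e) *\<^sub>R z" and f'="\<lambda>h. (1/e) *\<^sub>R h"])
    show "((*\<^sub>R) (1 / e) has_derivative (*\<^sub>R) (1 / e)) (at z)" by (auto intro!: derivative_eq_intros)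
  qed (rule smooth_fun_has_derivative(1)[OF smooth_fun_bump])
  then show "(kern e has_derivative (\<lambda>h. (1 / (e * kern_mass TYPE('n) e)) *\<^sub>R grad bump ((1 / e) *\<^sub>R z) \<bullet> h)) (at z)"
    by (simp add: kern_def[abs_def] mult.commute)
qed

lemma has_derivative_kern: "(kern e has_derivative (\<lambda>h. grad (kern e) x \<bullet> h)) (at x)"
  by (rule smooth_fun_has_derivative(1)[OF smooth_kern])

lemma kern_support: "closure {z. kern e (z - y) \<noteq> 0} \<subseteq> cball y e"
proof (rule closure_minimal)
  show "{z. kern e (z - y) \<noteq> 0} \<subseteq> cball y e"
  proof
    fix z assume "z \<in> {z. kern e (z - y) \<noteq> 0}"
    then have "\<not> e \<le> norm (z - y)" using kern_0 by blast
    then show "z \<in> cball y e" by (simp add: dist_norm norm_minus_commute)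
  qed
qed simp

lemma smooth_kern_shift: "smooth_fun (\<lambda>z. kern e (z - y))"
  using smooth_fun_scaled[OF smooth_kern, of 1 1 "- y"] by simp

lemma test_fun_kern:
  assumes "cball y e \<subseteq> U"
  shows "test_fun U (\<lambda>z. kern e (z - y))"
proof -
  have "bounded (closure {z. kern e (z - y) \<noteq> 0})"
    using kern_support bounded_cball bounded_subset by blast
  then show ?thesis
    unfolding test_fun_def compact_eq_bounded_closed
    using smooth_kern_shift order_trans[OF kern_support assms] by blast
qed

lemma grad_kern_shift: "grad (\<lambda>z. kern e (z - y)) z = grad (kern e) (z - y)"
  by (rule grad_translate) (use has_derivative_kern differentiableI in blast)

end

lemma grad_zero_outside:
  assumes "open S" "x \<in> S" "\<And>z. z \<in> S \<Longrightarrow> f z = 0"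
  shows "grad f x = 0"
proof (rule grad_eq)
  have "((\<lambda>z. 0::real) has_derivative (\<lambda>h. 0 \<bullet> h)) (at x)" by simp
  then show "(f has_derivative (\<lambda>h. 0 \<bullet> h)) (at x)"
    by (rule has_derivative_transform_within_open[OF _ assms(1,2)]) (use assms(3) in auto)
qed

lemma grad_kern_0:
  assumes "e > 0" "norm z > e" shows "grad (kern e) z = 0"
proof (rule grad_zero_outside)
  show "open (- cball 0 e)" "z \<in> - cball 0 e" using assms by auto
  show "kern e z = 0" if "z \<in> - cball 0 e" for z using that by (intro kern_0 assms) auto
qed

text \<open>The chain rule contributes \<open>1/e\<close>, and \<open>kern_mass_ge\<close> turns the
  mass of the kernel into a volume. As the kernel lives in a ball of radius \<open>e\<close>, its
  gradient has L1 norm at most \<open>B/e\<close>.\<close>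

lemma grad_kern_bound:
  obtains B where "B > 0" "\<And>e z::real^'n::finite. e > 0 \<Longrightarrow> norm (grad (kern e) z) \<le> B / (e * measure lebesgue (ball (0::real^'n) e))"
proof -
  have 0: "grad bump z = 0" if "z \<notin> cball 0 1" for z :: "real^'n"
    by (rule grad_zero_outside[where S="- cball 0 1"]) (use that in \<open>auto intro: bump_0\<close>)
  obtain B where B: "B > 0" "\<And>z::real^'n. norm (grad bump z) \<le> B"
    using compact_support_bounded[OF smooth_fun_has_derivative(3)[OF smooth_fun_bump] compact_cball[of 0 1] 0] by blast
  have "norm (grad (kern e) z) \<le> (B * kern_const TYPE('n)) / (e * measure lebesgue (ball (0::real^'n) e))" if e: "e > 0" for e and z :: "real^'n"
  proof -
    have m: "kern_mass TYPE('n) e > 0" and b: "measure lebesgue (ball (0::real^'n) e) > 0"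
      using kern_mass_pos[OF e] measure_ball_pos[OF e] by blast+
    have "norm (grad (kern e) z) \<le> (1 / (e * kern_mass TYPE('n) e)) * B"
      unfolding grad_kern[OF e] using m e B(2) by (simp add: divide_right_mono)
    also have "\<dots> \<le> (B * kern_const TYPE('n)) / (e * measure lebesgue (ball (0::real^'n) e))"
      using m e b B(1) kern_mass_ge[OF e, where 'n='n] by (simp add: field_simps)
    finally show ?thesis .
  qed
  then show ?thesis using that[of "B * kern_const TYPE('n)"] B(1) kern_const_pos[where 'n='n] by simp
qed

section \<open>Mollification\<close>

text \<open>The convolution with the even kernel, written as a pairing of \<open>f\<close> with a
  shifted kernel so that the definition of the weak gradient applies with this kernel as test
  function. The integral runs over the whole space, although only the values of \<open>f\<close> on
  the ball of radius \<open>e\<close> about \<open>y\<close> matter.\<close>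

definition mollify :: "real \<Rightarrow> (real^'n::finite \<Rightarrow> real) \<Rightarrow> real^'n \<Rightarrow> real" where
  "mollify e f y = (LINT z|lebesgue. f z * kern e (z - y))"

lemma continuous_grad_kern_shift:
  assumes "e > 0" shows "continuous_on UNIV (\<lambda>z. grad (kern e) (z - y))"
  by (rule continuous_on_compose2[OF smooth_fun_has_derivative(3)[OF smooth_kern[OF assms]]])
     (auto intro!: continuous_intros)

lemma integrable_mollify:
  assumes "e > 0" "set_integrable lebesgue (cball y r) f" "dist y y' + e \<le> r"
  shows "integrable lebesgue (\<lambda>z. f z * kern e (z - y'))"
    and "integrable lebesgue (\<lambda>z. f z * (grad (kern e) (z - y') \<bullet> h))"
proof -
  have far: "norm (z - y') > e" if "z \<notin> cball y r" for z
    using that assms(3) norm_triangle_ineq[of "z - y'" "y' - y"] by (simp add: dist_norm norm_minus_commute)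
  show "integrable lebesgue (\<lambda>z. f z * kern e (z - y'))"
    by (rule integrable_mult_compact_support[OF assms(2) continuous_kern_shift[OF assms(1)] compact_cball])
      (use far in \<open>force intro!: kern_0[OF assms(1)]\<close>)
  have "continuous_on UNIV (\<lambda>z. grad (kern e) (z - y') \<bullet> h)"
    by (intro continuous_on_inner continuous_grad_kern_shift[OF assms(1)] continuous_on_const)
  then show "integrable lebesgue (\<lambda>z. f z * (grad (kern e) (z - y') \<bullet> h))"
    by (rule integrable_mult_compact_support[OF assms(2) _ compact_cball])
       (simp add: grad_kern_0[OF assms(1) far])
qed

text \<open>Differentiation under the integral: uniform continuity of the kernel's gradient bounds
  the Taylor remainder \<open>R\<close> uniformly in \<open>z\<close>. Moving \<open>y\<close> by
  less than \<open>e\<close> keeps the kernel inside the ball of radius \<open>2*e\<close>, and the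
  minus sign comes from differentiating \<open>kern e (z - y)\<close> in \<open>y\<close>.\<close>

lemma mollify_has_derivative_kern:
  fixes f :: "real^'n::finite \<Rightarrow> real"
  assumes e: "e > 0" and f: "set_integrable lebesgue (cball y (2*e)) f"
  shows "(mollify e f has_derivative
           (\<lambda>h. (\<chi> i. - (LINT z|lebesgue. f z * grad (kern e) (z - y) $ i)) \<bullet> h)) (at y)"
    (is "(_ has_derivative ?L) _")
proof -
  define K where "K = cball y (2*e)"
  define G where "G = (LINT z|lebesgue. \<bar>indicator K z *\<^sub>R f z\<bar>)"
  have G0: "G \<ge> 0" by (simp add: G_def)
  have fK: "integrable lebesgue (\<lambda>z. \<bar>indicator K z *\<^sub>R f z\<bar>)"
    using f unfolding set_integrable_def K_def by (rule integrable_abs)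
  have L: "?L h = - (LINT z|lebesgue. f z * (grad (kern e) (z - y) \<bullet> h))" for h
  proof -
    have "integrable lebesgue (\<lambda>z. f z * grad (kern e) (z - y) $ i * h $ i)" for i
      using integrable_mollify(2)[OF e f, of y "axis i (h $ i)"] e by (simp add: inner_axis mult.assoc)
    then have "(LINT z|lebesgue. f z * (grad (kern e) (z - y) \<bullet> h)) = (\<Sum>i\<in>UNIV. (LINT z|lebesgue. f z * grad (kern e) (z - y) $ i * h $ i))"
      by (subst Bochner_Integration.integral_sum[symmetric]) (simp_all add: inner_vec_def sum_distrib_left mult.assoc)
    then show ?thesis by (simp add: inner_vec_def sum_negf mult.commute)
  qed
  have "\<exists>d>0. \<forall>y'. norm (y' - y) < d \<longrightarrow> norm (mollify e f y' - mollify e f y - ?L (y' - y)) \<le> t * norm (y' - y)" if t: "t > 0" for t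
  proof -
    \<comment> \<open>The summand 1 keeps the quotient meaningful when \<open>f\<close> vanishes
      almost everywhere on \<open>K\<close>.\<close>
    define s where "s = t / (G + 1)"
    have s: "s > 0" using t G0 by (simp add: s_def)
    \<comment> \<open>For \<open>z\<close> in \<open>K\<close> and shifts shorter than
      \<open>e\<close>, all arguments of the kernel stay in the ball of radius
      \<open>3*e\<close>.\<close>
    have "uniformly_continuous_on (cball 0 (3*e)) (grad (kern e) :: real^'n \<Rightarrow> real^'n)"
      by (rule compact_uniformly_continuous[OF continuous_on_subset[OF smooth_fun_has_derivative(3)[OF smooth_kern[OF e]]]]) auto
    then obtain d where d: "d > 0" "\<And>a b::real^'n. a \<in> cball 0 (3*e) \<Longrightarrow> b \<in> cball 0 (3*e) \<Longrightarrow> dist b a < d \<Longrightarrow> dist (grad (kern e) b) (grad (kern e) a) < s"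
      unfolding uniformly_continuous_on_def using s by blast
    have "norm (mollify e f y' - mollify e f y - ?L (y' - y)) \<le> t * norm (y' - y)" if y': "norm (y' - y) < min d e" for y'
    proof -
      define h where "h = y' - y"
      have hd: "norm h < d" "norm h < e" using y' by (auto simp: h_def)
      define R where "R z = kern e (z - y') - kern e (z - y) + grad (kern e) (z - y) \<bullet> h" for z
      have i1: "integrable lebesgue (\<lambda>z. f z * kern e (z - y'))"
        by (rule integrable_mollify(1)[OF e f]) (use y' in \<open>simp add: dist_norm norm_minus_commute\<close>)
      have i2: "integrable lebesgue (\<lambda>z. f z * kern e (z - y))" "integrable lebesgue (\<lambda>z. f z * (grad (kern e) (z - y) \<bullet> h))"
      proof -
        have "dist y y + e \<le> 2*e" using e by simp
        then show "integrable lebesgue (\<lambda>z. f z * kern e (z - y))" "integrable lebesgue (\<lambda>z. f z * (grad (kern e) (z - y) \<bullet> h))"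
          by (rule integrable_mollify[OF e f])+
      qed
      have eq: "mollify e f y' - mollify e f y - ?L h = (LINT z|lebesgue. f z * R z)"
        unfolding mollify_def L R_def using i1 i2 by (simp add: distrib_left right_diff_distrib)
      have Rb: "\<bar>f z * R z\<bar> \<le> \<bar>indicator K z *\<^sub>R f z\<bar> * (s * norm h)" for z
      proof (cases "z \<in> K")
        case True
        \<comment> \<open>The mean value inequality on the segment from \<open>z - y\<close> to
          \<open>z - y'\<close>, along which the gradient differs from its initial value by at most
          \<open>s\<close>.\<close>
        have "norm (kern e (z - y') - kern e (z - y) - grad (kern e) (z - y) \<bullet> ((z - y') - (z - y))) \<le> norm ((z - y') - (z - y)) * s"
        proof (rule differentiable_bound_linearization[where S="{z - y + u *\<^sub>R (- h) | u. u \<in> {0..1}}" and f'="\<lambda>x h. grad (kern e) x \<bullet> h"])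
          show "z - y \<in> {z - y + u *\<^sub>R (- h) |u. u \<in> {0..1}}" by (auto intro!: exI[of _ 0])
          show "z - y + u *\<^sub>R (z - y' - (z - y)) \<in> {z - y + u *\<^sub>R - h |u. u \<in> {0..1}}" if "u \<in> {0..1}" for u
          proof -
            have "z - y' - (z - y) = - h" by (simp add: h_def)
            then show ?thesis using that by auto
          qed
          fix x assume "x \<in> {z - y + u *\<^sub>R (- h) | u. u \<in> {0..1}}"
          then obtain u where u: "x = z - y - u *\<^sub>R h" "0 \<le> u" "u \<le> 1" by auto
          show "(kern e has_derivative (\<bullet>) (grad (kern e) x)) (at x within {z - y + u *\<^sub>R (- h) | u. u \<in> {0..1}})"
            using has_derivative_kern[OF e] by (rule has_derivative_at_withinI)
          have zy: "norm (z - y) \<le> 2*e" using True by (simp add: K_def dist_norm norm_minus_commute)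
          have uh: "norm (u *\<^sub>R h) \<le> norm h" using u by (simp add: mult_left_le_one_le)
          have "norm x \<le> norm (z - y) + norm (u *\<^sub>R h)" unfolding u(1) by (rule norm_triangle_ineq4)
          then have "x \<in> cball 0 (3*e)" using zy uh hd by simp
          moreover have "z - y \<in> cball 0 (3*e)" using zy e by simp
          moreover have "dist x (z - y) < d" using uh hd by (simp add: u(1) dist_norm)
          ultimately have ds: "norm (grad (kern e) x - grad (kern e) (z - y)) < s" using d(2)[of "z - y" x] unfolding dist_norm by blast
          have "(\<bullet>) (grad (kern e) x) - (\<bullet>) (grad (kern e) (z - y)) = (\<bullet>) (grad (kern e) x - grad (kern e) (z - y))"
            by (simp add: fun_eq_iff inner_diff_left)
          then show "onorm ((\<bullet>) (grad (kern e) x) - (\<bullet>) (grad (kern e) (z - y))) \<le> s"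
            using onorm_inner_le[OF less_imp_le[OF ds]] by simp
        qed
        moreover have "(z - y') - (z - y) = - h" by (simp add: h_def)
        ultimately have "\<bar>R z\<bar> \<le> s * norm h" by (simp add: R_def mult.commute)
        then show ?thesis using True by (simp add: abs_mult mult_left_mono)
      next
        case False
        then have 1: "norm (z - y) > 2*e" by (simp add: K_def dist_norm norm_minus_commute)
        then have "norm (z - y') \<ge> e"
          using norm_triangle_ineq[of "z - y'" "y' - y"] hd by (simp add: h_def)
        then have "R z = 0" using 1 e by (simp add: R_def kern_0[OF e] grad_kern_0[OF e])
        then show ?thesis using False by simp
      qed
      have "norm (LINT z|lebesgue. f z * R z) \<le> (LINT z|lebesgue. \<bar>indicator K z *\<^sub>R f z\<bar> * (s * norm h))"
      proof (rule order_trans[OF integral_norm_bound integral_mono])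
        have "integrable lebesgue (\<lambda>z. f z * R z)"
          using i1 i2 by (simp add: R_def distrib_left right_diff_distrib)
        then show "integrable lebesgue (\<lambda>z. norm (f z * R z))" by simp
        show "integrable lebesgue (\<lambda>z. \<bar>indicator K z *\<^sub>R f z\<bar> * (s * norm h))"
          using fK by (rule integrable_mult_left)
        show "norm (f z * R z) \<le> \<bar>indicator K z *\<^sub>R f z\<bar> * (s * norm h)" for z using Rb[of z] by simp
      qed
      also have "\<dots> = G * (s * norm h)" by (simp add: G_def)
      also have "\<dots> \<le> t * norm h"
      proof -
        have "G * s \<le> t" using G0 t by (simp add: s_def field_simps)
        then show ?thesis using mult_right_mono[of "G * s" t "norm h"] by (simp add: mult.assoc)
      qed
      finally show ?thesis using eq by (simp add: h_def)
    qed
    then show ?thesis using d(1) e by (intro exI[of _ "min d e"]) auto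
  qed
  then show ?thesis
    unfolding has_derivative_at_alt by (auto intro: bounded_linear_inner_right)
qed

lemma weak_grad_test:
  assumes w: "weak_grad U u g" and t: "test_fun U \<psi>"
  shows "(LINT z|lebesgue. u z * grad \<psi> z $ i) = - (LINT z|lebesgue. g z $ i * \<psi> z)"
proof -
  have out: "\<psi> z = 0" "grad \<psi> z = 0" if "z \<notin> U" for z
  proof -
    have z: "z \<in> - closure {x. \<psi> x \<noteq> 0}" using that t by (auto simp: test_fun_def)
    have 0: "\<psi> x = 0" if "x \<in> - closure {x. \<psi> x \<noteq> 0}" for x using that closure_subset[of "{x. \<psi> x \<noteq> 0}"] by auto
    show "\<psi> z = 0" using 0 z by blast
    show "grad \<psi> z = 0" by (rule grad_zero_outside[OF _ z 0]) auto
  qed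
  have "(LINT z|lebesgue. u z * grad \<psi> z $ i) = (LINT z:U|lebesgue. u z * pderiv_i i \<psi> z)"
    unfolding set_lebesgue_integral_def
    by (rule Bochner_Integration.integral_cong) (use out in \<open>auto simp: indicator_def grad_def vec_eq_iff\<close>)
  also have "\<dots> = - (LINT z:U|lebesgue. g z $ i * \<psi> z)"
    using w t by (simp add: weak_grad_def)
  also have "(LINT z:U|lebesgue. g z $ i * \<psi> z) = (LINT z|lebesgue. g z $ i * \<psi> z)"
    unfolding set_lebesgue_integral_def
    by (rule Bochner_Integration.integral_cong) (use out in \<open>auto simp: indicator_def\<close>)
  finally show ?thesis .
qed

text \<open>The shifted kernel is itself a test function, so moving the derivative off it shows that
  mollification commutes with weak differentiation.\<close>

lemma weak_grad_kern:
  assumes w: "weak_grad U u g" and e: "e > 0" and y: "cball y e \<subseteq> U"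
  shows "(LINT z|lebesgue. u z * grad (kern e) (z - y) $ i) = - mollify e (\<lambda>z. g z $ i) y"
  using weak_grad_test[OF w test_fun_kern[OF e y], of i] by (simp add: grad_kern_shift[OF e] mollify_def)

theorem mollify_has_derivative:
  assumes w: "weak_grad U u g" and e: "e > 0" and y: "cball y (2*e) \<subseteq> U"
  shows "(mollify e u has_derivative (\<lambda>h. (\<chi> i. mollify e (\<lambda>z. g z $ i) y) \<bullet> h)) (at y)"
proof -
  have "cball y e \<subseteq> U" using y e by (auto simp: subset_iff)
  moreover have "set_integrable lebesgue (cball y (2*e)) u"
    using w y by (auto simp: weak_grad_def loc_integrable_def)
  ultimately show ?thesis using mollify_has_derivative_kern[OF e, of y u] weak_grad_kern[OF w e] by simp
qed

lemma mollify_const: "e > 0 \<Longrightarrow> mollify e (\<lambda>z. c) y = c"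
  by (simp add: mollify_def integral_kern)

lemma mollify_le:
  assumes e: "e > 0" and f: "set_integrable lebesgue (cball y e) f"
    and b: "AE z in lebesgue. z \<in> ball y e \<longrightarrow> \<bar>f z\<bar> \<le> b"
  shows "\<bar>mollify e f y\<bar> \<le> b"
proof -
  have "\<bar>mollify e f y\<bar> \<le> (LINT z|lebesgue. \<bar>f z * kern e (z - y)\<bar>)"
    unfolding mollify_def by (rule integral_abs_bound)
  also have "\<dots> \<le> (LINT z|lebesgue. b * kern e (z - y))"
  proof (rule integral_mono_AE)
    show "integrable lebesgue (\<lambda>z. \<bar>f z * kern e (z - y)\<bar>)"
      using integrable_mollify(1)[OF e f, of y] by simp
    show "integrable lebesgue (\<lambda>z. b * kern e (z - y))"
      using integrable_kern_shift[OF e] by (rule integrable_mult_right)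
    show "AE z in lebesgue. \<bar>f z * kern e (z - y)\<bar> \<le> b * kern e (z - y)"
      using b
    proof eventually_elim
      case (elim z)
      show ?case
      proof (cases "z \<in> ball y e")
        case True
        then show ?thesis using elim kern_nonneg[OF e, of "z - y"] by (simp add: abs_mult mult_right_mono)
      next
        case False
        then show ?thesis by (simp add: kern_0[OF e] dist_norm norm_minus_commute)
      qed
    qed
  qed
  also have "\<dots> = b" using integral_kern[OF e, of y] by simp
  finally show ?thesis .
qed

lemma mollify_diff:
  assumes "e > 0" "set_integrable lebesgue (cball y e) f" "set_integrable lebesgue (cball y e) g"
  shows "mollify e (\<lambda>z. f z - g z) y = mollify e f y - mollify e g y"
  unfolding mollify_def left_diff_distrib
  by (rule Bochner_Integration.integral_diff)
    (rule integrable_mollify(1)[OF assms(1,2)] integrable_mollify(1)[OF assms(1,3)], simp)+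

lemma mollify_diff_const:
  assumes "e > 0" "set_integrable lebesgue (cball y e) f"
  shows "mollify e (\<lambda>z. f z - c) y = mollify e f y - c"
  using mollify_diff[OF assms set_integrable_const_compact[OF compact_cball]] mollify_const[OF assms(1)] by simp

text \<open>The kernel is at most \<open>kern_const\<close> divided by the volume of its ball. The
  set \<open>S\<close> is left free so that an estimate on a larger ball with another centre can be
  used.\<close>

lemma mollify_le_average:
  fixes f :: "real^'n::finite \<Rightarrow> real"
  assumes e: "e > 0" and f: "set_integrable lebesgue (cball y e) f" and S: "ball y e \<subseteq> S"
    and b: "(\<integral>\<^sup>+ z\<in>S. ennreal \<bar>f z\<bar> \<partial>lebesgue) \<le> ennreal b" and b0: "b \<ge> 0"
  shows "\<bar>mollify e f y\<bar> \<le> kern_const TYPE('n) * b / measure lebesgue (ball (0::real^'n) e)"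
proof -
  let ?c = "kern_const TYPE('n) / measure lebesgue (ball (0::real^'n) e)"
  have c: "?c > 0" using kern_const_pos measure_ball_pos[OF e] by (intro divide_pos_pos)
  have int: "integrable lebesgue (\<lambda>z. f z * kern e (z - y))"
    using integrable_mollify(1)[OF e f, of y] by simp
  have "ennreal \<bar>mollify e f y\<bar> \<le> ennreal (LINT z|lebesgue. \<bar>f z * kern e (z - y)\<bar>)"
    unfolding mollify_def by (intro ennreal_leI integral_abs_bound)
  also have "\<dots> = (\<integral>\<^sup>+ z. ennreal \<bar>f z * kern e (z - y)\<bar> \<partial>lebesgue)"
    using int by (intro nn_integral_eq_integral[symmetric]) auto
  also have "\<dots> \<le> (\<integral>\<^sup>+ z. ennreal ?c * (ennreal \<bar>f z\<bar> * indicator (ball y e) z) \<partial>lebesgue)"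
  proof (rule nn_integral_mono)
    fix z
    show "ennreal \<bar>f z * kern e (z - y)\<bar> \<le> ennreal ?c * (ennreal \<bar>f z\<bar> * indicator (ball y e) z)"
    proof (cases "z \<in> ball y e")
      case True
      have "\<bar>f z * kern e (z - y)\<bar> \<le> ?c * \<bar>f z\<bar>"
        using kern_nonneg[OF e, of "z - y"] kern_le[OF e, of "z - y"] 
        by (subst abs_mult, subst mult.commute) (intro mult_right_mono, simp_all)
      then show ?thesis using True c by (simp add: ennreal_leI flip: ennreal_mult)
    next
      case False
      then show ?thesis by (simp add: kern_0[OF e] dist_norm norm_minus_commute)
    qed
  qed
  also have "\<dots> = ennreal ?c * (\<integral>\<^sup>+ z\<in>ball y e. ennreal \<bar>f z\<bar> \<partial>lebesgue)"
  proof (rule nn_integral_cmult)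
    have "set_integrable lebesgue (ball y e) f" by (rule set_integrable_subset[OF f]) auto
    then have "(\<lambda>z. indicator (ball y e) z *\<^sub>R f z) \<in> borel_measurable lebesgue"
      unfolding set_integrable_def by (rule borel_measurable_integrable)
    then have "(\<lambda>z. ennreal \<bar>indicator (ball y e) z *\<^sub>R f z\<bar>) \<in> borel_measurable lebesgue"
      by (intro measurable_compose[OF borel_measurable_abs measurable_ennreal])
    also have "(\<lambda>z. ennreal \<bar>indicator (ball y e) z *\<^sub>R f z\<bar>) = (\<lambda>z. ennreal \<bar>f z\<bar> * indicator (ball y e) z)"
      by (auto simp: indicator_def)
    finally show "(\<lambda>z. ennreal \<bar>f z\<bar> * indicator (ball y e) z) \<in> borel_measurable lebesgue" .
  qed
  also have "(\<integral>\<^sup>+ z\<in>ball y e. ennreal \<bar>f z\<bar> \<partial>lebesgue) \<le> (\<integral>\<^sup>+ z\<in>S. ennreal \<bar>f z\<bar> \<partial>lebesgue)"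
    by (rule nn_integral_mono) (use S in \<open>auto simp: indicator_def\<close>)
  also have "(\<integral>\<^sup>+ z\<in>S. ennreal \<bar>f z\<bar> \<partial>lebesgue) \<le> ennreal b" by (rule b)
  also have "ennreal ?c * ennreal b = ennreal (?c * b)" using c b0 by (simp flip: ennreal_mult)
  finally have "ennreal \<bar>mollify e f y\<bar> \<le> ennreal (?c * b)" by (simp add: mult_left_mono)
  moreover have "0 \<le> ?c * b" using c b0 by (intro mult_nonneg_nonneg) simp_all
  ultimately show ?thesis using ennreal_le_iff by force
qed

section \<open>Weak gradients\<close>

text \<open>By translation invariance every difference quotient \<open>q n\<close> has integral 0.
  Steps of length at most 1 keep all quotients supported in the ball of radius \<open>R + 1\<close>
  and bounded by \<open>B\<close>, so the limit passes under the integral.\<close>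

lemma integral_partial_derivative_0:
  fixes H :: "real^'n::finite \<Rightarrow> real"
  assumes H: "\<And>x. (H has_derivative (\<lambda>h. D x \<bullet> h)) (at x)" and D: "continuous_on UNIV D"
    and K: "compact K" and 0: "\<And>x. x \<notin> K \<Longrightarrow> H x = 0"
  shows "(LINT x|lebesgue. D x $ i) = 0"
proof -
  have Hc: "continuous_on UNIV H"
    using H by (meson continuous_at_imp_continuous_on has_derivative_continuous)
  have D0: "D x = 0" if "x \<notin> K" for x
  proof -
    have "grad H x = 0"
      by (rule grad_zero_outside[where S="- K"]) (use that 0 K in \<open>auto simp: compact_imp_closed open_Compl\<close>)
    then show ?thesis using grad_eq[OF H] by simp
  qed
  obtain B where B: "B > 0" "\<And>x. norm (D x) \<le> B" using compact_support_bounded[OF D K D0] by blast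
  obtain R where R: "R > 0" "\<And>x. x \<in> K \<Longrightarrow> norm x \<le> R" using compact_imp_bounded[OF K] unfolding bounded_pos by auto
  define t where "t n = 1 / real (Suc n)" for n
  have t: "t n > 0" "t n \<le> 1" for n by (auto simp: t_def)
  let ?e = "axis i 1 :: real^'n"
  define q where "q n x = (H (x + t n *\<^sub>R ?e) - H x) / t n" for n x
  have Hi: "integrable lebesgue H" by (rule integrable_compact_support[OF Hc K 0])
  have Hsc: "continuous_on UNIV (\<lambda>x. H (x + c))" for c
    by (rule continuous_on_compose2[OF Hc]) (auto intro!: continuous_intros)
  have Hsi: "integrable lebesgue (\<lambda>x. H (x + c))" for c
  proof (rule integrable_compact_support[OF Hsc])
    show "compact ((\<lambda>x. x - c) ` K)" by (intro compact_continuous_image K continuous_intros)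
    fix x assume "x \<notin> (\<lambda>x. x - c) ` K"
    then have "x + c \<notin> K" by (metis add_diff_cancel imageI)
    then show "H (x + c) = 0" by (rule 0)
  qed
  have q0: "(LINT x|lebesgue. q n x) = 0" for n
    unfolding q_def using Hi Hsi lebesgue_integral_translate[OF Hc] by simp
  have qb: "\<bar>q n x\<bar> \<le> B * indicator (cball 0 (R + 1)) x" for n x
  proof (cases "norm x \<le> R + 1")
    case True
    have "norm (H (x + t n *\<^sub>R ?e) - H x) \<le> B * norm (x + t n *\<^sub>R ?e - x)"
    proof (rule differentiable_bound[where S=UNIV and f'="\<lambda>x h. D x \<bullet> h"])
      show "onorm ((\<bullet>) (D x)) \<le> B" for x
        by (rule onorm_inner_le[OF B(2)])
    qed (use H in auto)
    then have "\<bar>H (x + t n *\<^sub>R ?e) - H x\<bar> \<le> B * t n" using t[of n] by (simp add: norm_axis_1)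
    then show ?thesis using t[of n] True by (simp add: q_def field_simps)
  next
    case False
    have "norm (x + t n *\<^sub>R ?e) > R"
      using norm_triangle_ineq4[of "x + t n *\<^sub>R ?e" "t n *\<^sub>R ?e"] False t[of n] by (simp add: norm_axis_1)
    then have "H (x + t n *\<^sub>R ?e) = 0" "H x = 0" using R False by (force intro!: 0)+
    then show ?thesis using False by (simp add: q_def)
  qed
  have ql: "(\<lambda>n. q n x) \<longlonglongrightarrow> D x $ i" for x
  proof -
    have "((\<lambda>u. H (x + u *\<^sub>R ?e)) has_real_derivative D x $ i) (at 0)"
    proof -
      have "((\<lambda>u. H (x + u *\<^sub>R ?e)) has_derivative (\<lambda>u. D (x + 0 *\<^sub>R ?e) \<bullet> (u *\<^sub>R ?e))) (at 0)"
        by (rule has_derivative_compose[where f="\<lambda>u. x + u *\<^sub>R ?e", OF _ H]) (auto intro!: derivative_eq_intros)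
      then show ?thesis by (simp add: has_field_derivative_def inner_axis mult_commute_abs)
    qed
    then have *: "((\<lambda>u. (H (x + u *\<^sub>R ?e) - H x) / u) \<longlongrightarrow> D x $ i) (at 0)" by (simp add: DERIV_def)
    have "filterlim t (at 0) sequentially"
      unfolding filterlim_at t_def using LIMSEQ_Suc[OF lim_1_over_n] by (auto intro!: always_eventually)
    from filterlim_compose[OF * this] show ?thesis by (simp add: q_def)
  qed
  have "(\<lambda>n. LINT x|lebesgue. q n x) \<longlonglongrightarrow> (LINT x|lebesgue. D x $ i)"
  proof (rule integral_dominated_convergence[where w="\<lambda>x. B * indicator (cball 0 (R + 1)) x"])
    show "(\<lambda>x. D x $ i) \<in> borel_measurable lebesgue"
      using D by (intro continuous_imp_measurable_lebesgue continuous_intros)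
    show "q n \<in> borel_measurable lebesgue" for n
      unfolding q_def using Hsc Hc t[of n] by (intro continuous_imp_measurable_lebesgue continuous_intros) auto
    show "integrable lebesgue (\<lambda>x::real^'n. B * indicator (cball 0 (R + 1)) x)"
      using set_integrable_const_compact[OF compact_cball, of 0 "R + 1" "1::real"]
      by (intro integrable_mult_right) (simp add: set_integrable_def)
    show "AE x in lebesgue. (\<lambda>n. q n x) \<longlonglongrightarrow> D x $ i" using ql by (rule AE_I2)
    show "AE x in lebesgue. norm (q n x) \<le> B * indicator (cball 0 (R + 1)) x" for n
      using qb by (intro AE_I2) simp
  qed
  then show ?thesis using q0 by (simp add: LIMSEQ_const_iff)
qed

section \<open>Test functions and weak gradients of C1 functions\<close>

lemma test_fun_obtain:
  assumes t: "test_fun U \<psi>"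
  obtains K where "compact K" "K \<subseteq> U" "\<And>z. z \<notin> K \<Longrightarrow> \<psi> z = 0" "\<And>z. z \<notin> K \<Longrightarrow> grad \<psi> z = 0"
    "continuous_on UNIV \<psi>" "continuous_on UNIV (grad \<psi>)"
    "\<And>z. (\<psi> has_derivative (\<lambda>h. grad \<psi> z \<bullet> h)) (at z)"
proof -
  let ?K = "closure {x. \<psi> x \<noteq> 0}"
  have s: "smooth_fun \<psi>" and K: "compact ?K" "?K \<subseteq> U" using t by (auto simp: test_fun_def)
  have 0: "\<psi> x = 0" if "x \<in> - ?K" for x using that closure_subset[of "{x. \<psi> x \<noteq> 0}"] by auto
  have "grad \<psi> z = 0" if "z \<in> - ?K" for z by (rule grad_zero_outside[OF _ that 0]) auto
  then show ?thesis
    by (intro that[OF K] 0) (use smooth_fun_has_derivative[OF s] in \<open>simp_all only: Compl_iff not_False_eq_True\<close>)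
qed

lemma test_fun_integrable:
  assumes t: "test_fun U \<psi>" and f: "loc_integrable U f"
  shows "integrable lebesgue (\<lambda>z. f z * \<psi> z)" "integrable lebesgue (\<lambda>z. f z * grad \<psi> z $ i)"
proof -
  obtain K where K: "compact K" "K \<subseteq> U" "\<And>z. z \<notin> K \<Longrightarrow> \<psi> z = 0" "\<And>z. z \<notin> K \<Longrightarrow> grad \<psi> z = 0"
    "continuous_on UNIV \<psi>" "continuous_on UNIV (grad \<psi>)"
    using test_fun_obtain[OF t] by metis
  have fK: "set_integrable lebesgue K f" using f K by (auto simp: loc_integrable_def)
  show "integrable lebesgue (\<lambda>z. f z * \<psi> z)"
    by (rule integrable_mult_compact_support[OF fK K(5,1,3)])
  show "integrable lebesgue (\<lambda>z. f z * grad \<psi> z $ i)"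
    by (rule integrable_mult_compact_support[OF fK _ K(1)]) (use K in \<open>auto intro!: continuous_intros\<close>)
qed

lemma weak_gradI:
  assumes "loc_integrable U u" "\<And>i. loc_integrable U (\<lambda>x. g x $ i)"
    and "\<And>\<psi> i. test_fun U \<psi> \<Longrightarrow> (LINT z|lebesgue. u z * grad \<psi> z $ i) = - (LINT z|lebesgue. g z $ i * \<psi> z)"
  shows "weak_grad U u g"
  unfolding weak_grad_def
proof (intro conjI allI impI assms(1,2))
  fix \<psi> i assume t: "test_fun U \<psi>"
  obtain K where K: "K \<subseteq> U" "\<And>z. z \<notin> K \<Longrightarrow> \<psi> z = 0" "\<And>z. z \<notin> K \<Longrightarrow> grad \<psi> z = 0"
    using test_fun_obtain[OF t] by metis
  have "(LINT x:U|lebesgue. u x * pderiv_i i \<psi> x) = (LINT z|lebesgue. u z * grad \<psi> z $ i)"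
    unfolding set_lebesgue_integral_def
  proof (rule Bochner_Integration.integral_cong)
    fix x show "indicator U x *\<^sub>R (u x * pderiv_i i \<psi> x) = u x * grad \<psi> x $ i"
      using K(1) K(3)[of x] by (cases "x \<in> U") (auto simp: grad_def vec_eq_iff)
  qed simp
  also have "\<dots> = - (LINT z|lebesgue. g z $ i * \<psi> z)" by (rule assms(3)[OF t])
  also have "(LINT z|lebesgue. g z $ i * \<psi> z) = (LINT x:U|lebesgue. g x $ i * \<psi> x)"
    unfolding set_lebesgue_integral_def
  proof (rule Bochner_Integration.integral_cong)
    fix x show "g x $ i * \<psi> x = indicator U x *\<^sub>R (g x $ i * \<psi> x)"
      using K(1) K(2)[of x] by (cases "x \<in> U") auto
  qed simp
  finally show "(LINT x:U|lebesgue. u x * pderiv_i i \<psi> x) = - (LINT x:U|lebesgue. g x $ i * \<psi> x)" .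
qed

lemma loc_integrable_continuous: "continuous_on U f \<Longrightarrow> loc_integrable U f"
  unfolding loc_integrable_def by (meson continuous_on_subset set_integrable_continuous_compact)

lemma loc_integrable_diff: "loc_integrable U f \<Longrightarrow> loc_integrable U g \<Longrightarrow> loc_integrable U (\<lambda>x. f x - g x)"
  unfolding loc_integrable_def by (auto intro: set_integral_diff)

text \<open>The product \<open>F * \<psi>\<close> is C1 with compact support, so each of its partial
  derivatives integrates to 0.\<close>

lemma integration_by_parts_test_fun:
  fixes F :: "real^'n::finite \<Rightarrow> real"
  assumes F: "\<And>x. (F has_derivative (\<lambda>h. G x \<bullet> h)) (at x)" and G: "continuous_on UNIV G" and t: "test_fun U \<psi>"
  shows "(LINT z|lebesgue. F z * grad \<psi> z $ i) = - (LINT z|lebesgue. G z $ i * \<psi> z)"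
proof -
  obtain K where K: "compact K" "K \<subseteq> U" "\<And>z. z \<notin> K \<Longrightarrow> \<psi> z = 0" "\<And>z. z \<notin> K \<Longrightarrow> grad \<psi> z = 0"
    "continuous_on UNIV \<psi>" "continuous_on UNIV (grad \<psi>)"
    "\<And>z. (\<psi> has_derivative (\<lambda>h. grad \<psi> z \<bullet> h)) (at z)"
    using test_fun_obtain[OF t] by metis
  have Fc: "continuous_on UNIV F" using F by (meson continuous_at_imp_continuous_on has_derivative_continuous)
  have i1: "integrable lebesgue (\<lambda>z. F z * grad \<psi> z $ i)"
    by (rule test_fun_integrable[OF t loc_integrable_continuous[OF continuous_on_subset[OF Fc]]]) simp
  have "continuous_on UNIV (\<lambda>z. G z $ i)" using G by (intro continuous_intros)
  then have i2: "integrable lebesgue (\<lambda>z. G z $ i * \<psi> z)"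
    by (intro test_fun_integrable[OF t loc_integrable_continuous[OF continuous_on_subset]]) auto
  have "(LINT x|lebesgue. (F x *\<^sub>R grad \<psi> x + \<psi> x *\<^sub>R G x) $ i) = 0"
  proof (rule integral_partial_derivative_0[OF _ _ K(1)])
    fix x
    have "((\<lambda>x. F x * \<psi> x) has_derivative (\<lambda>h. F x * (grad \<psi> x \<bullet> h) + (G x \<bullet> h) * \<psi> x)) (at x)"
      by (intro has_derivative_mult F K(7))
    then show "((\<lambda>x. F x * \<psi> x) has_derivative (\<lambda>h. (F x *\<^sub>R grad \<psi> x + \<psi> x *\<^sub>R G x) \<bullet> h)) (at x)"
      by (simp add: inner_add_left mult.commute)
    show "continuous_on UNIV (\<lambda>x. F x *\<^sub>R grad \<psi> x + \<psi> x *\<^sub>R G x)"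
      by (intro continuous_intros Fc K G)
    show "F x * \<psi> x = 0" if "x \<notin> K" using K(3)[OF that] by simp
  qed
  then have "(LINT z|lebesgue. F z * grad \<psi> z $ i) + (LINT z|lebesgue. G z $ i * \<psi> z) = 0"
    using i1 i2 by (simp add: mult.commute)
  then show ?thesis by simp
qed

lemma weak_grad_C1:
  assumes F: "\<And>x. (F has_derivative (\<lambda>h. G x \<bullet> h)) (at x)" and G: "continuous_on UNIV G"
  shows "weak_grad U F G"
proof (rule weak_gradI)
  have Fc: "continuous_on UNIV F" using F by (meson continuous_at_imp_continuous_on has_derivative_continuous)
  show "loc_integrable U F" by (rule loc_integrable_continuous[OF continuous_on_subset[OF Fc]]) simp
  have "continuous_on UNIV (\<lambda>z. G z $ i)" for i using G by (intro continuous_intros)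
  then show "loc_integrable U (\<lambda>x. G x $ i)" for i
    by (rule loc_integrable_continuous[OF continuous_on_subset]) simp
qed (rule integration_by_parts_test_fun[OF F G])

lemma weak_grad_diff:
  assumes 1: "weak_grad U f g" and 2: "weak_grad U f' g'"
  shows "weak_grad U (\<lambda>x. f x - f' x) (\<lambda>x. g x - g' x)"
proof (rule weak_gradI)
  have l: "loc_integrable U f" "loc_integrable U f'" "\<And>i. loc_integrable U (\<lambda>x. g x $ i)" "\<And>i. loc_integrable U (\<lambda>x. g' x $ i)"
    using 1 2 by (auto simp: weak_grad_def)
  show "loc_integrable U (\<lambda>x. f x - f' x)" "loc_integrable U (\<lambda>x. (g x - g' x) $ i)" for i
    using l by (auto intro: loc_integrable_diff)
  fix \<psi> i assume t: "test_fun U \<psi>"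
  show "(LINT z|lebesgue. (f z - f' z) * grad \<psi> z $ i) = - (LINT z|lebesgue. (g z - g' z) $ i * \<psi> z)"
  proof -
    have "(LINT z|lebesgue. (f z - f' z) * grad \<psi> z $ i) = (LINT z|lebesgue. f z * grad \<psi> z $ i) - (LINT z|lebesgue. f' z * grad \<psi> z $ i)"
      unfolding left_diff_distrib
      by (rule Bochner_Integration.integral_diff[OF test_fun_integrable(2)[OF t l(1)] test_fun_integrable(2)[OF t l(2)]])
    also have "\<dots> = - ((LINT z|lebesgue. g z $ i * \<psi> z) - (LINT z|lebesgue. g' z $ i * \<psi> z))"
      using weak_grad_test[OF 1 t, of i] weak_grad_test[OF 2 t, of i] by simp
    also have "(LINT z|lebesgue. g z $ i * \<psi> z) - (LINT z|lebesgue. g' z $ i * \<psi> z) = (LINT z|lebesgue. (g z - g' z) $ i * \<psi> z)"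
      unfolding vector_minus_component left_diff_distrib
      by (rule Bochner_Integration.integral_diff[OF test_fun_integrable(1)[OF t l(3)] test_fun_integrable(1)[OF t l(4)], symmetric])
    finally show ?thesis .
  qed
qed

section \<open>Agreement of weak gradients with classical derivatives, and uniqueness\<close>

lemma lebesgue_point_cong:
  assumes "open S" "x \<in> S" "\<And>z. z \<in> S \<Longrightarrow> f z = g z" "lebesgue_point f x"
  shows "lebesgue_point g x"
  unfolding lebesgue_point_def
proof (intro allI impI)
  fix e :: real assume "e > 0"
  then obtain d where d: "d > 0" "\<And>r. 0 < r \<and> r < d \<Longrightarrow>
     (\<integral>\<^sup>+ z\<in>ball x r. ennreal \<bar>f z - f x\<bar> \<partial>lebesgue) \<le> ennreal e * emeasure lebesgue (ball x r)"
    using assms(4) unfolding lebesgue_point_def by blast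
  obtain d' where d': "d' > 0" "ball x d' \<subseteq> S" using assms(1,2) by (auto simp: open_contains_ball)
  have "(\<integral>\<^sup>+ z\<in>ball x r. ennreal \<bar>g z - g x\<bar> \<partial>lebesgue) \<le> ennreal e * emeasure lebesgue (ball x r)"
    if r: "0 < r \<and> r < min d d'" for r
  proof -
    have "(\<integral>\<^sup>+ z\<in>ball x r. ennreal \<bar>g z - g x\<bar> \<partial>lebesgue) = (\<integral>\<^sup>+ z\<in>ball x r. ennreal \<bar>f z - f x\<bar> \<partial>lebesgue)"
    proof (rule nn_integral_cong)
      fix z
      have "z \<in> S" if "z \<in> ball x r" using that r d' by auto
      then show "ennreal \<bar>g z - g x\<bar> * indicator (ball x r) z = ennreal \<bar>f z - f x\<bar> * indicator (ball x r) z"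
        using assms(3)[of z] assms(3)[OF assms(2)] by (cases "z \<in> ball x r") (simp_all only: indicator_simps mult_zero_right not_False_eq_True if_True)
    qed
    then show ?thesis using d(2)[of r] r by simp
  qed
  then show "\<exists>d>0. \<forall>r. 0 < r \<and> r < d \<longrightarrow>
     (\<integral>\<^sup>+ z\<in>ball x r. ennreal \<bar>g z - g x\<bar> \<partial>lebesgue) \<le> ennreal e * emeasure lebesgue (ball x r)"
    using d(1) d'(1) by (intro exI[of _ "min d d'"]) simp
qed

text \<open>Exhaust \<open>U\<close> by compact sets. Near a point in the interior of one of them,
  the truncation of \<open>f\<close> to that set is \<open>f\<close> itself, and being a Lebesgue
  point is a local property.\<close>

lemma AE_lebesgue_point_loc:
  fixes f :: "real^'n::finite \<Rightarrow> real"
  assumes U: "open U" and f: "loc_integrable U f"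
  shows "AE x in lebesgue. x \<in> U \<longrightarrow> lebesgue_point f x"
proof -
  obtain C where C: "\<And>n. compact (C n)" "\<And>n. C n \<subseteq> U" "\<And>n. C n \<subseteq> interior (C (Suc n))" "\<Union>(range C) = U"
    by (rule open_Union_compact_subsets[OF U]) blast
  have "AE x in lebesgue. lebesgue_point (\<lambda>z. indicator (C n) z *\<^sub>R f z) x" for n :: nat
    using f C(1,2)[of n] by (intro AE_lebesgue_point) (auto simp: loc_integrable_def set_integrable_def)
  then have "AE x in lebesgue. \<forall>n. lebesgue_point (\<lambda>z. indicator (C n) z *\<^sub>R f z) x"
    by (simp add: AE_all_countable)
  then show ?thesis
  proof eventually_elim
    case (elim x)
    show ?case
    proof
      assume "x \<in> U"
      then obtain n where n: "x \<in> interior (C (Suc n))" using C(3,4) by blast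
      show "lebesgue_point f x"
        by (rule lebesgue_point_cong[OF open_interior n _ elim[rule_format, of "Suc n"]])
          (use interior_subset in \<open>auto simp: indicator_def\<close>)
    qed
  qed
qed

lemma loc_integrableD: "loc_integrable U f \<Longrightarrow> cball y r \<subseteq> U \<Longrightarrow> set_integrable lebesgue (cball y r) f"
  by (simp add: loc_integrable_def)

lemma mollify_tendsto_lebesgue_point:
  fixes f :: "real^'n::finite \<Rightarrow> real"
  assumes f: "set_integrable lebesgue (cball y r) f" and r: "r > 0" and l: "lebesgue_point f y"
  shows "((\<lambda>e. mollify e f y) \<longlongrightarrow> f y) (at_right 0)"
proof (rule tendstoI)
  fix t :: real assume t: "t > 0"
  let ?k = "kern_const TYPE('n)"
  \<comment> \<open>\<open>mollify_le_average\<close> turns the mean oscillation \<open>s\<close>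
    into the error \<open>?k * s = t/2\<close>.\<close>
  define s where "s = t / (2 * ?k)"
  have k: "?k > 0" by (rule kern_const_pos)
  have s: "s > 0" using t k by (simp add: s_def)
  obtain d where d: "d > 0" "\<And>e. 0 < e \<Longrightarrow> e < d \<Longrightarrow>
     (\<integral>\<^sup>+ z\<in>ball y e. ennreal \<bar>f z - f y\<bar> \<partial>lebesgue) \<le> ennreal s * emeasure lebesgue (ball y e)"
    using l s unfolding lebesgue_point_def by blast
  show "\<forall>\<^sub>F e in at_right 0. dist (mollify e f y) (f y) < t"
    unfolding eventually_at_right_field
  proof (intro exI conjI allI impI)
    show "0 < min d r" using d r by simp
    fix e :: real assume e0: "0 < e" and e1: "e < min d r"
    have fe: "set_integrable lebesgue (cball y e) f"
      by (rule set_integrable_subset[OF f]) (use e1 in auto)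
    let ?m = "measure lebesgue (ball (0::real^'n) e)"
    have m: "?m > 0" by (rule measure_ball_pos[OF e0])
    have my: "measure lebesgue (ball y e) = ?m" using measure_ball_scale[OF e0 e0, of y 0] e0 by simp
    have "\<bar>mollify e (\<lambda>z. f z - f y) y\<bar> \<le> ?k * (s * ?m) / ?m"
    proof (rule mollify_le_average[OF e0])
      show "set_integrable lebesgue (cball y e) (\<lambda>z. f z - f y)"
        by (intro set_integral_diff fe set_integrable_const_compact) simp
      show "(\<integral>\<^sup>+ z\<in>ball y e. ennreal \<bar>f z - f y\<bar> \<partial>lebesgue) \<le> ennreal (s * ?m)"
        using d(2)[OF e0] e1 s e0 unfolding emeasure_ball[OF less_imp_le[OF e0]] my by (simp add: ennreal_mult)
    qed (use s m in auto)
    also have "\<dots> = t / 2" using m k by (simp add: s_def)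
    finally show "dist (mollify e f y) (f y) < t"
      using t mollify_diff_const[OF e0 fe, of "f y"] by (simp add: dist_real_def)
  qed
qed

text \<open>Test the weak gradient of \<open>v z = u z - u y - A \<bullet> (z - y)\<close> with kernels shrinking to \<open>y\<close>. Since \<open>v\<close> is
  \<open>o(e)\<close> on the ball of radius \<open>e\<close>, where the gradient of the kernel has \<open>L\<^sup>1\<close>-norm \<open>O(1/e)\<close>, one side
  tends to \<open>0\<close>; the other one tends to \<open>A - g y\<close>.\<close>

lemma weak_grad_eq_derivative:
  fixes u :: "real^'n::finite \<Rightarrow> real"
  assumes w: "weak_grad U u g" and U: "open U" "y \<in> U"
    and D: "(u has_derivative (\<lambda>h. A \<bullet> h)) (at y)"
    and l: "lebesgue_point (\<lambda>z. g z $ i) y"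
  shows "g y $ i = A $ i"
proof -
  define F where "F z = u y + A \<bullet> (z - y)" for z
  define v where "v z = u z - F z" for z
  have wF: "weak_grad U F (\<lambda>z. A)"
    by (rule weak_grad_C1) (auto simp: F_def[abs_def] intro!: derivative_eq_intros)
  have wv: "weak_grad U v (\<lambda>z. g z - A)"
    using weak_grad_diff[OF w wF] by (simp add: v_def[abs_def])
  obtain r where r: "r > 0" "cball y r \<subseteq> U" using U by (auto simp: open_contains_cball)
  have gi: "set_integrable lebesgue (cball y r) (\<lambda>z. g z $ i)"
    using w r by (auto simp: weak_grad_def loc_integrable_def)
  have lim1: "((\<lambda>e. mollify e (\<lambda>z. g z $ i) y - A $ i) \<longlongrightarrow> g y $ i - A $ i) (at_right 0)"
    by (intro tendsto_diff mollify_tendsto_lebesgue_point[OF gi r(1) l] tendsto_const)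
  obtain B where B: "B > 0" "\<And>e z::real^'n. e > 0 \<Longrightarrow> norm (grad (kern e) z) \<le> B / (e * measure lebesgue (ball (0::real^'n) e))"
    using grad_kern_bound by blast
  have lim2: "((\<lambda>e. mollify e (\<lambda>z. g z $ i) y - A $ i) \<longlongrightarrow> 0) (at_right 0)"
  proof (rule tendstoI)
    fix t :: real assume t: "t > 0"
    \<comment> \<open>On the ball the integrand is at most \<open>s * e\<close> times
      \<open>B / (e * ?m)\<close>, and the volume is \<open>?m\<close>, so the integral is at most
      \<open>s * B = t/2\<close>.\<close>
    define s where "s = t / (2 * B)"
    have s: "s > 0" using t B by (simp add: s_def)
    obtain d where d: "d > 0" "\<And>z. norm (z - y) < d \<Longrightarrow> norm (u z - u y - A \<bullet> (z - y)) \<le> s * norm (z - y)"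
      using D s unfolding has_derivative_at_alt by meson
    show "\<forall>\<^sub>F e in at_right 0. dist (mollify e (\<lambda>z. g z $ i) y - A $ i) 0 < t"
      unfolding eventually_at_right_field
    proof (intro exI conjI allI impI)
      show "0 < min d r" using d r by simp
      fix e :: real assume e0: "0 < e" and e1: "e < min d r"
      let ?m = "measure lebesgue (ball (0::real^'n) e)"
      have m: "?m > 0" by (rule measure_ball_pos[OF e0])
      have my: "measure lebesgue (cball y e) = ?m" using e0 by (simp add: content_ball content_cball)
      have ye: "cball y e \<subseteq> U" using r(2) e1 by (auto simp: subset_iff)
      have ge: "set_integrable lebesgue (cball y e) (\<lambda>z. g z $ i)"
        using w ye by (auto simp: weak_grad_def loc_integrable_def)
      have ve: "set_integrable lebesgue (cball y e) v"
        using wv ye by (auto simp: weak_grad_def loc_integrable_def)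
      have *: "(LINT z|lebesgue. v z * grad (kern e) (z - y) $ i) = - (mollify e (\<lambda>z. g z $ i) y - A $ i)"
        using weak_grad_kern[OF wv e0 ye, of i] mollify_diff_const[OF e0 ge, of "A $ i"] by simp
      have "norm (LINT z|lebesgue. v z * grad (kern e) (z - y) $ i) \<le> (LINT z|lebesgue. s * B / ?m * indicator (cball y e) z)"
      proof (rule order_trans[OF integral_norm_bound integral_mono])
        have "integrable lebesgue (\<lambda>z. v z * (grad (kern e) (z - y) \<bullet> axis i 1))"
          by (rule integrable_mollify(2)[OF e0 ve]) simp
        then show "integrable lebesgue (\<lambda>z. norm (v z * grad (kern e) (z - y) $ i))" by (simp add: inner_axis)
        show "integrable lebesgue (\<lambda>z. s * B / ?m * indicator (cball y e) z)"
          using set_integrable_const_compact[OF compact_cball, of y e "1::real"]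
          by (intro integrable_mult_right) (simp add: set_integrable_def)
        fix z
        show "norm (v z * grad (kern e) (z - y) $ i) \<le> s * B / ?m * indicator (cball y e) z"
        proof (cases "z \<in> cball y e")
          case True
          then have zy: "norm (z - y) \<le> e" by (simp add: dist_norm norm_minus_commute)
          then have "norm (v z) \<le> s * norm (z - y)" using d(2)[of z] e1 by (simp add: v_def F_def diff_diff_eq)
          also have "\<dots> \<le> s * e" using zy s by (intro mult_left_mono) auto
          finally have v: "norm (v z) \<le> s * e" .
          have "\<bar>grad (kern e) (z - y) $ i\<bar> \<le> B / (e * ?m)"
            using B(2)[OF e0, of "z - y"] component_le_norm_cart[of "grad (kern e) (z - y)" i] by linarith
          then have "norm (v z) * \<bar>grad (kern e) (z - y) $ i\<bar> \<le> (s * e) * (B / (e * ?m))"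
            using v s e0 by (intro mult_mono) auto
          then show ?thesis using True e0 m by (simp add: abs_mult)
        next
          case False
          then have "norm (z - y) > e" by (simp add: dist_norm norm_minus_commute)
          then show ?thesis using False by (simp add: grad_kern_0[OF e0])
        qed
      qed
      also have "\<dots> = t / 2" using m B by (simp add: my s_def)
      finally have "\<bar>mollify e (\<lambda>z. g z $ i) y - A $ i\<bar> \<le> t/2" unfolding * by (simp add: abs_minus_commute)
      then show "dist (mollify e (\<lambda>z. g z $ i) y - A $ i) 0 < t" using t by simp
    qed
  qed
  show ?thesis using tendsto_unique[OF _ lim1 lim2] by simp
qed

text \<open>The exceptional set is contained in the non-Lebesgue points of the components of
  \<open>g\<close>; it does not depend on \<open>A\<close>, so the quantifier over \<open>A\<close>
  may stand inside.\<close>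

lemma AE_weak_grad_eq_derivative:
  fixes u :: "real^'n::finite \<Rightarrow> real"
  assumes w: "weak_grad U u g" and U: "open U"
  shows "AE y in lebesgue. y \<in> U \<longrightarrow> (\<forall>A. (u has_derivative (\<lambda>h. A \<bullet> h)) (at y) \<longrightarrow> g y = A)"
proof -
  have "AE y in lebesgue. \<forall>i\<in>UNIV. y \<in> U \<longrightarrow> lebesgue_point (\<lambda>z. g z $ i) y"
    using w U by (intro AE_finite_allI AE_lebesgue_point_loc) (auto simp: weak_grad_def)
  then show ?thesis
    by eventually_elim (auto simp: vec_eq_iff intro: weak_grad_eq_derivative[OF w U])
qed

text \<open>\<open>g - g'\<close> is a weak gradient of the zero function, whose classical
  derivative is 0 everywhere. Since \<open>wgrad\<close> is an arbitrary choice among weak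
  gradients, this is what permits replacing it by a concrete one.\<close>

lemma weak_grad_unique:
  assumes "weak_grad U u g" "weak_grad U u g'" "open U"
  shows "AE y in lebesgue. y \<in> U \<longrightarrow> g y = g' y"
proof -
  have "weak_grad U (\<lambda>x. u x - u x) (\<lambda>x. g x - g' x)" using assms by (intro weak_grad_diff)
  from AE_weak_grad_eq_derivative[OF this assms(3)] show ?thesis
  proof eventually_elim
    case (elim y)
    have "((\<lambda>x. u x - u x) has_derivative (\<lambda>h. 0 \<bullet> h)) (at y)" by simp
    then have "g y - g' y = 0" if "y \<in> U" using elim that by blast
    then show ?case by simp
  qed
qed

lemma weakly_diff_wgrad: "weakly_diff U u \<Longrightarrow> weak_grad U u (wgrad U u)"
  unfolding wgrad_def by (rule someI_ex[where P="weak_grad U u"]) (auto simp: weakly_diff_def)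

lemma mollify_inner:
  assumes e: "e > 0" and g: "\<And>i. set_integrable lebesgue (cball y e) (\<lambda>z. g z $ i)"
  shows "(\<chi> i. mollify e (\<lambda>z. g z $ i) y) \<bullet> h = mollify e (\<lambda>z. g z \<bullet> h) y"
proof -
  have "dist y y + e \<le> e" by simp
  from integrable_mollify(1)[OF e g this]
  have i: "integrable lebesgue (\<lambda>z. g z $ i * kern e (z - y))" for i .
  have "mollify e (\<lambda>z. g z \<bullet> h) y = (LINT z|lebesgue. (\<Sum>i\<in>UNIV. (g z $ i * kern e (z - y)) * h $ i))"
    unfolding mollify_def inner_vec_def sum_distrib_right
    by (intro Bochner_Integration.integral_cong refl sum.cong) simp
  also have "\<dots> = (\<Sum>i\<in>UNIV. mollify e (\<lambda>z. g z $ i) y * h $ i)"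
    unfolding mollify_def by (subst Bochner_Integration.integral_sum) (use i in auto)
  finally show ?thesis by (simp add: inner_vec_def)
qed

section \<open>Functions with bounded weak gradient\<close>

text \<open>Pairing with the mollified vector \<open>v\<close> itself reduces the claim to the
  scalar bound: \<open>|v|^2\<close> is the mollification of \<open>g \<bullet> v\<close>, hence at
  most \<open>M * |v|\<close>. This keeps the constant free of dimensional factors.\<close>

lemma mollify_norm_le:
  fixes g :: "real^'n::finite \<Rightarrow> real^'n"
  assumes e: "e > 0" and g: "\<And>i. set_integrable lebesgue (cball y e) (\<lambda>z. g z $ i)"
    and M: "M \<ge> 0" "AE z in lebesgue. z \<in> ball y e \<longrightarrow> norm (g z) \<le> M"
  shows "norm (\<chi> i. mollify e (\<lambda>z. g z $ i) y) \<le> M"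
proof -
  define v where "v = (\<chi> i. mollify e (\<lambda>z. g z $ i) y)"
  have "\<bar>mollify e (\<lambda>z. g z \<bullet> v) y\<bar> \<le> M * norm v"
  proof (rule mollify_le[OF e])
    have "integrable lebesgue (\<lambda>z. \<Sum>i\<in>UNIV. (indicator (cball y e) z *\<^sub>R g z $ i) * v $ i)"
      using g by (intro Bochner_Integration.integrable_sum integrable_mult_left) (simp only: set_integrable_def)
    then show "set_integrable lebesgue (cball y e) (\<lambda>z. g z \<bullet> v)"
      by (simp add: set_integrable_def inner_vec_def sum_distrib_left mult.assoc)
    show "AE z in lebesgue. z \<in> ball y e \<longrightarrow> \<bar>g z \<bullet> v\<bar> \<le> M * norm v"
      using M(2)
    proof eventually_elim
      case (elim z)
      then show ?case using Cauchy_Schwarz_ineq2[of "g z" v] mult_right_mono[of "norm (g z)" M "norm v"] by auto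
    qed
  qed
  then have "norm v * norm v \<le> M * norm v"
    using mollify_inner[OF e g, of v] by (simp add: v_def[symmetric] norm_eq_square power2_norm_eq_inner[symmetric] power2_eq_square)
  then have "norm v \<le> M" using M(1) by (cases "v = 0") auto
  then show ?thesis by (simp add: v_def)
qed

lemma mollify_lipschitz:
  fixes u :: "real^'n::finite \<Rightarrow> real"
  assumes w: "weak_grad U u g" and e: "e > 0" and S: "convex S" "\<And>y. y \<in> S \<Longrightarrow> cball y (2*e) \<subseteq> U"
    and B: "\<And>y. y \<in> S \<Longrightarrow> norm (\<chi> i. mollify e (\<lambda>z. g z $ i) y) \<le> B"
    and ab: "a \<in> S" "b \<in> S"
  shows "\<bar>mollify e u a - mollify e u b\<bar> \<le> B * norm (a - b)"
proof -
  have "norm (mollify e u a - mollify e u b) \<le> B * norm (a - b)"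
  proof (rule differentiable_bound[OF S(1) _ _ ab, where f'="\<lambda>y h. (\<chi> i. mollify e (\<lambda>z. g z $ i) y) \<bullet> h"])
    fix y assume y: "y \<in> S"
    show "(mollify e u has_derivative (\<bullet>) (\<chi> i. mollify e (\<lambda>z. g z $ i) y)) (at y within S)"
      using mollify_has_derivative[OF w e S(2)[OF y]] by (rule has_derivative_at_withinI)
    show "onorm ((\<bullet>) (\<chi> i. mollify e (\<lambda>z. g z $ i) y)) \<le> B" by (rule onorm_inner_le[OF B[OF y]])
  qed
  then show ?thesis by simp
qed

text \<open>The gradients of the mollifications inherit the bound \<open>M\<close>, so the
  mollifications are \<open>M\<close>-Lipschitz on slightly smaller balls, and they converge
  pointwise to the continuous \<open>u\<close>.\<close>

theorem weak_grad_bounded_imp_lipschitz: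
  fixes u :: "real^'n::finite \<Rightarrow> real"
  assumes w: "weak_grad U u g" and c: "continuous_on U u" and M: "M \<ge> 0" "AE x in lebesgue. x \<in> U \<longrightarrow> norm (g x) \<le> M"
    and ball: "ball x0 r \<subseteq> U" and ab: "a \<in> ball x0 r" "b \<in> ball x0 r"
  shows "\<bar>u a - u b\<bar> \<le> M * norm (a - b)"
proof -
  \<comment> \<open>A radius beyond both points and below \<open>r\<close>; the gap leaves room for
    the balls of radius \<open>2*e\<close> on which differentiating the mollification needs
    data.\<close>
  define r' where "r' = (max (dist x0 a) (dist x0 b) + r) / 2"
  have r': "dist x0 a < r'" "dist x0 b < r'" "r' < r" using ab by (auto simp: r'_def)
  have sub: "cball y (2*e) \<subseteq> ball x0 r" if "y \<in> ball x0 r'" "e \<le> (r - r')/2" for y e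
  proof
    fix z assume "z \<in> cball y (2*e)"
    then show "z \<in> ball x0 r" using that dist_triangle[of x0 z y] by auto
  qed
  have "\<forall>\<^sub>F e in at_right 0. \<bar>mollify e u a - mollify e u b\<bar> \<le> M * norm (a - b)"
    unfolding eventually_at_right_field
  proof (intro exI conjI allI impI)
    show "0 < (r - r')/2" using r' by simp
    fix e :: real assume e: "0 < e" "e < (r - r')/2"
    show "\<bar>mollify e u a - mollify e u b\<bar> \<le> M * norm (a - b)"
    proof (rule mollify_lipschitz[OF w e(1) convex_ball[of x0 r']])
      show "a \<in> ball x0 r'" "b \<in> ball x0 r'" using r' by auto
      fix y assume y: "y \<in> ball x0 r'"
      show s: "cball y (2*e) \<subseteq> U" using sub[OF y, of e] e ball by auto
      have s': "cball y e \<subseteq> U" using s e by (auto simp: subset_iff)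
      show "norm (\<chi> i. mollify e (\<lambda>z. g z $ i) y) \<le> M"
      proof (rule mollify_norm_le[OF e(1) _ M(1)])
        show "set_integrable lebesgue (cball y e) (\<lambda>z. g z $ i)" for i
          using w s' by (simp add: weak_grad_def loc_integrable_def)
        show "AE z in lebesgue. z \<in> ball y e \<longrightarrow> norm (g z) \<le> M"
          using M(2) by eventually_elim (use s' in \<open>auto simp: subset_iff\<close>)
      qed
    qed
  qed
  moreover have lim: "((\<lambda>e. mollify e u p) \<longlongrightarrow> u p) (at_right 0)" if "p \<in> ball x0 r" for p
  proof -
    have U': "\<exists>t>0. cball p t \<subseteq> ball x0 r" using that open_contains_cball open_ball by blast
    then obtain t where t: "t > 0" "cball p t \<subseteq> U" using ball by auto
    show ?thesis
    proof (rule mollify_tendsto_lebesgue_point[OF _ t(1)])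
      show "set_integrable lebesgue (cball p t) u" using w t by (simp add: weak_grad_def loc_integrable_def)
      have "continuous_on (ball x0 r) u" using c ball continuous_on_subset by blast
      then show "lebesgue_point u p"
        using that by (intro isCont_imp_lebesgue_point) (simp add: continuous_on_eq_continuous_at)
    qed
  qed
  have "((\<lambda>e. \<bar>mollify e u a - mollify e u b\<bar>) \<longlongrightarrow> \<bar>u a - u b\<bar>) (at_right 0)"
    by (intro tendsto_rabs tendsto_diff lim ab)
  ultimately show ?thesis by (intro tendsto_upperbound) auto
qed

text \<open>The function \<open>v z = u z - u x - g x \<bullet> (z - x)\<close> is compared with its mollification at scale \<open>\<tau> r\<close> on the ball
  of radius \<open>r\<close>: the error is \<open>O(\<tau> r)\<close> because \<open>v\<close> is Lipschitz, and the gradient of the mollification is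
  \<open>\<tau>\<^sup>-\<^sup>n o(1)\<close> as \<open>r \<rightarrow> 0\<close> because \<open>x\<close> is a Lebesgue point.\<close>

theorem weak_grad_bounded_imp_has_derivative:
  fixes u :: "real^'n::finite \<Rightarrow> real"
  assumes w: "weak_grad U u g" and c: "continuous_on U u" and M: "M \<ge> 0" "AE x in lebesgue. x \<in> U \<longrightarrow> norm (g x) \<le> M"
    and U: "open U" "x \<in> U" and l: "\<And>i. lebesgue_point (\<lambda>z. g z $ i) x"
  shows "(u has_derivative (\<lambda>h. g x \<bullet> h)) (at x)"
proof -
  let ?n = "real CARD('n)" and ?k = "kern_const TYPE('n)"
  define F where "F z = u x + g x \<bullet> (z - x)" for z
  define v where "v z = u z - F z" for z
  define L where "L = M + norm (g x)"
  have L: "L \<ge> 0" using M by (simp add: L_def)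
  have k: "?k > 0" by (rule kern_const_pos)
  have wF: "weak_grad U F (\<lambda>z. g x)"
    by (rule weak_grad_C1) (auto simp: F_def[abs_def] intro!: derivative_eq_intros)
  have wv: "weak_grad U v (\<lambda>z. g z - g x)"
    using weak_grad_diff[OF w wF] by (simp add: v_def[abs_def])
  have cv: "continuous_on U v"
    unfolding v_def F_def by (intro continuous_intros c)
  have gL: "AE z in lebesgue. z \<in> U \<longrightarrow> norm (g z - g x) \<le> L"
    using M(2) by eventually_elim (auto simp: L_def intro: order_trans[OF norm_triangle_ineq4])
  obtain r0 where r0: "r0 > 0" "ball x r0 \<subseteq> U" using U by (auto simp: open_contains_ball)
  have lip: "\<bar>v a - v b\<bar> \<le> L * norm (a - b)" if "a \<in> ball x r0" "b \<in> ball x r0" for a b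
    by (rule weak_grad_bounded_imp_lipschitz[OF wv cv L gL r0(2) that])
  have "\<exists>d>0. \<forall>y. norm (y - x) < d \<longrightarrow> norm (u y - u x - g x \<bullet> (y - x)) \<le> \<eta> * norm (y - x)" if \<eta>: "\<eta> > 0" for \<eta>
  proof -
    \<comment> \<open>The smoothing errors at \<open>y\<close> and at \<open>x\<close> are at most
      \<open>L * e\<close> each, with \<open>e = 2 * \<tau> * s\<close>; their sum
      \<open>4 * L * \<tau> * s\<close> has to be at most half of \<open>\<eta> * s\<close>. Writing
      \<open>L + 1\<close> covers \<open>L = 0\<close>, and \<open>\<tau> \<le> 1/2\<close> gives
      \<open>2 * e \<le> r\<close>.\<close>
    define \<tau> where "\<tau> = min (1/2) (\<eta> / (8 * (L + 1)))"
    have "\<eta> / (8 * (L + 1)) > 0" using \<eta> L by (intro divide_pos_pos) simp_all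
    then have \<tau>: "\<tau> > 0" "\<tau> \<le> 1/2" unfolding \<tau>_def by linarith+
    have "\<tau> \<le> \<eta> / (8 * (L + 1))" by (simp add: \<tau>_def)
    then have "8 * (L + 1) * \<tau> \<le> \<eta>" using L by (simp add: field_simps)
    then have L\<tau>: "4 * L * \<tau> \<le> \<eta> / 2" using \<tau> by (simp add: algebra_simps)
    \<comment> \<open>The ball of radius \<open>2 * r\<close> has \<open>(2/\<tau>)^CARD('n)\<close>
      times the volume of the kernel's ball, so \<open>mollify_le_average\<close> yields at most
      \<open>\<eta> / (2 * ?n)\<close> for each of the \<open>?n\<close> components of the
      gradient.\<close>
    define \<delta> where "\<delta> = \<eta> / (2 * ?n * ?k * (2/\<tau>)^CARD('n))"
    have n: "?n > 0" by simp
    have \<delta>: "\<delta> > 0" using \<eta> \<tau> k by (simp add: \<delta>_def)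
    have "\<exists>d>0. \<forall>r. 0 < r \<and> r < d \<longrightarrow>
       (\<integral>\<^sup>+ z\<in>ball x r. ennreal \<bar>g z $ i - g x $ i\<bar> \<partial>lebesgue) \<le> ennreal \<delta> * emeasure lebesgue (ball x r)" for i
      using l[of i] \<delta> unfolding lebesgue_point_def by blast
    then have "\<exists>dd. \<forall>i. dd i > 0 \<and> (\<forall>r. 0 < r \<and> r < dd i \<longrightarrow>
       (\<integral>\<^sup>+ z\<in>ball x r. ennreal \<bar>g z $ i - g x $ i\<bar> \<partial>lebesgue) \<le> ennreal \<delta> * emeasure lebesgue (ball x r))"
      by (intro choice allI)
    then obtain dd where dd: "\<And>i. dd i > 0" "\<And>i r. 0 < r \<Longrightarrow> r < dd i \<Longrightarrow>
       (\<integral>\<^sup>+ z\<in>ball x r. ennreal \<bar>g z $ i - g x $ i\<bar> \<partial>lebesgue) \<le> ennreal \<delta> * emeasure lebesgue (ball x r)"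
      by blast
    define d where "d = Min (range dd)"
    have d: "d > 0" "\<And>i. d \<le> dd i" using dd(1) by (auto simp: d_def)
    show ?thesis
    proof (intro exI conjI allI impI)
      show "min d r0 / 8 > 0" using d r0 by simp
      fix y assume y: "norm (y - x) < min d r0 / 8"
      show "norm (u y - u x - g x \<bullet> (y - x)) \<le> \<eta> * norm (y - x)"
      proof (cases "y = x")
        case False
        define s where "s = norm (y - x)"
        have s: "s > 0" using False by (simp add: s_def)
        \<comment> \<open>Twice the distance, so that \<open>y\<close> lies in the open ball
          \<open>ball x r\<close>.\<close>
        define r where "r = 2 * s"
        define e where "e = \<tau> * r"
        have "8 * s < d" "8 * s < r0" using y by (auto simp: s_def)
        then have r: "r > 0" "2 * r < d" "2 * r < r0" using s by (simp_all add: r_def)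
        have e: "e > 0" "2 * e \<le> r" using r \<tau> by (auto simp: e_def)
        have w0: "cball w (2*e) \<subseteq> ball x (2*r)" if "w \<in> ball x r" for w
        proof
          fix z assume "z \<in> cball w (2*e)"
          then show "z \<in> ball x (2*r)" using that e dist_triangle[of x z w] by auto
        qed
        have wU: "cball w (2*e) \<subseteq> U" if "w \<in> ball x r" for w
          using w0[OF that] r r0 by (auto simp: subset_iff)
        have yr: "y \<in> ball x r" "x \<in> ball x r" using s by (auto simp: r_def s_def dist_norm norm_minus_commute)
        have si: "set_integrable lebesgue (cball w e) f" if "w \<in> ball x r" "loc_integrable U f" for w f
        proof -
          have "cball w e \<subseteq> U" using wU[OF that(1)] e by (auto simp: subset_iff)
          then show ?thesis using that(2) by (simp add: loc_integrable_def)
        qed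
        have lv: "loc_integrable U v" "\<And>i. loc_integrable U (\<lambda>z. (g z - g x) $ i)"
          using wv by (auto simp: weak_grad_def)
        let ?m = "measure lebesgue (ball (0::real^'n) e)"
        have m: "?m > 0" by (rule measure_ball_pos[OF e(1)])
        have m2: "measure lebesgue (ball x (2*r)) = (2/\<tau>)^CARD('n) * ?m"
          using measure_ball_scale[of "2*r" e x "0::real^'n"] r e by (simp add: e_def)
        have gb: "norm (\<chi> i. mollify e (\<lambda>z. (g z - g x) $ i) w) \<le> \<eta> / 2" if wr: "w \<in> ball x r" for w
        proof -
          have "\<bar>mollify e (\<lambda>z. (g z - g x) $ i) w\<bar> \<le> ?k * (\<delta> * ((2/\<tau>)^CARD('n) * ?m)) / ?m" for i
          proof (rule mollify_le_average[OF e(1) si[OF wr lv(2)]])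
            show "ball w e \<subseteq> ball x (2*r)" using w0[OF wr] e by (auto simp: subset_iff)
            show "(\<integral>\<^sup>+ z\<in>ball x (2*r). ennreal \<bar>(g z - g x) $ i\<bar> \<partial>lebesgue) \<le> ennreal (\<delta> * ((2/\<tau>)^CARD('n) * ?m))"
            proof -
              have "(\<integral>\<^sup>+ z\<in>ball x (2*r). ennreal \<bar>g z $ i - g x $ i\<bar> \<partial>lebesgue) \<le> ennreal \<delta> * emeasure lebesgue (ball x (2*r))"
                by (rule dd(2)) (use r d(2)[of i] in linarith)+
              also have "emeasure lebesgue (ball x (2*r)) = ennreal ((2/\<tau>)^CARD('n) * ?m)"
                unfolding m2[symmetric] using r by (intro emeasure_ball) simp
              also have "ennreal \<delta> * \<dots> = ennreal (\<delta> * ((2/\<tau>)^CARD('n) * ?m))"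
                using \<delta> \<tau> m by (intro ennreal_mult[symmetric]) simp_all
              finally show ?thesis by (simp only: vector_minus_component)
            qed
            show "0 \<le> \<delta> * ((2/\<tau>)^CARD('n) * ?m)" using \<delta> \<tau> m by simp
          qed
          also have "?k * (\<delta> * ((2/\<tau>)^CARD('n) * ?m)) / ?m = \<eta> / (2 * ?n)"
          proof -
            define q where "q = (2/\<tau>)^CARD('n)"
            have "q > 0" using \<tau> by (simp add: q_def)
            then show ?thesis using m k unfolding \<delta>_def q_def[symmetric] by (simp add: field_simps)
          qed
          finally have "\<bar>mollify e (\<lambda>z. (g z - g x) $ i) w\<bar> \<le> \<eta> / (2 * ?n)" for i .
          then have "(\<Sum>i\<in>UNIV. \<bar>mollify e (\<lambda>z. (g z - g x) $ i) w\<bar>) \<le> (\<Sum>i\<in>(UNIV::'n set). \<eta> / (2 * ?n))"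
            by (intro sum_mono)
          also have "\<dots> = \<eta> / 2" by simp
          finally show ?thesis
            using norm_le_l1_cart[of "\<chi> i. mollify e (\<lambda>z. (g z - g x) $ i) w"] by simp
        qed
        have 1: "\<bar>mollify e v y - mollify e v x\<bar> \<le> \<eta> / 2 * s"
          unfolding s_def by (rule mollify_lipschitz[OF wv e(1) convex_ball[of x r] wU gb yr])
        have 2: "\<bar>mollify e v w - v w\<bar> \<le> L * e" if wr: "w \<in> ball x r" for w
        proof -
          have "\<bar>mollify e (\<lambda>z. v z - v w) w\<bar> \<le> L * e"
          proof (rule mollify_le[OF e(1)])
            show "set_integrable lebesgue (cball w e) (\<lambda>z. v z - v w)"
              by (intro set_integral_diff si[OF wr lv(1)] set_integrable_const_compact) simp
            show "AE z in lebesgue. z \<in> ball w e \<longrightarrow> \<bar>v z - v w\<bar> \<le> L * e"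
            proof (intro AE_I2 impI)
              fix z assume z: "z \<in> ball w e"
              have "z \<in> cball w (2*e)" using z e by simp
              then have zw: "z \<in> ball x r0" "w \<in> ball x r0" using w0[OF wr] wr r by auto
              have "\<bar>v z - v w\<bar> \<le> L * norm (z - w)" by (rule lip[OF zw])
              also have "\<dots> \<le> L * e" using z L by (intro mult_left_mono) (auto simp: dist_norm norm_minus_commute)
              finally show "\<bar>v z - v w\<bar> \<le> L * e" .
            qed
          qed
          then show ?thesis using mollify_diff_const[OF e(1) si[OF wr lv(1)], of "v w"] by simp
        qed
        have "v x = 0" by (simp add: v_def F_def)
        then have "\<bar>v y\<bar> \<le> \<eta> / 2 * s + 2 * (L * e)" using 1 2[OF yr(1)] 2[OF yr(2)] by linarith
        also have "2 * (L * e) = (4 * L * \<tau>) * s" by (simp add: e_def r_def)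
        also have "\<eta> / 2 * s + (4 * L * \<tau>) * s \<le> \<eta> * s"
          using mult_right_mono[OF L\<tau>, of s] s by linarith
        finally show ?thesis by (simp add: v_def F_def s_def diff_diff_eq)
      qed simp
    qed
  qed
  then show ?thesis unfolding has_derivative_at_alt by (auto intro: bounded_linear_inner_right)
qed

section \<open>Approximation by smooth functions\<close>

text \<open>Fubini's theorem, together with the unit mass of the kernel in its other variable, which
  follows from evenness. The Borel representative \<open>F\<close> of \<open>|f|\<close> makes the
  integrand jointly measurable on the product space.\<close>

lemma nn_integral_mollify_le:
  fixes f :: "real^'n::finite \<Rightarrow> real"
  assumes e: "e > 0" and f: "integrable lebesgue f"
  shows "(\<integral>\<^sup>+ y. ennreal \<bar>mollify e f y\<bar> \<partial>lebesgue) \<le> (\<integral>\<^sup>+ z. ennreal \<bar>f z\<bar> \<partial>lebesgue)"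
proof -
  have fm: "(\<lambda>z. ennreal \<bar>f z\<bar>) \<in> borel_measurable (completion lborel)"
    using f by (intro measurable_compose[OF borel_measurable_abs measurable_ennreal]) auto
  obtain F where F: "F \<in> borel_measurable lborel" "AE z in lborel. ennreal \<bar>f z\<bar> = F z"
    using completion_ex_borel_measurable[OF fm] by blast
  have Fm: "F \<in> borel_measurable borel" using F(1) by simp
  have km: "(\<lambda>w. ennreal (kern e w)) \<in> borel_measurable borel"
    using borel_measurable_continuous_onI[OF continuous_kern[OF e]] by measurable
  have 1: "ennreal \<bar>mollify e f y\<bar> \<le> (\<integral>\<^sup>+ z. F z * ennreal (kern e (z - y)) \<partial>lborel)" for y
  proof -
    have "integrable lebesgue (\<lambda>z. f z * kern e (z - y))"
    proof -
      have "set_integrable lebesgue (cball y e) f"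
        unfolding set_integrable_def using integrable_mult_indicator[OF _ f, of "cball y e"] by simp
      then show ?thesis using integrable_mollify(1)[OF e, of y e f y] by simp
    qed
    then have "ennreal (LINT z|lebesgue. \<bar>f z * kern e (z - y)\<bar>) = (\<integral>\<^sup>+ z. ennreal \<bar>f z * kern e (z - y)\<bar> \<partial>lebesgue)"
      by (intro nn_integral_eq_integral[symmetric]) auto
    also have "\<dots> = (\<integral>\<^sup>+ z. ennreal \<bar>f z\<bar> * ennreal (kern e (z - y)) \<partial>lborel)"
      by (simp add: nn_integral_completion abs_mult kern_nonneg[OF e] ennreal_mult)
    also have "\<dots> = (\<integral>\<^sup>+ z. F z * ennreal (kern e (z - y)) \<partial>lborel)"
      by (rule nn_integral_cong_AE) (use F(2) in \<open>eventually_elim, simp\<close>)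
    finally have eq: "ennreal (LINT z|lebesgue. \<bar>f z * kern e (z - y)\<bar>) = (\<integral>\<^sup>+ z. F z * ennreal (kern e (z - y)) \<partial>lborel)" .
    show ?thesis unfolding mollify_def eq[symmetric] by (intro ennreal_leI integral_abs_bound)
  qed
  have "(\<integral>\<^sup>+ y. ennreal \<bar>mollify e f y\<bar> \<partial>lebesgue) = (\<integral>\<^sup>+ y. ennreal \<bar>mollify e f y\<bar> \<partial>lborel)"
    by (rule nn_integral_completion)
  also have "\<dots> \<le> (\<integral>\<^sup>+ y. (\<integral>\<^sup>+ z. F z * ennreal (kern e (z - y)) \<partial>lborel) \<partial>lborel)"
    by (rule nn_integral_mono) (rule 1)
  also have "\<dots> = (\<integral>\<^sup>+ z. (\<integral>\<^sup>+ y. F z * ennreal (kern e (z - y)) \<partial>lborel) \<partial>lborel)"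
  proof (rule lborel_pair.Fubini')
    let ?P = "borel \<Otimes>\<^sub>M borel :: ((real^'n) \<times> (real^'n)) measure"
    have m1: "(\<lambda>p. F (fst p)) \<in> borel_measurable ?P"
      by (rule measurable_compose[OF measurable_fst Fm])
    have m2: "(\<lambda>p. fst p - snd p) \<in> borel_measurable ?P"
      by (rule borel_measurable_diff[OF measurable_fst measurable_snd])
    have "sets (lborel \<Otimes>\<^sub>M lborel :: ((real^'n) \<times> (real^'n)) measure) = sets ?P"
      by (rule sets_pair_measure_cong) simp_all
    then have "borel_measurable (lborel \<Otimes>\<^sub>M lborel) = (borel_measurable ?P :: ((real^'n) \<times> (real^'n) \<Rightarrow> ennreal) set)"
      by (rule measurable_cong_sets) (rule refl)
    then show "(\<lambda>(z, y). F z * ennreal (kern e (z - y))) \<in> borel_measurable (lborel \<Otimes>\<^sub>M lborel)"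
      using borel_measurable_times_ennreal[OF m1 measurable_compose[OF m2 km]]
      by (simp only: case_prod_beta')
  qed
  also have "\<dots> = (\<integral>\<^sup>+ z. F z \<partial>lborel)"
  proof (rule nn_integral_cong)
    fix z :: "real^'n"
    have kz: "(\<lambda>y. ennreal (kern e (z - y))) \<in> borel_measurable borel"
      by (rule measurable_compose[OF _ km]) simp
    have "(\<integral>\<^sup>+ y. ennreal (kern e (z - y)) \<partial>lborel) = (\<integral>\<^sup>+ y. ennreal (kern e (y - z)) \<partial>lebesgue)"
      by (simp add: nn_integral_completion kern_even[OF e, of z])
    also have "\<dots> = ennreal 1"
      using integral_kern[OF e, of z] integrable_kern_shift[OF e, of z]
      by (subst nn_integral_eq_integral) (auto simp: kern_nonneg[OF e])
    finally show "(\<integral>\<^sup>+ y. F z * ennreal (kern e (z - y)) \<partial>lborel) = F z"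
      using kz by (simp add: nn_integral_cmult)
  qed
  also have "\<dots> = (\<integral>\<^sup>+ z. ennreal \<bar>f z\<bar> \<partial>lborel)"
    by (rule nn_integral_cong_AE) (use F(2) in \<open>eventually_elim, simp\<close>)
  also have "\<dots> = (\<integral>\<^sup>+ z. ennreal \<bar>f z\<bar> \<partial>lebesgue)" by (simp add: nn_integral_completion)
  finally show ?thesis .
qed

lemma set_integrable_cball: "integrable lebesgue f \<Longrightarrow> set_integrable lebesgue (cball (y::'a::euclidean_space) r) (f :: _ \<Rightarrow> real)"
  unfolding set_integrable_def using integrable_mult_indicator[of "cball y r" lebesgue f] by simp

lemma continuous_mollify:
  assumes "e > 0" "integrable lebesgue f"
  shows "continuous_on UNIV (mollify e f)"
  using mollify_has_derivative_kern[OF assms(1) set_integrable_cball[OF assms(2)]]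
  by (meson continuous_at_imp_continuous_on has_derivative_continuous)

text \<open>Pointwise convergence holds at Lebesgue points, hence almost everywhere, and
  mollification does not increase the L1 norm; Scheffe's lemma upgrades the two to convergence in
  L1.\<close>

lemma mollify_tendsto_L1:
  fixes f :: "real^'n::finite \<Rightarrow> real"
  assumes f: "integrable lebesgue f" and e: "\<And>n. e n > 0" "e \<longlonglongrightarrow> 0"
  shows "(\<lambda>n. \<integral>\<^sup>+ y. ennreal \<bar>mollify (e n) f y - f y\<bar> \<partial>lebesgue) \<longlonglongrightarrow> 0"
proof -
  have ef: "filterlim e (at_right 0) sequentially"
  proof -
    have "e n \<noteq> 0" for n using e(1)[of n] by simp
    then show ?thesis using e by (auto simp: filterlim_at)
  qed
  have le: "(\<integral>\<^sup>+ y. ennreal \<bar>mollify (e n) f y\<bar> \<partial>lebesgue) \<le> (\<integral>\<^sup>+ z. ennreal \<bar>f z\<bar> \<partial>lebesgue)" for n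
    by (rule nn_integral_mollify_le[OF e(1) f])
  have "(\<lambda>n. \<integral>\<^sup>+ y. ennreal (norm (mollify (e n) f y - f y)) \<partial>lebesgue) \<longlonglongrightarrow> 0"
  proof (rule Scheffe_lemma1[OF _ f])
    show "integrable lebesgue (mollify (e n) f)" for n
    proof (rule integrableI_bounded)
      show "mollify (e n) f \<in> borel_measurable lebesgue"
        by (rule continuous_imp_measurable_lebesgue[OF continuous_mollify[OF e(1) f]])
      show "(\<integral>\<^sup>+ y. ennreal (norm (mollify (e n) f y)) \<partial>lebesgue) < \<infinity>"
        using le[of n] f unfolding integrable_iff_bounded by (auto intro: le_less_trans)
    qed
    show "AE y in lebesgue. (\<lambda>n. mollify (e n) f y) \<longlonglongrightarrow> f y"
      using AE_lebesgue_point[OF f]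
    proof eventually_elim
      case (elim y)
      show ?case
        by (rule filterlim_compose[OF mollify_tendsto_lebesgue_point[OF set_integrable_cball[OF f] zero_less_one elim] ef])
    qed
    show "limsup (\<lambda>n. \<integral>\<^sup>+ y. ennreal (norm (mollify (e n) f y)) \<partial>lebesgue) \<le> (\<integral>\<^sup>+ z. ennreal (norm (f z)) \<partial>lebesgue)"
      using le by (intro Limsup_bounded) auto
  qed
  then show ?thesis by simp
qed

text \<open>For a small radius the union of the closed balls about \<open>L\<close> stays in
  \<open>U\<close>; it is the sum of \<open>L\<close> and a closed ball at the origin, hence
  compact.\<close>

lemma compact_cball_neighbourhood:
  fixes L :: "'a::euclidean_space set"
  assumes "compact L" "open U" "L \<subseteq> U"
  obtains r K where "r > 0" "compact K" "K \<subseteq> U" "\<And>x. x \<in> L \<Longrightarrow> cball x r \<subseteq> K"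
proof -
  obtain r where r: "r > 0" "(\<Union>x\<in>L. cball x r) \<subseteq> U"
    using compact_subset_open_imp_cball_epsilon_subset[OF assms] by blast
  have "{x + z | x z. x \<in> L \<and> z \<in> cball 0 r} = (\<Union>x\<in>L. cball x r)"
  proof safe
    fix x z assume "x \<in> L" "z \<in> cball (0::'a) r"
    then show "x + z \<in> (\<Union>x\<in>L. cball x r)" by (auto simp: dist_norm intro!: bexI[of _ x])
  next
    fix x z assume "x \<in> L" "z \<in> cball x r"
    then show "\<exists>x' z'. z = x' + z' \<and> x' \<in> L \<and> z' \<in> cball 0 r"
      by (intro exI[of _ x] exI[of _ "z - x"]) (auto simp: dist_norm norm_minus_commute)
  qed
  then have "compact (\<Union>x\<in>L. cball x r)"
    using compact_sums[OF assms(1) compact_cball[of 0 r]] by simp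
  then show ?thesis using that[OF r(1) _ r(2)] by blast
qed

lemma mollify_cong:
  assumes "e > 0" "\<And>z. z \<in> ball y e \<Longrightarrow> f z = g z"
  shows "mollify e f y = mollify e g y"
  unfolding mollify_def
proof (rule Bochner_Integration.integral_cong)
  fix z show "f z * kern e (z - y) = g z * kern e (z - y)"
    using assms(2)[of z] by (cases "z \<in> ball y e") (simp_all add: kern_0[OF assms(1)] dist_norm norm_minus_commute)
qed simp

text \<open>Applied with a component of the kernel's gradient as \<open>q\<close>, this makes the
  gradients of mollifications continuous.\<close>

lemma continuous_convolution:
  fixes f :: "real^'n::finite \<Rightarrow> real"
  assumes f: "integrable lebesgue f" and q: "continuous_on UNIV q" and b: "\<And>z. \<bar>q z\<bar> \<le> B"
  shows "continuous_on UNIV (\<lambda>y. LINT z|lebesgue. f z * q (z - y))"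
  unfolding continuous_on_sequentially comp_def
proof (intro allI ballI impI, elim conjE)
  fix x :: "nat \<Rightarrow> real^'n" and a assume x: "x \<longlonglongrightarrow> a"
  have qs: "continuous_on UNIV (\<lambda>z. q (z - y))" for y
    by (rule continuous_on_compose2[OF q]) (auto intro!: continuous_intros)
  show "(\<lambda>n. LINT z|lebesgue. f z * q (z - x n)) \<longlonglongrightarrow> (LINT z|lebesgue. f z * q (z - a))"
  proof (rule integral_dominated_convergence[where w="\<lambda>z. \<bar>f z\<bar> * B"])
    show "(\<lambda>z. f z * q (z - a)) \<in> borel_measurable lebesgue" "(\<lambda>z. f z * q (z - x n)) \<in> borel_measurable lebesgue" for n
      using f continuous_imp_measurable_lebesgue[OF qs] by auto
    show "integrable lebesgue (\<lambda>z. \<bar>f z\<bar> * B)" using f by simp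
    show "AE z in lebesgue. (\<lambda>n. f z * q (z - x n)) \<longlonglongrightarrow> f z * q (z - a)"
    proof (rule AE_I2)
      fix z
      have "isCont q (z - a)" using q by (simp add: continuous_on_eq_continuous_at)
      moreover have "(\<lambda>n. z - x n) \<longlonglongrightarrow> z - a" by (intro tendsto_intros x)
      ultimately have "(\<lambda>n. q (z - x n)) \<longlonglongrightarrow> q (z - a)" by (rule isCont_tendsto_compose)
      then show "(\<lambda>n. f z * q (z - x n)) \<longlonglongrightarrow> f z * q (z - a)" by (rule tendsto_mult_left)
    qed
    show "AE z in lebesgue. norm (f z * q (z - x n)) \<le> \<bar>f z\<bar> * B" for n
      using b by (intro AE_I2) (simp add: abs_mult mult_left_mono)
  qed
qed

text \<open>The data consumed by the two halves of the chain rule: L1 convergence of the gradients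
  serves the components of the inner map, almost everywhere convergence serves the outer function,
  and the uniform bound on \<open>F n\<close> feeds dominated convergence in both. The approximants
  are C1 on the whole space, so composing with them raises no question of domains.\<close>

definition C1_approximates ::
    "(real^'n::finite) set \<Rightarrow> (real^'n \<Rightarrow> real) \<Rightarrow> (real^'n \<Rightarrow> real^'n) \<Rightarrow>
     (nat \<Rightarrow> real^'n \<Rightarrow> real) \<Rightarrow> (nat \<Rightarrow> real^'n \<Rightarrow> real^'n) \<Rightarrow> bool" where
  "C1_approximates L u g F P \<longleftrightarrow>
    (\<forall>n x. (F n has_derivative (\<lambda>h. P n x \<bullet> h)) (at x)) \<and>
    (\<forall>n. continuous_on UNIV (P n)) \<and>
    (\<forall>x\<in>L. (\<lambda>n. F n x) \<longlonglongrightarrow> u x) \<and>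
    (\<exists>B. \<forall>n. \<forall>x\<in>L. \<bar>F n x\<bar> \<le> B) \<and>
    (\<forall>i. (\<lambda>n. \<integral>\<^sup>+ x\<in>L. ennreal \<bar>P n x $ i - g x $ i\<bar> \<partial>lebesgue) \<longlonglongrightarrow> 0) \<and>
    (AE x in lebesgue. x \<in> L \<longrightarrow> (\<forall>i. (\<lambda>n. P n x $ i) \<longlonglongrightarrow> g x $ i))"

lemma C1_approximatesD:
  assumes "C1_approximates L u g F P"
  shows "(F n has_derivative (\<lambda>h. P n x \<bullet> h)) (at x)" "continuous_on UNIV (P n)"
    "x \<in> L \<Longrightarrow> (\<lambda>n. F n x) \<longlonglongrightarrow> u x" "\<exists>B. \<forall>n. \<forall>x\<in>L. \<bar>F n x\<bar> \<le> B"
    "(\<lambda>n. \<integral>\<^sup>+ x\<in>L. ennreal \<bar>P n x $ i - g x $ i\<bar> \<partial>lebesgue) \<longlonglongrightarrow> 0"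
    "AE x in lebesgue. x \<in> L \<longrightarrow> (\<forall>i. (\<lambda>n. P n x $ i) \<longlonglongrightarrow> g x $ i)"
  using assms unfolding C1_approximates_def by simp_all

text \<open>Cutting \<open>u\<close> off outside a compact neighbourhood \<open>K\<close> of
  \<open>L\<close> makes its mollifications globally C1, while on \<open>L\<close> they agree with
  those of \<open>u\<close> as long as the kernel radius is at most \<open>r\<close>. The bound by
  \<open>M\<close> is a separate conditional clause because the gradient may also be unbounded, as
  it is allowed to be for the inner map.\<close>

lemma ex_C1_approximation:
  fixes u :: "real^'n::finite \<Rightarrow> real"
  assumes w: "weak_grad U u g" and c: "continuous_on U u" and U: "open U" and L: "compact L" "L \<subseteq> U"
  obtains F P where "C1_approximates L u g F P"
    "\<forall>M\<ge>0. (AE x in lebesgue. x \<in> U \<longrightarrow> norm (g x) \<le> M) \<longrightarrow> (\<forall>n. \<forall>x\<in>L. norm (P n x) \<le> M)"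
proof -
  obtain r K where r: "r > 0" and K: "compact K" "K \<subseteq> U" "\<And>x. x \<in> L \<Longrightarrow> cball x r \<subseteq> K"
    using compact_cball_neighbourhood[OF L(1) U L(2)] by blast
  define e where "e n = r / real (Suc n)" for n
  have e: "e n > 0" "e n \<le> r" for n using r by (auto simp: e_def field_simps)
  have e0: "e \<longlonglongrightarrow> 0"
    unfolding e_def using tendsto_mult_right[OF LIMSEQ_Suc[OF lim_1_over_n], of r] by simp
  have ef: "filterlim e (at_right 0) sequentially"
  proof -
    have "e n \<noteq> 0" for n using e(1)[of n] by simp
    then show ?thesis using e e0 by (auto simp: filterlim_at)
  qed
  have gl: "loc_integrable U (\<lambda>x. g x $ i)" "loc_integrable U u" for i using w by (auto simp: weak_grad_def)
  define uK where "uK z = indicator K z *\<^sub>R u z" for z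
  define gK where "gK i z = indicator K z *\<^sub>R g z $ i" for i z
  have uKi: "integrable lebesgue uK" and gKi: "integrable lebesgue (gK i)" for i
    using gl K unfolding loc_integrable_def set_integrable_def uK_def gK_def by auto
  have inK: "z \<in> K" if "x \<in> L" "z \<in> cball x (e n)" for x z n
    using K(3)[OF that(1)] that(2) e(2)[of n] by (auto simp: subset_iff)
  have LK: "x \<in> K" if "x \<in> L" for x using inK[OF that, of x 0] e(1)[of 0] by simp
  have uKe: "mollify (e n) uK x = mollify (e n) u x" if "x \<in> L" for x n
  proof (rule mollify_cong[OF e(1)])
    fix z assume "z \<in> ball x (e n)"
    then have "z \<in> K" using inK[OF that, of z n] by simp
    then show "uK z = u z" by (simp add: uK_def)
  qed
  have gKe: "mollify (e n) (gK i) x = mollify (e n) (\<lambda>z. g z $ i) x" if "x \<in> L" for x n i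
  proof (rule mollify_cong[OF e(1)])
    fix z assume "z \<in> ball x (e n)"
    then have "z \<in> K" using inK[OF that, of z n] by simp
    then show "gK i z = g z $ i" by (simp add: gK_def)
  qed
  define F where "F n = mollify (e n) uK" for n
  define P where "P n x = (\<chi> i. - (LINT z|lebesgue. uK z * grad (kern (e n)) (z - x) $ i))" for n x
  have 1: "(F n has_derivative (\<lambda>h. P n x \<bullet> h)) (at x)" for n x
    unfolding F_def P_def by (rule mollify_has_derivative_kern[OF e(1) set_integrable_cball[OF uKi]])
  have 2: "continuous_on UNIV (P n)" for n
  proof -
    have gc: "continuous_on UNIV (grad (kern (e n)) :: real^'n \<Rightarrow> real^'n)"
      by (rule smooth_fun_has_derivative(3)[OF smooth_kern[OF e(1)]])
    have g0: "grad (kern (e n)) z = 0" if "z \<notin> cball 0 (e n)" for z :: "real^'n"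
      using that by (intro grad_kern_0[OF e(1)]) simp
    obtain C where C: "\<And>z::real^'n. norm (grad (kern (e n)) z) \<le> C"
      using compact_support_bounded[OF gc compact_cball g0] by blast
    have "continuous_on UNIV (\<lambda>x. LINT z|lebesgue. uK z * grad (kern (e n)) (z - x) $ i)" for i
    proof (rule continuous_convolution[OF uKi])
      show "continuous_on UNIV (\<lambda>z::real^'n. grad (kern (e n)) z $ i)" using gc by (intro continuous_intros)
      show "\<bar>grad (kern (e n)) z $ i\<bar> \<le> C" for z :: "real^'n"
        using C[of z] component_le_norm_cart order_trans by blast
    qed
    then show ?thesis unfolding P_def by (intro continuous_on_vec_lambda continuous_on_minus)
  qed
  have Pe: "P n x $ i = mollify (e n) (gK i) x" if "x \<in> L" for n x i
  proof -
    have "(LINT z|lebesgue. uK z * grad (kern (e n)) (z - x) $ i) = (LINT z|lebesgue. u z * grad (kern (e n)) (z - x) $ i)"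
    proof (rule Bochner_Integration.integral_cong)
      fix z
      show "uK z * grad (kern (e n)) (z - x) $ i = u z * grad (kern (e n)) (z - x) $ i"
      proof (cases "z \<in> cball x (e n)")
        case True then show ?thesis using inK[OF that True] by (simp add: uK_def)
      next
        case False then show ?thesis by (simp add: grad_kern_0[OF e(1)] dist_norm norm_minus_commute)
      qed
    qed simp
    also have "\<dots> = - mollify (e n) (\<lambda>z. g z $ i) x"
      by (rule weak_grad_kern[OF w e(1)]) (use inK[OF that] K(2) in blast)
    finally show ?thesis using gKe[OF that] by (simp add: P_def)
  qed
  have 3: "(\<lambda>n. F n x) \<longlonglongrightarrow> u x" if x: "x \<in> L" for x
  proof -
    have "lebesgue_point u x"
      using c U L x by (intro isCont_imp_lebesgue_point) (auto simp: continuous_on_eq_continuous_at)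
    moreover have "set_integrable lebesgue (cball x r) u"
      by (rule loc_integrableD[OF gl(2) subset_trans[OF K(3)[OF x] K(2)]])
    ultimately have "(\<lambda>n. mollify (e n) u x) \<longlonglongrightarrow> u x"
      by (intro filterlim_compose[OF mollify_tendsto_lebesgue_point[OF _ r] ef])
    then show ?thesis using uKe[OF x] by (simp add: F_def)
  qed
  have "compact (u ` K)" using c K by (meson compact_continuous_image continuous_on_subset)
  then have "bounded (u ` K)" by (rule compact_imp_bounded)
  then obtain B where B: "B > 0" "\<And>x. x \<in> K \<Longrightarrow> \<bar>u x\<bar> \<le> B" unfolding bounded_pos by auto
  have 4: "\<bar>F n x\<bar> \<le> B" if "x \<in> L" for n x
    unfolding F_def
  proof (rule mollify_le[OF e(1) set_integrable_cball[OF uKi]])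
    show "AE z in lebesgue. z \<in> ball x (e n) \<longrightarrow> \<bar>uK z\<bar> \<le> B"
      using B by (intro AE_I2) (auto simp: uK_def indicator_def)
  qed
  have 5: "(\<lambda>n. \<integral>\<^sup>+ x\<in>L. ennreal \<bar>P n x $ i - g x $ i\<bar> \<partial>lebesgue) \<longlonglongrightarrow> 0" for i
  proof (rule tendsto_sandwich[OF _ _ tendsto_const mollify_tendsto_L1[OF gKi e(1) e0, of i]])
    show "\<forall>\<^sub>F n in sequentially. 0 \<le> (\<integral>\<^sup>+ x\<in>L. ennreal \<bar>P n x $ i - g x $ i\<bar> \<partial>lebesgue)" by simp
    have "ennreal \<bar>P n x $ i - g x $ i\<bar> * indicator L x \<le> ennreal \<bar>mollify (e n) (gK i) x - gK i x\<bar>" for n x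
      using LK[of x] by (cases "x \<in> L") (simp_all add: Pe gK_def)
    then show "\<forall>\<^sub>F n in sequentially. (\<integral>\<^sup>+ x\<in>L. ennreal \<bar>P n x $ i - g x $ i\<bar> \<partial>lebesgue)
        \<le> (\<integral>\<^sup>+ x. ennreal \<bar>mollify (e n) (gK i) x - gK i x\<bar> \<partial>lebesgue)"
      by (intro always_eventually allI nn_integral_mono)
  qed
  have "AE x in lebesgue. \<forall>i\<in>UNIV. lebesgue_point (gK i) x"
    by (intro AE_finite_allI AE_lebesgue_point gKi) simp
  then have 6: "AE x in lebesgue. x \<in> L \<longrightarrow> (\<forall>i. (\<lambda>n. P n x $ i) \<longlonglongrightarrow> g x $ i)"
  proof eventually_elim
    case (elim x)
    show ?case
    proof (intro impI allI)
      fix i assume x: "x \<in> L"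
      have "lebesgue_point (gK i) x" using elim by blast
      then have "(\<lambda>n. mollify (e n) (gK i) x) \<longlonglongrightarrow> gK i x"
        by (intro filterlim_compose[OF mollify_tendsto_lebesgue_point[OF set_integrable_cball[OF gKi] zero_less_one] ef])
      then show "(\<lambda>n. P n x $ i) \<longlonglongrightarrow> g x $ i" using Pe[OF x] LK[OF x] by (simp add: gK_def)
    qed
  qed
  have 7: "norm (P n x) \<le> M" if "M \<ge> 0" "AE x in lebesgue. x \<in> U \<longrightarrow> norm (g x) \<le> M" "x \<in> L" for M n x
  proof -
    have xU: "cball x (e n) \<subseteq> U" using inK[OF that(3)] K(2) by blast
    have "P n x = (\<chi> i. mollify (e n) (\<lambda>z. g z $ i) x)"
      using Pe[OF that(3)] gKe[OF that(3)] by (simp add: vec_eq_iff)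
    also have "norm \<dots> \<le> M"
    proof (rule mollify_norm_le[OF e(1) loc_integrableD[OF gl(1) xU] that(1)])
      show "AE z in lebesgue. z \<in> ball x (e n) \<longrightarrow> norm (g z) \<le> M"
        using that(2) by eventually_elim (use xU in \<open>auto simp: subset_iff\<close>)
    qed
    finally show ?thesis .
  qed
  have "\<exists>B. \<forall>n. \<forall>x\<in>L. \<bar>F n x\<bar> \<le> B" using 4 by (intro exI[of _ B]) simp
  then have "C1_approximates L u g F P"
    unfolding C1_approximates_def using 1 2 3 5 6 by (intro conjI allI ballI)
  moreover have "\<forall>M\<ge>0. (AE x in lebesgue. x \<in> U \<longrightarrow> norm (g x) \<le> M) \<longrightarrow> (\<forall>n. \<forall>x\<in>L. norm (P n x) \<le> M)"
    using 7 by blast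
  ultimately show ?thesis by (rule that)
qed

section \<open>Limits of integrals of products\<close>

lemma integrable_mult_bounded:
  fixes a f :: "'a \<Rightarrow> real"
  assumes "a \<in> borel_measurable M" "\<And>x. \<bar>a x\<bar> \<le> C" "integrable M f"
  shows "integrable M (\<lambda>x. a x * f x)"
proof (rule Bochner_Integration.integrable_bound[of M "\<lambda>x. C * f x"])
  show "integrable M (\<lambda>x. C * f x)" using assms(3) by simp
  show "(\<lambda>x. a x * f x) \<in> borel_measurable M" using assms by auto
  show "AE x in M. norm (a x * f x) \<le> norm (C * f x)"
  proof (rule AE_I2)
    fix x
    have "\<bar>a x\<bar> \<le> \<bar>C\<bar>" using assms(2)[of x] by linarith
    then show "norm (a x * f x) \<le> norm (C * f x)" by (simp add: abs_mult mult_right_mono)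
  qed
qed

text \<open>Split \<open>a n * m n\<close> into \<open>a n * m'\<close>, treated by dominated
  convergence, and \<open>a n * (m n - m')\<close>, whose integral is at most \<open>C\<close> times
  an L1 error.\<close>

lemma tendsto_integral_mult_L1:
  fixes a :: "nat \<Rightarrow> 'a \<Rightarrow> real"
  assumes am: "\<And>n. a n \<in> borel_measurable M" and a'm: "a' \<in> borel_measurable M"
    and al: "AE x in M. (\<lambda>n. a n x) \<longlonglongrightarrow> a' x" and ab: "\<And>n x. \<bar>a n x\<bar> \<le> C"
    and m: "\<And>n. integrable M (m n)" "integrable M m'" and ml: "(\<lambda>n. \<integral>\<^sup>+ x. ennreal \<bar>m n x - m' x\<bar> \<partial>M) \<longlonglongrightarrow> 0"
  shows "(\<lambda>n. LINT x|M. a n x * m n x) \<longlonglongrightarrow> (LINT x|M. a' x * m' x)"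
proof -
  have ami: "integrable M (\<lambda>x. a n x * f x)" if "integrable M f" for n f
    by (rule integrable_mult_bounded[OF am ab that])
  have "(\<lambda>n. LINT x|M. a n x * m' x) \<longlonglongrightarrow> (LINT x|M. a' x * m' x)"
  proof (rule integral_dominated_convergence[where w="\<lambda>x. C * \<bar>m' x\<bar>"])
    show "AE x in M. (\<lambda>n. a n x * m' x) \<longlonglongrightarrow> a' x * m' x"
      using al by eventually_elim (intro tendsto_mult tendsto_const)
    show "AE x in M. norm (a n x * m' x) \<le> C * \<bar>m' x\<bar>" for n
      using ab by (intro AE_I2) (simp add: abs_mult mult_right_mono)
  qed (use am a'm m in auto)
  moreover have "(\<lambda>n. LINT x|M. a n x * (m n x - m' x)) \<longlonglongrightarrow> 0"
  proof (rule Lim_null_comparison)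
    have int: "integrable M (\<lambda>x. \<bar>m n x - m' x\<bar>)" for n using m by simp
    have eq: "(LINT x|M. \<bar>m n x - m' x\<bar>) = enn2real (\<integral>\<^sup>+ x. ennreal \<bar>m n x - m' x\<bar> \<partial>M)" for n
      by (rule integral_eq_nn_integral) (use int[of n] in auto)
    have "(\<lambda>n. LINT x|M. \<bar>m n x - m' x\<bar>) \<longlonglongrightarrow> 0"
      unfolding eq using ml by (intro tendsto_enn2real) simp_all
    then show "(\<lambda>n. C * (LINT x|M. \<bar>m n x - m' x\<bar>)) \<longlonglongrightarrow> 0"
      by (rule tendsto_mult_right_zero)
    show "\<forall>\<^sub>F n in sequentially. norm (LINT x|M. a n x * (m n x - m' x)) \<le> C * (LINT x|M. \<bar>m n x - m' x\<bar>)"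
    proof (intro always_eventually allI)
      fix n
      have "norm (LINT x|M. a n x * (m n x - m' x)) \<le> (LINT x|M. C * \<bar>m n x - m' x\<bar>)"
      proof (rule order_trans[OF integral_norm_bound integral_mono])
        show "integrable M (\<lambda>x. norm (a n x * (m n x - m' x)))" using ami[of "\<lambda>x. m n x - m' x" n] m by auto
        show "integrable M (\<lambda>x. C * \<bar>m n x - m' x\<bar>)" using int by simp
        show "norm (a n x * (m n x - m' x)) \<le> C * \<bar>m n x - m' x\<bar>" for x
          using ab[of n x] by (simp add: abs_mult mult_right_mono)
      qed
      then show "norm (LINT x|M. a n x * (m n x - m' x)) \<le> C * (LINT x|M. \<bar>m n x - m' x\<bar>)" by simp
    qed
  qed
  ultimately have "(\<lambda>n. (LINT x|M. a n x * m' x) + (LINT x|M. a n x * (m n x - m' x))) \<longlonglongrightarrow> (LINT x|M. a' x * m' x) + 0"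
    by (rule tendsto_add)
  moreover have "(LINT x|M. a n x * m' x) + (LINT x|M. a n x * (m n x - m' x)) = (LINT x|M. a n x * m n x)" for n
    using ami[OF m(2), of n] ami[OF m(1), of n n] by (simp add: right_diff_distrib)
  ultimately show ?thesis by simp
qed

section \<open>The chain rule\<close>

lemma has_derivative_vec_lambda:
  fixes f :: "'k::finite \<Rightarrow> real^'n::finite \<Rightarrow> real"
  assumes "\<And>k. (f k has_derivative f' k) (at x)"
  shows "((\<lambda>x. \<chi> k. f k x) has_derivative (\<lambda>h. \<chi> k. f' k h)) (at x)"
proof (rule has_derivative_componentwise_within[THEN iffD2], rule ballI)
  fix b :: "real^'k" assume "b \<in> Basis"
  then obtain k where b: "b = axis k 1" by (auto simp: Basis_vec_def)
  show "((\<lambda>x. (\<chi> k. f k x) \<bullet> b) has_derivative (\<lambda>x. (\<chi> k. f' k x) \<bullet> b)) (at x)"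
    using assms[of k] by (simp add: b inner_axis)
qed

text \<open>The form in which the Luzin condition enters the chain rule: exceptional null sets in
  the target of \<open>\<psi>\<close> pull back to null sets.\<close>

lemma AE_preimage:
  assumes N: "\<And>E. E \<in> null_sets lebesgue \<Longrightarrow> {y \<in> V. \<psi> y \<in> E} \<in> null_sets lebesgue"
    and Q: "AE x in lebesgue. Q x"
  shows "AE y in lebesgue. y \<in> V \<longrightarrow> Q (\<psi> y)"
proof -
  obtain E where E: "E \<in> null_sets lebesgue" "{x \<in> space lebesgue. \<not> Q x} \<subseteq> E"
    using Q unfolding eventually_ae_filter by blast
  show ?thesis by (rule AE_I'[OF N[OF E(1)]]) (use E(2) in auto)
qed

lemma set_integrable_measurable:
  "set_integrable lebesgue K f \<Longrightarrow> (\<lambda>x. indicator K x * f x) \<in> borel_measurable lebesgue" for f :: "'a::euclidean_space \<Rightarrow> real"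
  unfolding set_integrable_def by (drule borel_measurable_integrable) simp

text \<open>Mollify only the inner map: \<open>F\<close> composed with \<open>\<Psi> n\<close> is
  C1, and ordinary integration by parts applies. In the limit the factors
  \<open>P (\<Psi> n y)\<close> converge pointwise and boundedly, as every \<open>\<Psi> n\<close>
  maps \<open>K\<close> into one fixed ball, while the gradients \<open>W k n\<close> converge in L1
  on \<open>K\<close>.\<close>

lemma chain_rule_C1:
  fixes F :: "real^'m::finite \<Rightarrow> real" and \<psi> :: "real^'n::finite \<Rightarrow> real^'m"
  assumes F: "\<And>x. (F has_derivative (\<lambda>h. P x \<bullet> h)) (at x)" and P: "continuous_on UNIV P"
    and V: "open V" and \<psi>: "continuous_on V \<psi>" and w: "\<And>k. weak_grad V (\<lambda>y. \<psi> y $ k) (G k)"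
    and t: "test_fun V \<eta>"
  shows "(LINT y|lebesgue. F (\<psi> y) * grad \<eta> y $ i) = - (LINT y|lebesgue. (\<Sum>k\<in>UNIV. P (\<psi> y) $ k * G k y $ i) * \<eta> y)"
proof -
  obtain K where K: "compact K" "K \<subseteq> V" "\<And>z. z \<notin> K \<Longrightarrow> \<eta> z = 0" "\<And>z. z \<notin> K \<Longrightarrow> grad \<eta> z = 0"
    "continuous_on UNIV \<eta>" "continuous_on UNIV (grad \<eta>)"
    using test_fun_obtain[OF t] by metis
  have "\<exists>p. C1_approximates K (\<lambda>y. \<psi> y $ k) (G k) (fst p) (snd p)" for k
  proof -
    have c: "continuous_on V (\<lambda>y. \<psi> y $ k)" using \<psi> by (intro continuous_intros)
    obtain \<Phi> W where "C1_approximates K (\<lambda>y. \<psi> y $ k) (G k) \<Phi> W"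
      by (rule ex_C1_approximation[OF w c V K(1,2)])
    then show ?thesis by (intro exI[of _ "(\<Phi>, W)"]) simp
  qed
  then have "\<exists>p. \<forall>k. C1_approximates K (\<lambda>y. \<psi> y $ k) (G k) (fst (p k)) (snd (p k))"
    by (intro choice allI)
  then obtain p where p: "\<And>k. C1_approximates K (\<lambda>y. \<psi> y $ k) (G k) (fst (p k)) (snd (p k))" by blast
  define \<Phi> where "\<Phi> k = fst (p k)" for k
  define W where "W k = snd (p k)" for k
  note \<Phi> = C1_approximatesD[OF p, folded \<Phi>_def W_def]
  have "\<exists>B. \<forall>k. \<forall>n. \<forall>x\<in>K. \<bar>\<Phi> k n x\<bar> \<le> B k" by (intro choice allI \<Phi>(4))
  then obtain B where B: "\<And>k n x. x \<in> K \<Longrightarrow> \<bar>\<Phi> k n x\<bar> \<le> B k" by blast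
  define \<Psi> where "\<Psi> n y = (\<chi> k. \<Phi> k n y)" for n y
  have \<Psi>D: "(\<Psi> n has_derivative (\<lambda>h. \<chi> k. W k n y \<bullet> h)) (at y)" for n y
    unfolding \<Psi>_def by (rule has_derivative_vec_lambda[OF \<Phi>(1)])
  have \<Psi>c: "continuous_on UNIV (\<Psi> n)" for n
    using \<Psi>D by (meson continuous_at_imp_continuous_on has_derivative_continuous)
  have Fc: "continuous_on UNIV F" using F by (meson continuous_at_imp_continuous_on has_derivative_continuous)
  have F\<Psi>c: "continuous_on UNIV (\<lambda>y. F (\<Psi> n y))" for n
    by (rule continuous_on_compose2[OF Fc \<Psi>c]) simp
  have P\<Psi>c: "continuous_on UNIV (\<lambda>y. P (\<Psi> n y))" for n
    by (rule continuous_on_compose2[OF P \<Psi>c]) simp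
  have \<Psi>l: "(\<lambda>n. \<Psi> n y) \<longlonglongrightarrow> \<psi> y" if "y \<in> K" for y
    by (rule vec_tendstoI) (simp add: \<Psi>_def \<Phi>(3)[OF that])
  define R where "R = (\<Sum>k\<in>UNIV. B k)"
  have \<Psi>b: "\<Psi> n y \<in> cball 0 R" if "y \<in> K" for n y
  proof -
    have "norm (\<Psi> n y) \<le> (\<Sum>k\<in>UNIV. \<bar>\<Psi> n y $ k\<bar>)" by (rule norm_le_l1_cart)
    also have "\<dots> \<le> R" unfolding R_def \<Psi>_def by (intro sum_mono) (simp add: B[OF that])
    finally show ?thesis by simp
  qed
  obtain CF where CF: "CF > 0" "\<And>x. x \<in> cball 0 R \<Longrightarrow> \<bar>F x\<bar> \<le> CF"
  proof -
    have "bounded (F ` cball 0 R)"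
      by (intro compact_imp_bounded compact_continuous_image continuous_on_subset[OF Fc]) auto
    then show ?thesis using that unfolding bounded_pos by auto
  qed
  obtain CP where CP: "CP > 0" "\<And>x. x \<in> cball 0 R \<Longrightarrow> norm (P x) \<le> CP"
  proof -
    have "bounded (P ` cball 0 R)"
      by (intro compact_imp_bounded compact_continuous_image continuous_on_subset[OF P]) auto
    then show ?thesis using that unfolding bounded_pos by auto
  qed
  obtain C\<eta> where C\<eta>: "C\<eta> > 0" "\<And>y. norm (\<eta> y) \<le> C\<eta>"
    using compact_support_bounded[OF K(5,1,3)] by blast
  have ibp: "(LINT y|lebesgue. F (\<Psi> n y) * grad \<eta> y $ i)
      = - (\<Sum>k\<in>UNIV. LINT y|lebesgue. (P (\<Psi> n y) $ k * \<eta> y) * (indicator K y * W k n y $ i))" for n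
  proof -
    have "(LINT y|lebesgue. F (\<Psi> n y) * grad \<eta> y $ i) = - (LINT y|lebesgue. (\<Sum>k\<in>UNIV. P (\<Psi> n y) $ k *\<^sub>R W k n y) $ i * \<eta> y)"
    proof (rule integration_by_parts_test_fun[OF _ _ t])
      fix y
      have "((\<lambda>y. F (\<Psi> n y)) has_derivative (\<lambda>h. P (\<Psi> n y) \<bullet> (\<chi> k. W k n y \<bullet> h))) (at y)"
        by (rule has_derivative_compose[OF \<Psi>D F])
      show "((\<lambda>y. F (\<Psi> n y)) has_derivative (\<bullet>) (\<Sum>k\<in>UNIV. P (\<Psi> n y) $ k *\<^sub>R W k n y)) (at y)"
      proof -
        have "P (\<Psi> n y) \<bullet> (\<chi> k. W k n y \<bullet> h) = (\<Sum>k\<in>UNIV. P (\<Psi> n y) $ k *\<^sub>R W k n y) \<bullet> h" for h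
          unfolding inner_sum_left inner_scaleR_left by (subst inner_vec_def) simp
        then show ?thesis using \<open>((\<lambda>y. F (\<Psi> n y)) has_derivative (\<lambda>h. P (\<Psi> n y) \<bullet> (\<chi> k. W k n y \<bullet> h))) (at y)\<close>
          by (simp only:)
      qed
      show "continuous_on UNIV (\<lambda>y. \<Sum>k\<in>UNIV. P (\<Psi> n y) $ k *\<^sub>R W k n y)"
        by (intro continuous_intros P\<Psi>c \<Phi>(2))
    qed
    \<comment> \<open>The indicator of \<open>K\<close> can be inserted because
      \<open>\<eta>\<close> vanishes off \<open>K\<close>; it makes the gradient factors integrable
      on the whole space, as the product limit requires.\<close>
    also have "(LINT y|lebesgue. (\<Sum>k\<in>UNIV. P (\<Psi> n y) $ k *\<^sub>R W k n y) $ i * \<eta> y)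
      = (LINT y|lebesgue. (\<Sum>k\<in>UNIV. (P (\<Psi> n y) $ k * \<eta> y) * (indicator K y * W k n y $ i)))"
    proof (rule Bochner_Integration.integral_cong)
      fix y show "(\<Sum>k\<in>UNIV. P (\<Psi> n y) $ k *\<^sub>R W k n y) $ i * \<eta> y
        = (\<Sum>k\<in>UNIV. (P (\<Psi> n y) $ k * \<eta> y) * (indicator K y * W k n y $ i))"
        unfolding sum_component vector_scaleR_component sum_distrib_right
        by (rule sum.cong[OF refl]) (use K(3)[of y] in \<open>cases "y \<in> K"; simp\<close>)
    qed simp
    also have "\<dots> = (\<Sum>k\<in>UNIV. LINT y|lebesgue. (P (\<Psi> n y) $ k * \<eta> y) * (indicator K y * W k n y $ i))"
    proof (rule Bochner_Integration.integral_sum)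
      fix k
      have "integrable lebesgue (\<lambda>y. P (\<Psi> n y) $ k * \<eta> y * W k n y $ i)"
      proof (rule integrable_compact_support[OF _ K(1)])
        show "continuous_on UNIV (\<lambda>y. P (\<Psi> n y) $ k * \<eta> y * W k n y $ i)"
          by (intro continuous_intros P\<Psi>c \<Phi>(2) K(5))
      qed (simp add: K(3))
      moreover have "P (\<Psi> n y) $ k * \<eta> y * W k n y $ i = (P (\<Psi> n y) $ k * \<eta> y) * (indicator K y * W k n y $ i)" for y
        using K(3)[of y] by (cases "y \<in> K") simp_all
      ultimately show "integrable lebesgue (\<lambda>y. (P (\<Psi> n y) $ k * \<eta> y) * (indicator K y * W k n y $ i))" by simp
    qed
    finally show ?thesis .
  qed
  have lhs: "(\<lambda>n. LINT y|lebesgue. F (\<Psi> n y) * grad \<eta> y $ i) \<longlonglongrightarrow> (LINT y|lebesgue. F (\<psi> y) * grad \<eta> y $ i)"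
  proof (rule integral_dominated_convergence[where w="\<lambda>y. CF * \<bar>grad \<eta> y $ i\<bar>"])
    have lim: "(\<lambda>n. F (\<Psi> n y) * grad \<eta> y $ i) \<longlonglongrightarrow> F (\<psi> y) * grad \<eta> y $ i" for y
    proof (cases "y \<in> K")
      case True
      have "isCont F (\<psi> y)" using Fc by (simp add: continuous_on_eq_continuous_at)
      from isCont_tendsto_compose[OF this \<Psi>l[OF True]] show ?thesis by (rule tendsto_mult_right)
    qed (simp add: K(4))
    then show "AE y in lebesgue. (\<lambda>n. F (\<Psi> n y) * grad \<eta> y $ i) \<longlonglongrightarrow> F (\<psi> y) * grad \<eta> y $ i" by (rule AE_I2)
    show m: "(\<lambda>y. F (\<Psi> n y) * grad \<eta> y $ i) \<in> borel_measurable lebesgue" for n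
      by (intro continuous_imp_measurable_lebesgue continuous_intros F\<Psi>c K(6))
    show "(\<lambda>y. F (\<psi> y) * grad \<eta> y $ i) \<in> borel_measurable lebesgue"
      by (rule borel_measurable_LIMSEQ_real[OF lim m])
    have "continuous_on UNIV (\<lambda>y. grad \<eta> y $ i)" by (intro continuous_intros K(6))
    then have "integrable lebesgue (\<lambda>y. grad \<eta> y $ i)"
      by (rule integrable_compact_support[OF _ K(1)]) (simp add: K(4))
    then show "integrable lebesgue (\<lambda>y. CF * \<bar>grad \<eta> y $ i\<bar>)" by simp
    show "AE y in lebesgue. norm (F (\<Psi> n y) * grad \<eta> y $ i) \<le> CF * \<bar>grad \<eta> y $ i\<bar>" for n
    proof (rule AE_I2)
      fix y show "norm (F (\<Psi> n y) * grad \<eta> y $ i) \<le> CF * \<bar>grad \<eta> y $ i\<bar>"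
        using CF(2)[OF \<Psi>b, of y n] by (cases "y \<in> K") (simp_all add: abs_mult mult_right_mono K(4))
    qed
  qed
  define a where "a k n y = P (\<Psi> n y) $ k * \<eta> y" for k n y
  define a' where "a' k y = P (\<psi> y) $ k * \<eta> y" for k y
  have al: "(\<lambda>n. a k n y) \<longlonglongrightarrow> a' k y" for k y
  proof (cases "y \<in> K")
    case True
    have "isCont P (\<psi> y)" using P by (simp add: continuous_on_eq_continuous_at)
    from isCont_tendsto_compose[OF this \<Psi>l[OF True]] show ?thesis
      unfolding a_def a'_def by (intro tendsto_mult tendsto_const tendsto_vec_nth)
  qed (simp add: a_def a'_def K(3))
  have am: "a k n \<in> borel_measurable lebesgue" for k n
    unfolding a_def by (intro continuous_imp_measurable_lebesgue continuous_intros P\<Psi>c K(5))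
  have a'm: "a' k \<in> borel_measurable lebesgue" for k
    by (rule borel_measurable_LIMSEQ_real[OF al am])
  have ab: "\<bar>a k n y\<bar> \<le> CP * C\<eta>" for k n y
  proof (cases "y \<in> K")
    case True
    have "\<bar>P (\<Psi> n y) $ k\<bar> \<le> CP"
      using component_le_norm_cart[of "P (\<Psi> n y)" k] CP(2)[OF \<Psi>b[OF True, of n]] by linarith
    then show ?thesis unfolding a_def abs_mult using C\<eta>(2)[of y] CP by (intro mult_mono) auto
  qed (use CP C\<eta> in \<open>simp add: a_def K(3)\<close>)
  have a'b: "\<bar>a' k y\<bar> \<le> CP * C\<eta>" for k y
    by (rule tendsto_upperbound[OF tendsto_rabs[OF al]]) (use ab in auto)
  have mi: "integrable lebesgue (\<lambda>y. indicator K y * W k n y $ i)" for k n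
  proof -
    have "continuous_on K (\<lambda>y. W k n y $ i)" using continuous_on_subset[OF \<Phi>(2)] by (intro continuous_intros) auto
    from set_integrable_continuous_compact[OF K(1) this] show ?thesis by (simp add: set_integrable_def)
  qed
  have m'i: "integrable lebesgue (\<lambda>y. indicator K y * G k y $ i)" for k
    using w[of k] K(1,2) by (auto simp: weak_grad_def loc_integrable_def set_integrable_def)
  have "(\<lambda>n. LINT y|lebesgue. a k n y * (indicator K y * W k n y $ i)) \<longlonglongrightarrow> (LINT y|lebesgue. a' k y * (indicator K y * G k y $ i))" for k
  proof (rule tendsto_integral_mult_L1[OF am a'm AE_I2[OF al] ab mi m'i])
    have eq: "ennreal \<bar>indicator K y * W k n y $ i - indicator K y * G k y $ i\<bar> = ennreal \<bar>W k n y $ i - G k y $ i\<bar> * indicator K y" for n y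
      by (cases "y \<in> K") simp_all
    show "(\<lambda>n. \<integral>\<^sup>+ y. ennreal \<bar>indicator K y * W k n y $ i - indicator K y * G k y $ i\<bar> \<partial>lebesgue) \<longlonglongrightarrow> 0"
      unfolding eq by (rule \<Phi>(5))
  qed
  then have "(\<lambda>n. - (\<Sum>k\<in>UNIV. LINT y|lebesgue. a k n y * (indicator K y * W k n y $ i)))
      \<longlonglongrightarrow> - (\<Sum>k\<in>UNIV. LINT y|lebesgue. a' k y * (indicator K y * G k y $ i))"
    by (intro tendsto_minus tendsto_sum)
  then have "(LINT y|lebesgue. F (\<psi> y) * grad \<eta> y $ i) = - (\<Sum>k\<in>UNIV. LINT y|lebesgue. a' k y * (indicator K y * G k y $ i))"
    using lhs unfolding ibp a_def[symmetric] by (rule LIMSEQ_unique[rotated])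
  also have "(\<Sum>k\<in>UNIV. LINT y|lebesgue. a' k y * (indicator K y * G k y $ i)) = (LINT y|lebesgue. (\<Sum>k\<in>UNIV. a' k y * (indicator K y * G k y $ i)))"
    by (rule Bochner_Integration.integral_sum[symmetric]) (rule integrable_mult_bounded[OF a'm a'b m'i])
  also have "\<dots> = (LINT y|lebesgue. (\<Sum>k\<in>UNIV. P (\<psi> y) $ k * G k y $ i) * \<eta> y)"
  proof (rule Bochner_Integration.integral_cong)
    fix y show "(\<Sum>k\<in>UNIV. a' k y * (indicator K y * G k y $ i)) = (\<Sum>k\<in>UNIV. P (\<psi> y) $ k * G k y $ i) * \<eta> y"
      unfolding sum_distrib_right a'_def
      by (rule sum.cong[OF refl]) (use K(3)[of y] in \<open>cases "y \<in> K"; simp\<close>)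
  qed simp
  finally show ?thesis .
qed

text \<open>Now the outer function is mollified: its C1 approximants already obey the chain rule,
  and their gradients converge almost everywhere on the image of \<open>K\<close>. Condition
  \<open>N\<close> turns this into convergence for almost every \<open>y\<close>, and the bound
  \<open>M\<close> gives the majorant \<open>M * |G k|\<close> although \<open>G k\<close> is merely
  locally integrable.\<close>

theorem weak_grad_chain_rule:
  fixes f :: "real^'m::finite \<Rightarrow> real" and \<psi> :: "real^'n::finite \<Rightarrow> real^'m"
  assumes V: "open V" and U: "open U" and \<psi>: "continuous_on V \<psi>" "\<psi> ` V \<subseteq> U"
    and w: "\<And>k. weak_grad V (\<lambda>y. \<psi> y $ k) (G k)"
    and f: "continuous_on U f" "weak_grad U f g"
    and M: "M \<ge> 0" "AE x in lebesgue. x \<in> U \<longrightarrow> norm (g x) \<le> M"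
    and N: "\<And>E. E \<in> null_sets lebesgue \<Longrightarrow> {y \<in> V. \<psi> y \<in> E} \<in> null_sets lebesgue"
  shows "weak_grad V (\<lambda>y. f (\<psi> y)) (\<lambda>y. \<Sum>k\<in>UNIV. g (\<psi> y) $ k *\<^sub>R G k y)"
proof -
  have approx: "\<exists>F P. C1_approximates (\<psi> ` K) f g F P \<and> (\<forall>n. \<forall>y\<in>K. \<forall>k. \<bar>P n (\<psi> y) $ k\<bar> \<le> M)"
    if K: "compact K" "K \<subseteq> V" for K
  proof -
    have L: "compact (\<psi> ` K)" "\<psi> ` K \<subseteq> U"
      using K \<psi> by (auto intro: compact_continuous_image continuous_on_subset)
    obtain F P where A: "C1_approximates (\<psi> ` K) f g F P"
      and b: "\<forall>M\<ge>0. (AE x in lebesgue. x \<in> U \<longrightarrow> norm (g x) \<le> M) \<longrightarrow> (\<forall>n. \<forall>x\<in>\<psi> ` K. norm (P n x) \<le> M)"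
      by (rule ex_C1_approximation[OF f(2,1) U L])
    have "\<bar>P n (\<psi> y) $ k\<bar> \<le> M" if "y \<in> K" for n y k
      using b[rule_format, OF M, of "\<psi> y" n] that component_le_norm_cart[of "P n (\<psi> y)" k] by force
    then show ?thesis using A by blast
  qed
  have conv: "AE y in lebesgue. y \<in> K \<longrightarrow> (\<forall>k. (\<lambda>n. P n (\<psi> y) $ k) \<longlonglongrightarrow> g (\<psi> y) $ k)"
    if "K \<subseteq> V" "C1_approximates (\<psi> ` K) f g F P" for K F P
  proof -
    have "AE y in lebesgue. y \<in> V \<longrightarrow> (\<psi> y \<in> \<psi> ` K \<longrightarrow> (\<forall>k. (\<lambda>n. P n (\<psi> y) $ k) \<longlonglongrightarrow> g (\<psi> y) $ k))"
      by (rule AE_preimage[where Q="\<lambda>x. x \<in> \<psi> ` K \<longrightarrow> (\<forall>k. (\<lambda>n. P n x $ k) \<longlonglongrightarrow> g x $ k)"])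
        (rule N, assumption, rule C1_approximatesD(6)[OF that(2)])
    then show ?thesis
  proof eventually_elim
    case (elim y)
    then show ?case using that(1) by blast
  qed
  qed
  have f\<psi>: "continuous_on V (\<lambda>y. f (\<psi> y))" using continuous_on_compose2[OF f(1) \<psi>] .
  have Pm: "(\<lambda>y. indicator K y * P (\<psi> y) $ k) \<in> borel_measurable lebesgue"
    if "compact K" "K \<subseteq> V" "continuous_on UNIV P" for K k and P :: "real^'m \<Rightarrow> real^'m"
  proof (rule set_integrable_measurable[OF set_integrable_continuous_compact[OF that(1)]])
    show "continuous_on K (\<lambda>y. P (\<psi> y) $ k)"
      by (intro continuous_intros continuous_on_compose2[OF that(3) continuous_on_subset[OF \<psi>(1) that(2)]]) simp
  qed
  have gm: "(\<lambda>y. indicator K y * g (\<psi> y) $ k) \<in> borel_measurable lebesgue" 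
    and gb: "AE y in lebesgue. y \<in> K \<longrightarrow> \<bar>g (\<psi> y) $ k\<bar> \<le> M"
    if K: "compact K" "K \<subseteq> V" for K k
  proof -
    obtain F P where FP: "C1_approximates (\<psi> ` K) f g F P"
      and Pb: "\<And>n y k. y \<in> K \<Longrightarrow> \<bar>P n (\<psi> y) $ k\<bar> \<le> M" using approx[OF K] by blast
    note A = C1_approximatesD(2)[OF FP] conv[OF K(2) FP] Pb
    \<comment> \<open>A Lebesgue measurable \<open>g\<close> composed with a continuous map need not
      be measurable. Measurability is inherited from the continuous \<open>P n\<close> composed with
      \<open>\<psi>\<close>, through a \<open>lim\<close> that has a value everywhere and agrees
      with the desired function almost everywhere.\<close>
    define h where "h y = lim (\<lambda>n. indicator K y * P n (\<psi> y) $ k)" for y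
    have "h \<in> borel_measurable lebesgue"
      unfolding h_def by (intro borel_measurable_lim_metric Pm[OF K A(1)])
    then show "(\<lambda>y. indicator K y * g (\<psi> y) $ k) \<in> borel_measurable lebesgue"
    proof (rule borel_measurable_AE)
      show "AE y in lebesgue. h y = indicator K y * g (\<psi> y) $ k"
        using A(2)
      proof eventually_elim
        case (elim y)
        have "(\<lambda>n. indicator K y * P n (\<psi> y) $ k) \<longlonglongrightarrow> indicator K y * g (\<psi> y) $ k"
          using elim by (cases "y \<in> K") simp_all
        then show ?case unfolding h_def by (rule limI)
      qed
    qed
    show "AE y in lebesgue. y \<in> K \<longrightarrow> \<bar>g (\<psi> y) $ k\<bar> \<le> M"
      using A(2)
    proof eventually_elim
      case (elim y)
      show ?case
      proof
        assume y: "y \<in> K"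
        then have "(\<lambda>n. \<bar>P n (\<psi> y) $ k\<bar>) \<longlonglongrightarrow> \<bar>g (\<psi> y) $ k\<bar>" using elim by (intro tendsto_rabs) auto
        then show "\<bar>g (\<psi> y) $ k\<bar> \<le> M" by (rule tendsto_upperbound) (use A(3)[OF y] in auto)
      qed
    qed
  qed
  have gGi: "integrable lebesgue (\<lambda>y. indicator K y * (g (\<psi> y) $ k * G k y $ i))" 
    if K: "compact K" "K \<subseteq> V" for K k i
  proof (rule Bochner_Integration.integrable_bound)
    have Gi: "integrable lebesgue (\<lambda>y. indicator K y * G k y $ i)"
      using w[of k] K by (auto simp: weak_grad_def loc_integrable_def set_integrable_def)
    then show "integrable lebesgue (\<lambda>y. M * (indicator K y * G k y $ i))" by (rule integrable_mult_right)
    have "(\<lambda>y. (indicator K y * g (\<psi> y) $ k) * (indicator K y * G k y $ i)) \<in> borel_measurable lebesgue"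
      by (rule borel_measurable_times[OF gm[OF K] borel_measurable_integrable[OF Gi]])
    moreover have "(indicator K y * g (\<psi> y) $ k) * (indicator K y * G k y $ i) = indicator K y * (g (\<psi> y) $ k * G k y $ i)" for y
      by (cases "y \<in> K") simp_all
    ultimately show "(\<lambda>y. indicator K y * (g (\<psi> y) $ k * G k y $ i)) \<in> borel_measurable lebesgue" by simp
    show "AE y in lebesgue. norm (indicator K y * (g (\<psi> y) $ k * G k y $ i)) \<le> norm (M * (indicator K y * G k y $ i))"
      using gb[OF K, of k]
    proof eventually_elim
      case (elim y)
      then show ?case using M(1) by (cases "y \<in> K") (simp_all add: abs_mult mult_right_mono)
    qed
  qed
  show ?thesis
  proof (rule weak_gradI)
    show "loc_integrable V (\<lambda>y. f (\<psi> y))" by (rule loc_integrable_continuous[OF f\<psi>])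
    show "loc_integrable V (\<lambda>y. (\<Sum>k\<in>UNIV. g (\<psi> y) $ k *\<^sub>R G k y) $ i)" for i
      unfolding loc_integrable_def set_integrable_def
    proof (intro allI impI, elim conjE)
      fix K assume K: "compact K" "K \<subseteq> V"
      have "integrable lebesgue (\<lambda>y. \<Sum>k\<in>UNIV. indicator K y * (g (\<psi> y) $ k * G k y $ i))"
        by (rule Bochner_Integration.integrable_sum) (rule gGi[OF K])
      then show "integrable lebesgue (\<lambda>y. indicator K y *\<^sub>R (\<Sum>k\<in>UNIV. g (\<psi> y) $ k *\<^sub>R G k y) $ i)"
        by (simp add: sum_distrib_left)
    qed
    fix \<eta> i assume t: "test_fun V \<eta>"
    obtain K where K: "compact K" "K \<subseteq> V" "\<And>z. z \<notin> K \<Longrightarrow> \<eta> z = 0" "\<And>z. z \<notin> K \<Longrightarrow> grad \<eta> z = 0"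
      "continuous_on UNIV \<eta>" "continuous_on UNIV (grad \<eta>)"
      using test_fun_obtain[OF t] by metis
    obtain C\<eta> where C\<eta>: "C\<eta> > 0" "\<And>y. norm (\<eta> y) \<le> C\<eta>"
      using compact_support_bounded[OF K(5,1,3)] by blast
    obtain F P where FP: "C1_approximates (\<psi> ` K) f g F P"
      and Pb: "\<And>n y k. y \<in> K \<Longrightarrow> \<bar>P n (\<psi> y) $ k\<bar> \<le> M" using approx[OF K(1,2)] by blast
    obtain B where B: "\<And>n y. y \<in> K \<Longrightarrow> \<bar>F n (\<psi> y)\<bar> \<le> B" using C1_approximatesD(4)[OF FP] by auto
    note A = C1_approximatesD(1,2)[OF FP] C1_approximatesD(3)[OF FP imageI] B conv[OF K(2) FP] Pb
    have C1: "(LINT y|lebesgue. F n (\<psi> y) * grad \<eta> y $ i) = - (LINT y|lebesgue. (\<Sum>k\<in>UNIV. P n (\<psi> y) $ k * G k y $ i) * \<eta> y)" for n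
      by (rule chain_rule_C1[OF A(1,2) V \<psi>(1) w t])
    have gi: "integrable lebesgue (\<lambda>y. grad \<eta> y $ i)"
    proof -
      have "continuous_on UNIV (\<lambda>y. grad \<eta> y $ i)" by (intro continuous_intros K(6))
      then show ?thesis by (rule integrable_compact_support[OF _ K(1)]) (simp add: K(4))
    qed
    have lhs: "(\<lambda>n. LINT y|lebesgue. F n (\<psi> y) * grad \<eta> y $ i) \<longlonglongrightarrow> (LINT y|lebesgue. f (\<psi> y) * grad \<eta> y $ i)"
    proof (rule integral_dominated_convergence[where w="\<lambda>y. B * \<bar>grad \<eta> y $ i\<bar>"])
      have lim: "(\<lambda>n. F n (\<psi> y) * grad \<eta> y $ i) \<longlonglongrightarrow> f (\<psi> y) * grad \<eta> y $ i" for y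
        using tendsto_mult_right[OF A(3)[of y]] by (cases "y \<in> K") (simp_all add: K(4))
      then show "AE y in lebesgue. (\<lambda>n. F n (\<psi> y) * grad \<eta> y $ i) \<longlonglongrightarrow> f (\<psi> y) * grad \<eta> y $ i" by (rule AE_I2)
      have mm: "(\<lambda>y. h (\<psi> y) * grad \<eta> y $ i) \<in> borel_measurable lebesgue" if "continuous_on K (\<lambda>y. h (\<psi> y))" for h :: "_ \<Rightarrow> real"
      proof -
        have "(\<lambda>y. (indicator K y * h (\<psi> y)) * grad \<eta> y $ i) \<in> borel_measurable lebesgue"
          using set_integrable_measurable[OF set_integrable_continuous_compact[OF K(1) that]] gi by auto
        moreover have "(indicator K y * h (\<psi> y)) * grad \<eta> y $ i = h (\<psi> y) * grad \<eta> y $ i" for y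
          by (cases "y \<in> K") (simp_all add: K(4))
        ultimately show ?thesis by simp
      qed
      show "(\<lambda>y. f (\<psi> y) * grad \<eta> y $ i) \<in> borel_measurable lebesgue"
        by (rule mm[OF continuous_on_subset[OF f\<psi> K(2)]])
      show "(\<lambda>y. F n (\<psi> y) * grad \<eta> y $ i) \<in> borel_measurable lebesgue" for n
      proof (rule mm)
        have "continuous_on UNIV (F n)" using A(1) by (meson continuous_at_imp_continuous_on has_derivative_continuous)
        then show "continuous_on K (\<lambda>y. F n (\<psi> y))"
          by (rule continuous_on_compose2[OF _ continuous_on_subset[OF \<psi>(1) K(2)]]) simp
      qed
      show "integrable lebesgue (\<lambda>y. B * \<bar>grad \<eta> y $ i\<bar>)" using gi by simp
      show "AE y in lebesgue. norm (F n (\<psi> y) * grad \<eta> y $ i) \<le> B * \<bar>grad \<eta> y $ i\<bar>" for n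
      proof (rule AE_I2)
        fix y
        show "norm (F n (\<psi> y) * grad \<eta> y $ i) \<le> B * \<bar>grad \<eta> y $ i\<bar>"
        proof (cases "y \<in> K")
          case True
          show ?thesis using A(4)[OF True, of n] by (simp add: abs_mult mult_right_mono)
        qed (simp add: K(4))
      qed
    qed
    have Gi: "integrable lebesgue (\<lambda>y. indicator K y * G k y $ i)" for k
      using w[of k] K by (auto simp: weak_grad_def loc_integrable_def set_integrable_def)
    have e\<eta>: "(\<Sum>k\<in>UNIV. p y $ k * G k y $ i) * \<eta> y = (\<Sum>k\<in>UNIV. (indicator K y * p y $ k) * (indicator K y * G k y $ i) * \<eta> y)" for p y
      unfolding sum_distrib_right
      by (rule sum.cong[OF refl]) (use K(3)[of y] in \<open>cases "y \<in> K"; simp\<close>)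
    have \<eta>m: "\<eta> \<in> borel_measurable lebesgue" by (rule continuous_imp_measurable_lebesgue[OF K(5)])
    have mrhs: "(\<lambda>y. (\<Sum>k\<in>UNIV. p y $ k * G k y $ i) * \<eta> y) \<in> borel_measurable lebesgue"
      if p: "\<And>k. (\<lambda>y. indicator K y * p y $ k) \<in> borel_measurable lebesgue" for p
    proof -
      have "(\<lambda>y. \<Sum>k\<in>UNIV. (indicator K y * p y $ k) * (indicator K y * G k y $ i) * \<eta> y) \<in> borel_measurable lebesgue"
        by (rule borel_measurable_sum, rule borel_measurable_times[OF borel_measurable_times[OF p borel_measurable_integrable[OF Gi]] \<eta>m])
      then show ?thesis by (simp only: e\<eta>[where p=p])
    qed
    have rhs: "(\<lambda>n. LINT y|lebesgue. (\<Sum>k\<in>UNIV. P n (\<psi> y) $ k * G k y $ i) * \<eta> y)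
       \<longlonglongrightarrow> (LINT y|lebesgue. (\<Sum>k\<in>UNIV. g (\<psi> y) $ k * G k y $ i) * \<eta> y)"
    proof (rule integral_dominated_convergence[where w="\<lambda>y. (\<Sum>k\<in>UNIV. M * \<bar>indicator K y * G k y $ i\<bar>) * C\<eta>"])
      show "(\<lambda>y. (\<Sum>k\<in>UNIV. g (\<psi> y) $ k * G k y $ i) * \<eta> y) \<in> borel_measurable lebesgue"
      proof (rule mrhs)
        fix k
        show "(\<lambda>y. indicator K y * g (\<psi> y) $ k) \<in> borel_measurable lebesgue"
          using gm[of K k] K(1,2) by blast
      qed
      show "(\<lambda>y. (\<Sum>k\<in>UNIV. P n (\<psi> y) $ k * G k y $ i) * \<eta> y) \<in> borel_measurable lebesgue" for n
      proof (rule mrhs)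
        fix k
        show "(\<lambda>y. indicator K y * P n (\<psi> y) $ k) \<in> borel_measurable lebesgue"
          using Pm[of K "P n" k] K(1,2) A(2)[of n] by blast
      qed
      show "integrable lebesgue (\<lambda>y. (\<Sum>k\<in>UNIV. M * \<bar>indicator K y * G k y $ i\<bar>) * C\<eta>)"
        by (intro integrable_mult_left Bochner_Integration.integrable_sum integrable_mult_right integrable_abs Gi)
      show "AE y in lebesgue. (\<lambda>n. (\<Sum>k\<in>UNIV. P n (\<psi> y) $ k * G k y $ i) * \<eta> y) \<longlonglongrightarrow> (\<Sum>k\<in>UNIV. g (\<psi> y) $ k * G k y $ i) * \<eta> y"
        using A(5)
      proof eventually_elim
        case (elim y)
        show ?case
        proof (cases "y \<in> K")
          case True
          then have "(\<lambda>n. P n (\<psi> y) $ k) \<longlonglongrightarrow> g (\<psi> y) $ k" for k using elim by blast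
          then show ?thesis by (intro tendsto_mult tendsto_sum tendsto_const)
        qed (simp add: K(3))
      qed
      show "AE y in lebesgue. norm ((\<Sum>k\<in>UNIV. P n (\<psi> y) $ k * G k y $ i) * \<eta> y) \<le> (\<Sum>k\<in>UNIV. M * \<bar>indicator K y * G k y $ i\<bar>) * C\<eta>" for n
      proof (rule AE_I2)
        fix y
        show "norm ((\<Sum>k\<in>UNIV. P n (\<psi> y) $ k * G k y $ i) * \<eta> y) \<le> (\<Sum>k\<in>UNIV. M * \<bar>indicator K y * G k y $ i\<bar>) * C\<eta>"
        proof (cases "y \<in> K")
          case True
          have "\<bar>\<Sum>k\<in>UNIV. P n (\<psi> y) $ k * G k y $ i\<bar> \<le> (\<Sum>k\<in>UNIV. \<bar>P n (\<psi> y) $ k * G k y $ i\<bar>)" by (rule sum_abs)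
          also have "\<dots> \<le> (\<Sum>k\<in>UNIV. M * \<bar>indicator K y * G k y $ i\<bar>)"
            using True A(6)[OF True] by (intro sum_mono) (simp add: abs_mult mult_right_mono)
          finally show ?thesis using C\<eta>(2)[of y] C\<eta>(1) M(1) by (simp add: abs_mult) (intro mult_mono, auto intro: sum_nonneg)
        qed (simp add: K(3))
      qed
    qed
    have "(LINT y|lebesgue. f (\<psi> y) * grad \<eta> y $ i) = - (LINT y|lebesgue. (\<Sum>k\<in>UNIV. g (\<psi> y) $ k * G k y $ i) * \<eta> y)"
      by (rule LIMSEQ_unique[OF lhs]) (unfold C1, rule tendsto_minus[OF rhs])
    then show "(LINT y|lebesgue. f (\<psi> y) * grad \<eta> y $ i) = - (LINT y|lebesgue. (\<Sum>k\<in>UNIV. g (\<psi> y) $ k *\<^sub>R G k y) $ i * \<eta> y)"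
      by simp
  qed
qed

section \<open>Change of variables over a finite index type\<close>

text \<open>Relabels coordinates along a map of index types. The direction reverses: vectors indexed
  by the target of \<open>\<sigma>\<close> become vectors indexed by its source.\<close>

definition reindex :: "('a \<Rightarrow> 'b) \<Rightarrow> real^'b::finite \<Rightarrow> real^'a::finite" where
  "reindex \<sigma> x = (\<chi> i. x $ \<sigma> i)"

lemma reindex_nth [simp]: "reindex \<sigma> x $ i = x $ \<sigma> i"
  by (simp add: reindex_def)

lemma bounded_linear_reindex: "bounded_linear (reindex \<sigma>)"
  by (simp add: linear_conv_bounded_linear[symmetric]) (auto simp: linear_iff vec_eq_iff)

lemma reindex_inverse:
  assumes "\<And>i. \<sigma> (\<tau> i) = i"
  shows "reindex \<tau> (reindex \<sigma> x) = x"
  by (simp add: vec_eq_iff assms)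

lemma prod_Basis_cart: "(\<Prod>b\<in>Basis. v \<bullet> b) = (\<Prod>i\<in>UNIV. (v::real^'n::finite) $ i)"
proof -
  have B: "(Basis :: (real^'n) set) = (\<lambda>i. axis i 1) ` UNIV" by (auto simp: Basis_vec_def)
  have "inj (\<lambda>i::'n. axis i (1::real))" by (auto simp: inj_def axis_eq_axis)
  from prod.reindex[OF this, of "\<lambda>b. v \<bullet> b"] show ?thesis unfolding B by (simp add: inner_axis comp_def)
qed

text \<open>Lebesgue measure is determined by its values on boxes, and the preimage of a box is a
  box with the same side lengths in another order.\<close>

lemma lborel_distr_reindex:
  fixes \<sigma> :: "'a::finite \<Rightarrow> 'b::finite"
  assumes b: "bij \<sigma>"
  shows "distr lborel borel (reindex \<sigma>) = lborel"
proof (rule lborel_eqI[symmetric])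
  have m: "reindex \<sigma> \<in> borel_measurable borel"
    by (intro borel_measurable_continuous_onI linear_continuous_on bounded_linear_reindex)
  fix l u :: "real^'a" assume lu: "\<And>b. b \<in> Basis \<Longrightarrow> l \<bullet> b \<le> u \<bullet> b"
  let ?i = "reindex (inv \<sigma>)"
  have lu': "l $ i \<le> u $ i" for i using lu[of "axis i 1"] by (simp add: inner_axis axis_in_Basis_iff)
  have pre: "reindex \<sigma> -` box l u = box (?i l) (?i u)"
  proof (rule set_eqI)
    fix x
    have "(\<forall>i. l $ i < x $ \<sigma> i \<and> x $ \<sigma> i < u $ i) \<longleftrightarrow> (\<forall>j. l $ inv \<sigma> j < x $ j \<and> x $ j < u $ inv \<sigma> j)"
      using b by (metis bij_inv_eq_iff)
    then show "x \<in> reindex \<sigma> -` box l u \<longleftrightarrow> x \<in> box (?i l) (?i u)" by (simp add: mem_box_cart)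
  qed
  have "emeasure (distr lborel borel (reindex \<sigma>)) (box l u) = emeasure lborel (box (?i l) (?i u))"
    using m by (simp add: emeasure_distr pre)
  also have "\<dots> = (\<Prod>b\<in>Basis. (?i u - ?i l) \<bullet> b)"
    by (rule emeasure_lborel_box) (use lu' in \<open>auto simp: Basis_vec_def inner_axis\<close>)
  also have "(\<Prod>b\<in>Basis. (?i u - ?i l) \<bullet> b) = (\<Prod>j\<in>UNIV. (u - l) $ inv \<sigma> j)"
    unfolding prod_Basis_cart by simp
  also have "\<dots> = (\<Prod>b\<in>Basis. (u - l) \<bullet> b)"
    unfolding prod_Basis_cart using bij_imp_bij_inv[OF b] by (rule prod.reindex_bij_betw)
  finally show "emeasure (distr lborel borel (reindex \<sigma>)) (box l u) = (\<Prod>b\<in>Basis. (u - l) \<bullet> b)" .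
qed simp

lemma
  fixes \<sigma> :: "'a::finite \<Rightarrow> 'b::finite"
  assumes b: "bij \<sigma>"
  shows measurable_reindex: "reindex \<sigma> \<in> lebesgue \<rightarrow>\<^sub>M lebesgue"
    and lebesgue_distr_reindex: "distr lebesgue lebesgue (reindex \<sigma>) = lebesgue"
proof -
  have m: "reindex \<sigma> \<in> borel_measurable borel"
    by (intro borel_measurable_continuous_onI linear_continuous_on bounded_linear_reindex)
  have d: "distr lebesgue lborel (reindex \<sigma>) = lborel"
  proof -
    have "distr lebesgue lborel (reindex \<sigma>) = distr lborel lborel (reindex \<sigma>)"
      using m by (intro distr_completion) simp
    also have "\<dots> = distr lborel borel (reindex \<sigma>)" by (rule distr_cong) simp_all
    finally show ?thesis using lborel_distr_reindex[OF b] by simp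
  qed
  have mL: "reindex \<sigma> \<in> lebesgue \<rightarrow>\<^sub>M lborel" using m by (simp add: measurable_completion)
  show "reindex \<sigma> \<in> lebesgue \<rightarrow>\<^sub>M lebesgue"
    by (rule completion.measurable_completion2[OF mL]) (simp add: d)
  have "completion (distr lebesgue lborel (reindex \<sigma>)) = distr lebesgue lebesgue (reindex \<sigma>)"
    by (rule completion.completion_distr_eq[OF mL]) (simp add: d)
  then show "distr lebesgue lebesgue (reindex \<sigma>) = lebesgue" by (simp add: d)
qed

lemma set_integrable_reindex:
  fixes \<sigma> :: "'a::finite \<Rightarrow> 'b::finite" and f :: "real^'a \<Rightarrow> real"
  assumes b: "bij \<sigma>" and f: "set_integrable lebesgue S f"
  shows "set_integrable lebesgue (reindex \<sigma> -` S) (\<lambda>x. f (reindex \<sigma> x))"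
proof -
  let ?F = "\<lambda>x. indicator S x *\<^sub>R f x"
  have F: "integrable lebesgue ?F" using f by (simp add: set_integrable_def)
  then have "integrable (distr lebesgue lebesgue (reindex \<sigma>)) ?F" by (simp add: lebesgue_distr_reindex[OF b])
  then have "integrable lebesgue (\<lambda>x. ?F (reindex \<sigma> x))"
    by (rule integrable_distr[OF measurable_reindex[OF b]])
  moreover have "indicator S (reindex \<sigma> x) = (indicator (reindex \<sigma> -` S) x :: real)" for x
    by (simp add: indicator_def)
  ultimately show ?thesis by (simp add: set_integrable_def)
qed

text \<open>Conjugation by \<open>\<sigma>\<close> is a sign-preserving bijection between the
  permutations of the two index types, so the Leibniz sums match term by term.\<close>

lemma det_reindex:
  fixes A :: "real^'b::finite^'b" and \<sigma> :: "'a::finite \<Rightarrow> 'b"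
  assumes b: "bij \<sigma>"
  shows "det (\<chi> i j. A $ \<sigma> i $ \<sigma> j) = det A"
proof -
  let ?m = "map_permutation UNIV \<sigma>"
  have \<sigma>: "inj \<sigma>" "\<sigma> ` UNIV = UNIV" using b by (auto simp: bij_def)
  have m: "?m p (\<sigma> i) = \<sigma> (p i)" for p i
    using \<sigma> by (simp add: map_permutation_def restrict_id_def)
  have bij: "bij_betw ?m {p. p permutes UNIV} {q. q permutes UNIV}"
  proof (rule bij_betwI[where g="\<lambda>q. inv \<sigma> \<circ> q \<circ> \<sigma>"])
    show "?m \<in> {p. p permutes UNIV} \<rightarrow> {q. q permutes UNIV}"
      using map_permutation_permutes[where f=\<sigma> and A=UNIV and B=UNIV] b by auto
    show "(\<lambda>q. inv \<sigma> \<circ> q \<circ> \<sigma>) \<in> {q. q permutes UNIV} \<rightarrow> {p. p permutes UNIV}"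
    proof (intro Pi_I CollectI bij_imp_permutes)
      fix q :: "'b \<Rightarrow> 'b" assume "q \<in> {q. q permutes UNIV}"
      then have "bij q" by (simp add: permutes_bij)
      then show "bij (inv \<sigma> \<circ> q \<circ> \<sigma>)" using b by (intro bij_comp bij_imp_bij_inv)
    qed simp
    show "inv \<sigma> \<circ> ?m p \<circ> \<sigma> = p" for p using b by (auto simp: m bij_def)
    show "?m (inv \<sigma> \<circ> q \<circ> \<sigma>) = q" for q
    proof
      fix j
      obtain i where "j = \<sigma> i" using \<sigma>(2) by auto
      then show "?m (inv \<sigma> \<circ> q \<circ> \<sigma>) j = q j" using b by (simp add: m bij_is_surj surj_f_inv_f)
    qed
  qed
  have "det A = (\<Sum>p | p permutes UNIV. of_int (sign (?m p)) * (\<Prod>i\<in>UNIV. A $ i $ ?m p i))"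
    unfolding det_def by (rule sum.reindex_bij_betw[OF bij, symmetric])
  also have "\<dots> = (\<Sum>p | p permutes UNIV. of_int (sign p) * (\<Prod>i\<in>UNIV. A $ \<sigma> i $ \<sigma> (p i)))"
  proof (rule sum.cong[OF refl])
    fix p :: "'a \<Rightarrow> 'a" assume "p \<in> {p. p permutes UNIV}"
    then have "sign (?m p) = sign p" using \<sigma>(1) by (intro sign_map_permutation) auto
    moreover have "(\<Prod>i\<in>UNIV. A $ i $ ?m p i) = (\<Prod>i\<in>UNIV. A $ \<sigma> i $ ?m p (\<sigma> i))"
      by (rule prod.reindex_bij_betw[OF b, symmetric])
    ultimately show "of_int (sign (?m p)) * (\<Prod>i\<in>UNIV. A $ i $ ?m p i) = of_int (sign p) * (\<Prod>i\<in>UNIV. A $ \<sigma> i $ \<sigma> (p i))"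
      by (simp add: m)
  qed
  finally show ?thesis by (simp add: det_def)
qed

text \<open>The change of variables theorem of HOL-Analysis requires a well-ordered index type; every finite
  type is in bijection with one.\<close>

typedef 'a indexed = "UNIV :: 'a set" ..

instance indexed :: (finite) finite
proof
  have "(UNIV :: 'a indexed set) = range Abs_indexed" by (metis Abs_indexed_cases surjI surj_def)
  then show "finite (UNIV :: 'a indexed set)" by (metis finite finite_imageI)
qed

instantiation indexed :: (finite) wellorder
begin

text \<open>Any injection into the naturals will do; one exists by finiteness, and the order is
  pulled back along it.\<close>

definition index_of :: "'a indexed \<Rightarrow> nat" where "index_of = (SOME f. inj f)"

definition less_eq_indexed :: "'a indexed \<Rightarrow> 'a indexed \<Rightarrow> bool" where "x \<le> y \<longleftrightarrow> index_of x \<le> index_of y"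

definition less_indexed :: "'a indexed \<Rightarrow> 'a indexed \<Rightarrow> bool" where "x < y \<longleftrightarrow> index_of x < index_of y"

instance
proof
  have "\<exists>f :: 'a indexed \<Rightarrow> nat. inj f" using finite_imp_inj_to_nat_seg[of "UNIV :: 'a indexed set"] by auto
  then have inj: "inj (index_of :: 'a indexed \<Rightarrow> nat)" unfolding index_of_def by (rule someI_ex)
  fix x y z :: "'a indexed" and P :: "'a indexed \<Rightarrow> bool"
  show "x < y \<longleftrightarrow> x \<le> y \<and> \<not> y \<le> x" "x \<le> x" "x \<le> y \<Longrightarrow> y \<le> z \<Longrightarrow> x \<le> z" "x \<le> y \<or> y \<le> x"
    by (auto simp: less_eq_indexed_def less_indexed_def)
  show "x \<le> y \<Longrightarrow> y \<le> x \<Longrightarrow> x = y" using inj by (auto simp: less_eq_indexed_def inj_def)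
  show "P x" if "\<And>x. (\<And>y. y < x \<Longrightarrow> P y) \<Longrightarrow> P x"
    by (induction x rule: measure_induct_rule[where f=index_of]) (rule that, simp add: less_indexed_def)
qed

end

text \<open>Conjugating \<open>g\<close> with the relabelling to \<open>'n indexed\<close> moves the
  situation to a well-ordered index type. The relabelling is linear, preserves Lebesgue measure and
  leaves the determinant of the derivative unchanged, so integrability can be carried there and
  back.\<close>

lemma set_integrable_change_of_variables:
  fixes g :: "real^'n::finite \<Rightarrow> real^'n" and f :: "real^'n \<Rightarrow> real"
  assumes S: "S \<in> sets lebesgue" and D: "\<And>x. x \<in> S \<Longrightarrow> (g has_derivative (\<lambda>h. A x *v h)) (at x)"
    and inj: "inj_on g S" and f: "set_integrable lebesgue (g ` S) f"
  shows "set_integrable lebesgue S (\<lambda>x. \<bar>det (A x)\<bar> * f (g x))"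
proof -
  let ?T = "reindex Rep_indexed :: real^'n \<Rightarrow> real^('n indexed)"
  let ?R = "reindex Abs_indexed :: real^('n indexed) \<Rightarrow> real^'n"
  have bR: "bij (Rep_indexed :: 'n indexed \<Rightarrow> 'n)"
    by (rule bijI') (auto simp: Rep_indexed_inject intro: exI[of _ "Abs_indexed _"] simp: Abs_indexed_inverse)
  have bA: "bij (Abs_indexed :: 'n \<Rightarrow> 'n indexed)"
    by (rule bijI') (auto simp: Abs_indexed_inject intro: exI[of _ "Rep_indexed _"] simp: Rep_indexed_inverse)
  have RT: "?R (?T x) = x" for x by (rule reindex_inverse) (simp add: Abs_indexed_inverse)
  have TR: "?T (?R y) = y" for y by (rule reindex_inverse) (simp add: Rep_indexed_inverse)
  define g1 where "g1 y = ?T (g (?R y))" for y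
  define A1 where "A1 y = (\<chi> i j. A (?R y) $ Rep_indexed i $ Rep_indexed j)" for y
  define S1 where "S1 = ?R -` S"
  \<comment> \<open>Values in \<open>real^1\<close>, since the change of variables is formulated for
    vector-valued integrands.\<close>
  define f1 where "f1 y = (vec (f (?R y)) :: real^1)" for y
  have S1: "S1 \<in> sets lebesgue"
    using measurable_sets[OF measurable_reindex[OF bA] S] by (simp add: S1_def)
  have D1: "(g1 has_derivative (\<lambda>h. A1 y *v h)) (at y within S1)" if y: "y \<in> S1" for y
  proof -
    have "((\<lambda>y. g (?R y)) has_derivative (\<lambda>h. A (?R y) *v ?R h)) (at y)"
      by (rule has_derivative_compose[OF bounded_linear_imp_has_derivative[OF bounded_linear_reindex] D])
        (use y in \<open>simp add: S1_def\<close>)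
    then have "((\<lambda>y. ?T (g (?R y))) has_derivative (\<lambda>h. ?T (A (?R y) *v ?R h))) (at y)"
      by (rule bounded_linear.has_derivative[OF bounded_linear_reindex])
    moreover have "?T (A (?R y) *v ?R h) = A1 y *v h" for h
    proof -
      have "(\<Sum>j\<in>UNIV. A (?R y) $ Rep_indexed i $ j * h $ Abs_indexed j) = (\<Sum>j\<in>UNIV. A (?R y) $ Rep_indexed i $ Rep_indexed j * h $ j)" for i
        using sum.reindex_bij_betw[OF bR, of "\<lambda>j. A (?R y) $ Rep_indexed i $ j * h $ Abs_indexed j"]
        by (simp add: Rep_indexed_inverse)
      then show ?thesis by (simp add: vec_eq_iff matrix_vector_mult_def A1_def)
    qed
    ultimately show ?thesis unfolding g1_def by (simp add: has_derivative_at_withinI)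
  qed
  have inj1: "inj_on g1 S1"
  proof (rule inj_onI)
    fix y z assume "y \<in> S1" "z \<in> S1" "g1 y = g1 z"
    then have "g (?R y) = g (?R z)" unfolding g1_def by (metis RT)
    then have "?R y = ?R z" using inj \<open>y \<in> S1\<close> \<open>z \<in> S1\<close> by (auto simp: S1_def dest: inj_onD)
    then show "y = z" by (metis TR)
  qed
  have im: "g1 ` S1 = ?R -` (g ` S)"
  proof
    show "g1 ` S1 \<subseteq> ?R -` (g ` S)" by (auto simp: g1_def S1_def RT)
    show "?R -` (g ` S) \<subseteq> g1 ` S1"
    proof
      fix y assume "y \<in> ?R -` (g ` S)"
      then obtain x where x: "x \<in> S" "?R y = g x" by auto
      then have "y = g1 (?T x)" unfolding g1_def by (metis RT TR)
      then show "y \<in> g1 ` S1" using x RT by (auto simp: S1_def)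
    qed
  qed
  have vec: "(\<lambda>y. vec (h y) :: real^1) absolutely_integrable_on X \<longleftrightarrow> h absolutely_integrable_on X" for h :: "real^('n indexed) \<Rightarrow> real" and X
    unfolding absolutely_integrable_on_1_iff by simp
  have "(\<lambda>y. f (?R y)) absolutely_integrable_on (g1 ` S1)"
    unfolding im by (rule set_integrable_reindex[OF bA f])
  then have "f1 absolutely_integrable_on (g1 ` S1)" unfolding f1_def vec .
  then have "(\<lambda>y. \<bar>det (matrix ((*v) (A1 y)))\<bar> *\<^sub>R f1 (g1 y)) absolutely_integrable_on S1"
    using has_absolute_integral_change_of_variables[OF S1 D1 inj1, of f1 "integral (g1 ` S1) f1"] by simp
  moreover have "\<bar>det (matrix ((*v) (A1 y)))\<bar> *\<^sub>R f1 (g1 y) = vec (\<bar>det (A (?R y))\<bar> * f (g (?R y)))" for y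
    using det_reindex[OF bR, of "A (?R y)"] by (simp add: f1_def g1_def RT A1_def vec_eq_iff)
  ultimately have "(\<lambda>y. \<bar>det (A (?R y))\<bar> * f (g (?R y))) absolutely_integrable_on S1" by (simp add: vec)
  then have "set_integrable lebesgue (?T -` S1) (\<lambda>x. \<bar>det (A (?R (?T x)))\<bar> * f (g (?R (?T x))))"
    by (rule set_integrable_reindex[OF bR])
  moreover have "?T -` S1 = S" by (simp add: S1_def RT vimage_def)
  ultimately show ?thesis by (simp add: RT)
qed

section \<open>Composition operators\<close>

lemma loc_integrable_measurable:
  fixes f :: "real^'n::finite \<Rightarrow> real"
  assumes U: "open U" and f: "loc_integrable U f"
  shows "(\<lambda>x. indicator U x * f x) \<in> borel_measurable lebesgue"
proof -
  obtain C where C: "\<And>n. compact (C n)" "\<And>n. C n \<subseteq> U" "\<And>n. C n \<subseteq> interior (C (Suc n))" "\<Union>(range C) = U"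
    by (rule open_Union_compact_subsets[OF U]) blast
  have mono: "C m \<subseteq> C n" if "m \<le> n" for m n
    using lift_Suc_mono_le[of C, OF _ that] C(3) interior_subset by blast
  show ?thesis
  proof (rule borel_measurable_LIMSEQ_real)
    show "(\<lambda>x. indicator (C n) x * f x) \<in> borel_measurable lebesgue" for n
      using f C(1,2) by (intro set_integrable_measurable) (auto simp: loc_integrable_def)
    show "(\<lambda>n. indicator (C n) x * f x) \<longlonglongrightarrow> indicator U x * f x" for x
    proof (cases "x \<in> U")
      case True
      then obtain m where m: "x \<in> C m" using C(4) by blast
      show ?thesis
      proof (rule tendsto_eventually, rule eventually_sequentiallyI)
        fix n assume "m \<le> n"
        then have "x \<in> C n" using mono m by blast
        then show "indicator (C n) x * f x = indicator U x * f x" using True by simp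
      qed
    next
      case False
      then have "x \<notin> C n" for n using C(2) by blast
      then show ?thesis using False by simp
    qed
  qed
qed

lemma borel_measurable_vec_lambda:
  fixes f :: "'i::finite \<Rightarrow> 'a \<Rightarrow> real"
  assumes "\<And>i. f i \<in> borel_measurable M"
  shows "(\<lambda>x. \<chi> i. f i x) \<in> borel_measurable M"
proof (rule borel_measurable_euclidean_space[THEN iffD2], rule ballI)
  fix b :: "real^'i" assume "b \<in> Basis"
  then obtain i where "b = axis i 1" by (auto simp: Basis_vec_def)
  then show "(\<lambda>x. (\<chi> i. f i x) \<bullet> b) \<in> borel_measurable M" using assms[of i] by (simp add: inner_axis)
qed

lemma weak_grad_measurable:
  assumes "open U" "weak_grad U u g"
  shows "(\<lambda>x. indicator U x *\<^sub>R g x) \<in> borel_measurable lebesgue"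
proof -
  have "(\<lambda>x. \<chi> i. indicator U x * g x $ i) \<in> borel_measurable lebesgue"
    using assms by (intro borel_measurable_vec_lambda loc_integrable_measurable) (simp_all add: weak_grad_def)
  moreover have "(\<chi> i. indicator U x * g x $ i) = indicator U x *\<^sub>R g x" for x by (simp add: vec_eq_iff)
  ultimately show ?thesis by simp
qed

text \<open>The sum is at most \<open>CARD('i)\<close> times its largest term, whose power is one of
  the summands on the right; no convexity of the power is involved.\<close>

lemma powr_sum_le:
  fixes a :: "'i::finite \<Rightarrow> real"
  assumes a: "\<And>i. a i \<ge> 0" and s: "s \<ge> 0"
  shows "(\<Sum>i\<in>UNIV. a i) powr s \<le> real CARD('i) powr s * (\<Sum>i\<in>UNIV. a i powr s)"
proof -
  define m where "m = Max (range a)"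
  have le: "a i \<le> m" for i by (simp add: m_def)
  have "m \<in> range a" unfolding m_def by (rule Max_in) auto
  then obtain j where j: "m = a j" by blast
  have "(\<Sum>i\<in>UNIV. a i) \<le> real CARD('i) * m"
    using sum_bounded_above[of UNIV a m] le by simp
  then have "(\<Sum>i\<in>UNIV. a i) powr s \<le> (real CARD('i) * m) powr s"
    using s a by (intro powr_mono2) (auto intro: sum_nonneg)
  also have "\<dots> = real CARD('i) powr s * a j powr s" using a[of j] by (simp add: j powr_mult)
  also have "\<dots> \<le> real CARD('i) powr s * (\<Sum>i\<in>UNIV. a i powr s)"
    by (intro mult_left_mono member_le_sum) auto
  finally show ?thesis .
qed

text \<open>A stand-in for the norm of the derivative matrix. The sum of row norms is what the chain
  rule for \<open>f \<circ> \<psi>\<close> produces, and it also bounds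
  \<open>1 / min_stretch\<close> of the inverse matrix, so one quantity serves both
  directions.\<close>

definition grad_sum :: "(real^'n::finite) set \<Rightarrow> (real^'n \<Rightarrow> real^'n) \<Rightarrow> real^'n \<Rightarrow> real" where
  "grad_sum V \<psi> y = (\<Sum>k\<in>UNIV. norm (wgrad V (\<lambda>y. \<psi> y $ k) y))"

lemma map_in_L1p_weak_grad: "map_in_L1p V s \<psi> \<Longrightarrow> weak_grad V (\<lambda>y. \<psi> y $ k) (wgrad V (\<lambda>y. \<psi> y $ k))"
  unfolding map_in_L1p_def in_L1p_def by (blast intro: weakly_diff_wgrad)

lemma grad_sum_measurable:
  assumes V: "open V" and \<psi>: "map_in_L1p V s \<psi>"
  shows "(\<lambda>y. indicator V y * grad_sum V \<psi> y powr s) \<in> borel_measurable lebesgue"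
proof -
  have "(\<lambda>y. (\<Sum>k\<in>UNIV. norm (indicator V y *\<^sub>R wgrad V (\<lambda>y. \<psi> y $ k) y)) powr s) \<in> borel_measurable lebesgue"
    by (intro powr_real_measurable borel_measurable_sum measurable_compose[OF weak_grad_measurable[OF V map_in_L1p_weak_grad[OF \<psi>]] borel_measurable_norm] borel_measurable_const)
  moreover have "(\<Sum>k\<in>UNIV. norm (indicator V y *\<^sub>R wgrad V (\<lambda>y. \<psi> y $ k) y)) powr s = indicator V y * grad_sum V \<psi> y powr s" for y
    by (cases "y \<in> V") (simp_all add: grad_sum_def)
  ultimately show ?thesis by simp
qed

lemma grad_sum_finite:
  assumes V: "open V" and \<psi>: "map_in_L1p V s \<psi>" and s: "s \<ge> 0"
  shows "(\<integral>\<^sup>+ y\<in>V. ennreal (grad_sum V \<psi> y powr s) \<partial>lebesgue) < \<infinity>"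
proof -
  let ?c = "real CARD('a) powr s" and ?w = "\<lambda>k. wgrad V (\<lambda>y. \<psi> y $ k)"
  have m: "(\<lambda>y. ennreal (norm (?w k y) powr s) * indicator V y) \<in> borel_measurable lebesgue" for k
  proof -
    have "(\<lambda>y. ennreal (norm (indicator V y *\<^sub>R ?w k y) powr s)) \<in> borel_measurable lebesgue"
      by (intro measurable_compose[OF powr_real_measurable measurable_ennreal] measurable_compose[OF weak_grad_measurable[OF V map_in_L1p_weak_grad[OF \<psi>]] borel_measurable_norm] borel_measurable_const)
    also have "(\<lambda>y. ennreal (norm (indicator V y *\<^sub>R ?w k y) powr s)) = (\<lambda>y. ennreal (norm (?w k y) powr s) * indicator V y)"
    proof
      fix y show "ennreal (norm (indicator V y *\<^sub>R ?w k y) powr s) = ennreal (norm (?w k y) powr s) * indicator V y"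
        by (cases "y \<in> V") simp_all
    qed
    finally show ?thesis .
  qed
  have "(\<integral>\<^sup>+ y\<in>V. ennreal (grad_sum V \<psi> y powr s) \<partial>lebesgue) \<le> (\<integral>\<^sup>+ y. ennreal ?c * (\<Sum>k\<in>UNIV. ennreal (norm (?w k y) powr s) * indicator V y) \<partial>lebesgue)"
  proof (rule nn_integral_mono)
    fix y
    have "ennreal (grad_sum V \<psi> y powr s) \<le> ennreal (?c * (\<Sum>k\<in>UNIV. norm (?w k y) powr s))"
      unfolding grad_sum_def by (intro ennreal_leI powr_sum_le s) simp
    also have "\<dots> = ennreal ?c * (\<Sum>k\<in>UNIV. ennreal (norm (?w k y) powr s))"
      by (subst ennreal_mult) (simp_all add: sum_nonneg sum_ennreal)
    finally show "ennreal (grad_sum V \<psi> y powr s) * indicator V y \<le> ennreal ?c * (\<Sum>k\<in>UNIV. ennreal (norm (?w k y) powr s) * indicator V y)"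
      by (cases "y \<in> V") simp_all
  qed
  also have "\<dots> = ennreal ?c * (\<Sum>k\<in>UNIV. \<integral>\<^sup>+ y\<in>V. ennreal (norm (?w k y) powr s) \<partial>lebesgue)"
    by (subst nn_integral_cmult[OF borel_measurable_sum[OF m]], subst nn_integral_sum[OF m], rule refl)
  also have "\<dots> < \<infinity>"
  proof -
    have "(\<integral>\<^sup>+ y\<in>V. ennreal (norm (?w k y) powr s) \<partial>lebesgue) < top" for k
      using \<psi> by (simp add: map_in_L1p_def in_L1p_def)
    then have "(\<Sum>k\<in>UNIV. \<integral>\<^sup>+ y\<in>V. ennreal (norm (?w k y) powr s) \<partial>lebesgue) < top" by simp
    then show ?thesis by (simp add: ennreal_mult_less_top)
  qed
  finally show ?thesis .
qed

section \<open>Maps with bounded weak gradients\<close>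

lemma L1inf_bound:
  assumes "in_L1inf U f"
  obtains C where "C \<ge> 0" "AE x in lebesgue. x \<in> U \<longrightarrow> norm (wgrad U f x) \<le> C"
proof -
  obtain C where C: "AE x in lebesgue. x \<in> U \<longrightarrow> norm (wgrad U f x) \<le> C"
    using assms unfolding in_L1inf_def by blast
  show ?thesis by (rule that[of "max 0 C"]) (simp, use C in \<open>eventually_elim, auto\<close>)
qed

lemma map_in_L1inf_bound:
  assumes "map_in_L1inf U \<phi>"
  obtains M where "M \<ge> 0" "\<And>k. weak_grad U (\<lambda>x. \<phi> x $ k) (wgrad U (\<lambda>x. \<phi> x $ k))"
    "\<And>k. AE x in lebesgue. x \<in> U \<longrightarrow> norm (wgrad U (\<lambda>x. \<phi> x $ k) x) \<le> M"
proof -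
  have "\<exists>C. C \<ge> 0 \<and> (AE x in lebesgue. x \<in> U \<longrightarrow> norm (wgrad U (\<lambda>x. \<phi> x $ k) x) \<le> C)" for k
  proof -
    have "in_L1inf U (\<lambda>x. \<phi> x $ k)" using assms by (simp add: map_in_L1inf_def)
    from L1inf_bound[OF this] show ?thesis by blast
  qed
  then have "\<exists>C. \<forall>k. C k \<ge> 0 \<and> (AE x in lebesgue. x \<in> U \<longrightarrow> norm (wgrad U (\<lambda>x. \<phi> x $ k) x) \<le> C k)"
    by (intro choice allI)
  then obtain C where C: "\<And>k. C k \<ge> 0" "\<And>k. AE x in lebesgue. x \<in> U \<longrightarrow> norm (wgrad U (\<lambda>x. \<phi> x $ k) x) \<le> C k" by blast
  have le: "C k \<le> (\<Sum>k\<in>UNIV. C k)" for k using C(1) by (intro member_le_sum) auto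
  show ?thesis
  proof (rule that[of "\<Sum>k\<in>UNIV. C k"])
    show "0 \<le> (\<Sum>k\<in>UNIV. C k)" using C(1) by (intro sum_nonneg)
    show "weak_grad U (\<lambda>x. \<phi> x $ k) (wgrad U (\<lambda>x. \<phi> x $ k))" for k
      using assms by (intro weakly_diff_wgrad) (simp add: map_in_L1inf_def in_L1inf_def)
    show "AE x in lebesgue. x \<in> U \<longrightarrow> norm (wgrad U (\<lambda>x. \<phi> x $ k) x) \<le> (\<Sum>k\<in>UNIV. C k)" for k
      using C(2)[of k]
    proof eventually_elim
      case (elim x)
      then show ?case using le[of k] by auto
    qed
  qed
qed

text \<open>On a ball about each point of \<open>E\<close> the components are Lipschitz with
  constant \<open>M\<close>, hence the map with constant \<open>CARD('a) * M\<close>; a locally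
  Lipschitz map of the space into itself preserves negligible sets.\<close>

lemma map_L1inf_null_image:
  assumes U: "open U" and c: "continuous_on U \<phi>" and \<phi>: "map_in_L1inf U \<phi>" and E: "E \<in> null_sets lebesgue" "E \<subseteq> U"
  shows "\<phi> ` E \<in> null_sets lebesgue"
proof -
  obtain M where M: "M \<ge> 0" "\<And>k. weak_grad U (\<lambda>x. \<phi> x $ k) (wgrad U (\<lambda>x. \<phi> x $ k))"
    "\<And>k. AE x in lebesgue. x \<in> U \<longrightarrow> norm (wgrad U (\<lambda>x. \<phi> x $ k) x) \<le> M"
    using map_in_L1inf_bound[OF \<phi>] by blast
  have "negligible (\<phi> ` E)"
  proof (rule negligible_locally_Lipschitz_image[OF order_refl])
    show "negligible E" using E by (simp add: negligible_iff_null_sets)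
    fix x assume "x \<in> E"
    then obtain r where r: "r > 0" "ball x r \<subseteq> U" using U E(2) by (meson open_contains_ball subset_iff)
    have "norm (\<phi> y - \<phi> x) \<le> (real CARD('a) * M) * norm (y - x)" if y: "y \<in> ball x r" for y
    proof -
      have "\<bar>\<phi> y $ k - \<phi> x $ k\<bar> \<le> M * norm (y - x)" for k
      proof (rule weak_grad_bounded_imp_lipschitz[OF M(2) _ M(1,3) r(2) y])
        show "continuous_on U (\<lambda>x. \<phi> x $ k)" using c by (intro continuous_intros)
      qed (use r in simp)
      then have "(\<Sum>k\<in>UNIV. \<bar>(\<phi> y - \<phi> x) $ k\<bar>) \<le> (\<Sum>k\<in>(UNIV::'a set). M * norm (y - x))"
        by (intro sum_mono) simp
      then show ?thesis using norm_le_l1_cart[of "\<phi> y - \<phi> x"] by simp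
    qed
    then show "\<exists>T B. open T \<and> x \<in> T \<and> (\<forall>y\<in>E \<inter> T. norm (\<phi> y - \<phi> x) \<le> B * norm (y - x))"
      using r(1) by (intro exI[of _ "ball x r"] exI[of _ "real CARD('a) * M"]) auto
  qed
  then show ?thesis by (simp add: negligible_iff_null_sets)
qed

text \<open>Every common Lebesgue point of the finitely many entries of the weak Jacobi matrix is a
  point of differentiability. Besides existence, this identifies the classical derivative with the
  \<open>wgrad\<close> choices inside \<open>jac_det\<close> and \<open>inner_dist\<close>.\<close>

lemma map_L1inf_AE_has_derivative:
  fixes \<phi> :: "real^'n::finite \<Rightarrow> real^'n"
  assumes U: "open U" and c: "continuous_on U \<phi>" and \<phi>: "map_in_L1inf U \<phi>"
  shows "AE x in lebesgue. x \<in> U \<longrightarrow> (\<phi> has_derivative (\<lambda>h. weak_jac U \<phi> x *v h)) (at x)"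
proof -
  obtain M where M: "M \<ge> 0" "\<And>k. weak_grad U (\<lambda>x. \<phi> x $ k) (wgrad U (\<lambda>x. \<phi> x $ k))"
    "\<And>k. AE x in lebesgue. x \<in> U \<longrightarrow> norm (wgrad U (\<lambda>x. \<phi> x $ k) x) \<le> M"
    using map_in_L1inf_bound[OF \<phi>] by blast
  have "AE x in lebesgue. \<forall>k\<in>UNIV. \<forall>i\<in>UNIV. x \<in> U \<longrightarrow> lebesgue_point (\<lambda>z. wgrad U (\<lambda>x. \<phi> x $ k) z $ i) x"
    using M(2) by (intro AE_finite_allI AE_lebesgue_point_loc U) (auto simp: weak_grad_def)
  then show ?thesis
  proof eventually_elim
    case (elim x)
    show ?case
    proof
      assume x: "x \<in> U"
      have "((\<lambda>x. \<phi> x $ k) has_derivative (\<lambda>h. wgrad U (\<lambda>x. \<phi> x $ k) x \<bullet> h)) (at x)" for k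
      proof (rule weak_grad_bounded_imp_has_derivative[OF M(2) _ M(1,3) U x])
        show "continuous_on U (\<lambda>x. \<phi> x $ k)" using c by (intro continuous_intros)
        show "lebesgue_point (\<lambda>z. wgrad U (\<lambda>x. \<phi> x $ k) z $ i) x" for i using elim x by blast
      qed
      then have "((\<lambda>x. \<chi> k. \<phi> x $ k) has_derivative (\<lambda>h. \<chi> k. wgrad U (\<lambda>x. \<phi> x $ k) x \<bullet> h)) (at x)"
        by (rule has_derivative_vec_lambda)
      moreover have "(\<chi> k. wgrad U (\<lambda>x. \<phi> x $ k) x \<bullet> h) = weak_jac U \<phi> x *v h" for h
        by (simp add: vec_eq_iff matrix_vector_mult_def weak_jac_def inner_vec_def)
      ultimately show "(\<phi> has_derivative (\<lambda>h. weak_jac U \<phi> x *v h)) (at x)" by simp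
    qed
  qed
qed

lemma jac_det_measurable:
  fixes \<phi> :: "real^'n::finite \<Rightarrow> real^'n"
  assumes U: "open U" and w: "\<And>k. weak_grad U (\<lambda>x. \<phi> x $ k) (wgrad U (\<lambda>x. \<phi> x $ k))"
  shows "{x \<in> U. jac_det U \<phi> x \<noteq> 0} \<in> sets lebesgue"
proof -
  define h where "h x = det (\<chi> i j. indicator U x * wgrad U (\<lambda>x. \<phi> x $ i) x $ j)" for x
  have "(\<lambda>x. indicator U x * wgrad U (\<lambda>x. \<phi> x $ i) x $ j) \<in> borel_measurable lebesgue" for i j
    using w[of i] by (intro loc_integrable_measurable U) (simp add: weak_grad_def)
  then have "h \<in> borel_measurable lebesgue"
    unfolding h_def det_def by (simp add: borel_measurable_sum borel_measurable_times borel_measurable_prod)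
  then have "h -` (- {0}) \<inter> space lebesgue \<in> sets lebesgue" by (rule measurable_sets) auto
  moreover have "U \<in> sets lebesgue" using U by simp
  moreover have "{x \<in> U. jac_det U \<phi> x \<noteq> 0} = U \<inter> (h -` (- {0}) \<inter> space lebesgue)"
  proof -
    have "h x = jac_det U \<phi> x" if "x \<in> U" for x
    proof -
      have "(\<chi> i j. indicator U x * wgrad U (\<lambda>x. \<phi> x $ i) x $ j) = weak_jac U \<phi> x"
        using that by (simp add: vec_eq_iff weak_jac_def)
      then show ?thesis by (simp add: h_def jac_det_def)
    qed
    then show ?thesis by auto
  qed
  ultimately show ?thesis by auto
qed

section \<open>Minimal stretching and inverse matrices\<close>

lemma min_stretch_ge:
  assumes "\<And>h. norm h = 1 \<Longrightarrow> c \<le> norm (A *v h)"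
  shows "c \<le> min_stretch (A :: real^'n^'n::finite)"
  unfolding min_stretch_def
proof (rule cInf_greatest)
  have "norm (axis undefined 1 :: real^'n) = 1" by (simp add: norm_axis_1)
  then show "{norm (A *v h) |h. norm h = 1} \<noteq> {}" by blast
qed (use assms in auto)

text \<open>Recover \<open>h\<close> as \<open>B\<close> applied to \<open>A *v h\<close> and
  estimate row by row. Inserting a unit vector shows that \<open>q\<close> cannot vanish.\<close>

lemma inverse_min_stretch_le:
  fixes A B :: "real^'n::finite^'n"
  assumes BA: "B ** A = mat 1"
  defines "q \<equiv> \<Sum>i\<in>UNIV. norm (B $ i)"
  shows "q > 0" "min_stretch A \<ge> 1 / q"
proof -
  have le: "norm h \<le> q * norm (A *v h)" for h
  proof -
    have "h = B *v (A *v h)" by (simp add: matrix_vector_mul_assoc BA)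
    then have "norm h = norm (B *v (A *v h))" by simp
    also have "\<dots> \<le> (\<Sum>i\<in>UNIV. \<bar>(B *v (A *v h)) $ i\<bar>)" by (rule norm_le_l1_cart)
    also have "\<dots> \<le> (\<Sum>i\<in>UNIV. norm (B $ i) * norm (A *v h))"
      by (intro sum_mono) (simp add: matrix_vector_mul_component Cauchy_Schwarz_ineq2)
    also have "\<dots> = q * norm (A *v h)" by (simp add: q_def sum_distrib_right)
    finally show ?thesis .
  qed
  have "q \<ge> 0" unfolding q_def by (intro sum_nonneg) simp
  moreover have "q \<noteq> 0" using le[of "axis undefined 1"] by (auto simp: norm_axis_1)
  ultimately show q: "q > 0" by simp
  show "min_stretch A \<ge> 1 / q"
  proof (rule min_stretch_ge)
    fix h :: "real^'n" assume "norm h = 1"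
    then show "1 / q \<le> norm (A *v h)" using le[of h] q by (simp add: pos_divide_le_eq mult.commute)
  qed
qed

lemma matrix_inv_mult:
  fixes A :: "real^'n::finite^'n"
  assumes "det A \<noteq> 0"
  shows "matrix_inv A ** A = mat 1"
proof -
  have "\<exists>B. A ** B = mat 1 \<and> B ** A = mat 1" using assms invertible_det_nz[of A] by (simp add: invertible_def)
  then have "A ** matrix_inv A = mat 1 \<and> matrix_inv A ** A = mat 1" unfolding matrix_inv_def by (rule someI_ex)
  then show ?thesis by blast
qed

text \<open>\<open>wgrad\<close> of the composition is an arbitrary weak gradient; by uniqueness it
  equals the one from the chain rule almost everywhere, and that one is estimated term by term.
  \<open>C\<close> stays a parameter so that the infimum over admissible bounds can be taken
  afterwards.\<close>

lemma wgrad_chain_rule_norm_le: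
  fixes f :: "real^'n::finite \<Rightarrow> real"
  assumes V: "open V" and U: "open U" and \<psi>: "continuous_on V \<psi>" "\<psi> ` V \<subseteq> U" "map_in_L1p V s \<psi>"
    and N: "luzin_N_inv V \<psi>" and f: "continuous_on U f" "in_L1inf U f"
    and C: "C \<ge> 0" "AE x in lebesgue. x \<in> U \<longrightarrow> norm (wgrad U f x) \<le> C"
  shows "weakly_diff V (f \<circ> \<psi>)"
    and "AE y in lebesgue. y \<in> V \<longrightarrow> norm (wgrad V (f \<circ> \<psi>) y) \<le> C * grad_sum V \<psi> y"
proof -
  let ?g = "wgrad U f" and ?G = "\<lambda>k. wgrad V (\<lambda>y. \<psi> y $ k)"
  have N': "{y \<in> V. \<psi> y \<in> E} \<in> null_sets lebesgue" if "E \<in> null_sets lebesgue" for E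
    using N that by (simp add: luzin_N_inv_def)
  have wf: "weak_grad U f ?g" using f(2) by (intro weakly_diff_wgrad) (simp add: in_L1inf_def)
  have w: "weak_grad V (f \<circ> \<psi>) (\<lambda>y. \<Sum>k\<in>UNIV. ?g (\<psi> y) $ k *\<^sub>R ?G k y)"
    using weak_grad_chain_rule[OF V U \<psi>(1,2) map_in_L1p_weak_grad[OF \<psi>(3)] f(1) wf C N'] by (simp add: comp_def)
  then show wd: "weakly_diff V (f \<circ> \<psi>)" by (auto simp: weakly_diff_def)
  have "AE y in lebesgue. y \<in> V \<longrightarrow> (\<psi> y \<in> U \<longrightarrow> norm (?g (\<psi> y)) \<le> C)"
    by (rule AE_preimage[where Q="\<lambda>x. x \<in> U \<longrightarrow> norm (?g x) \<le> C"]) (rule N', assumption, rule C(2))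
  with weak_grad_unique[OF weakly_diff_wgrad[OF wd] w V]
  show "AE y in lebesgue. y \<in> V \<longrightarrow> norm (wgrad V (f \<circ> \<psi>) y) \<le> C * grad_sum V \<psi> y"
  proof eventually_elim
    case (elim y)
    show ?case
    proof
      assume y: "y \<in> V"
      have g: "norm (?g (\<psi> y)) \<le> C" using elim(2) y \<psi>(2) by blast
      have "norm (wgrad V (f \<circ> \<psi>) y) = norm (\<Sum>k\<in>UNIV. ?g (\<psi> y) $ k *\<^sub>R ?G k y)" using elim(1) y by simp
      also have "\<dots> \<le> (\<Sum>k\<in>UNIV. norm (?g (\<psi> y) $ k *\<^sub>R ?G k y))" by (rule norm_sum)
      also have "\<dots> \<le> (\<Sum>k\<in>UNIV. C * norm (?G k y))"
      proof (rule sum_mono)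
        fix k
        have "\<bar>?g (\<psi> y) $ k\<bar> \<le> C" using component_le_norm_cart[of "?g (\<psi> y)" k] g by linarith
        then show "norm (?g (\<psi> y) $ k *\<^sub>R ?G k y) \<le> C * norm (?G k y)" by (simp add: mult_right_mono)
      qed
      also have "\<dots> = C * grad_sum V \<psi> y" by (simp add: grad_sum_def sum_distrib_left)
      finally show "norm (wgrad V (f \<circ> \<psi>) y) \<le> C * grad_sum V \<psi> y" .
    qed
  qed
qed

theorem L1p_luzin_imp_bdd_comp_op:
  fixes \<psi> :: "real^'n::finite \<Rightarrow> real^'n"
  assumes V: "open V" and U: "open U" and \<psi>: "continuous_on V \<psi>" "\<psi> ` V \<subseteq> U" "map_in_L1p V s \<psi>"
    and N: "luzin_N_inv V \<psi>" and s: "s > 0"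
  shows "bdd_comp_op_inf V \<psi> U s"
proof -
  define I where "I = (\<integral>\<^sup>+ y\<in>V. ennreal (grad_sum V \<psi> y powr s) \<partial>lebesgue)"
  have I: "I < \<infinity>" unfolding I_def using grad_sum_finite[OF V \<psi>(3)] s by simp
  \<comment> \<open>The norm of \<open>grad_sum V \<psi>\<close> as an s-th power integrable
    function on \<open>V\<close> bounds the operator.\<close>
  define K where "K = enn2real I powr (1/s)"
  have K0: "K \<ge> 0" by (simp add: K_def)
  have main: "in_L1p V s (f \<circ> \<psi>) \<and> L1p_seminorm V s (f \<circ> \<psi>) \<le> K * C"
    if f: "continuous_on U f" "in_L1inf U f" and C: "C \<ge> 0" "AE x in lebesgue. x \<in> U \<longrightarrow> norm (wgrad U f x) \<le> C" for f C
  proof -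
    note * = wgrad_chain_rule_norm_le[OF V U \<psi> N f C]
    let ?J = "\<integral>\<^sup>+ y\<in>V. ennreal (norm (wgrad V (f \<circ> \<psi>) y) powr s) \<partial>lebesgue"
    have "?J \<le> (\<integral>\<^sup>+ y. ennreal (C powr s) * (ennreal (grad_sum V \<psi> y powr s) * indicator V y) \<partial>lebesgue)"
    proof (rule nn_integral_mono_AE)
      show "AE y in lebesgue. ennreal (norm (wgrad V (f \<circ> \<psi>) y) powr s) * indicator V y \<le> ennreal (C powr s) * (ennreal (grad_sum V \<psi> y powr s) * indicator V y)"
        using *(2)
      proof eventually_elim
        case (elim y)
        show ?case
        proof (cases "y \<in> V")
          case True
          then have "norm (wgrad V (f \<circ> \<psi>) y) powr s \<le> (C * grad_sum V \<psi> y) powr s"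
            using elim s by (intro powr_mono2) auto
          also have "\<dots> = C powr s * grad_sum V \<psi> y powr s" by (rule powr_mult)
          finally show ?thesis using True by (simp add: ennreal_leI flip: ennreal_mult)
        qed simp
      qed
    qed
    also have "\<dots> = ennreal (C powr s) * I" unfolding I_def
    proof (rule nn_integral_cmult)
      have "(\<lambda>y. ennreal (indicator V y * grad_sum V \<psi> y powr s)) \<in> borel_measurable lebesgue"
        by (rule measurable_compose[OF grad_sum_measurable[OF V \<psi>(3)] measurable_ennreal])
      also have "(\<lambda>y. ennreal (indicator V y * grad_sum V \<psi> y powr s)) = (\<lambda>y. ennreal (grad_sum V \<psi> y powr s) * indicator V y)"
      proof
        fix y show "ennreal (indicator V y * grad_sum V \<psi> y powr s) = ennreal (grad_sum V \<psi> y powr s) * indicator V y"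
          by (cases "y \<in> V") simp_all
      qed
      finally show "(\<lambda>y. ennreal (grad_sum V \<psi> y powr s) * indicator V y) \<in> borel_measurable lebesgue" .
    qed
    finally have J: "?J \<le> ennreal (C powr s) * I" .
    have fin: "ennreal (C powr s) * I < \<infinity>" using I by (simp add: ennreal_mult_less_top)
    then have in_L: "in_L1p V s (f \<circ> \<psi>)" using *(1) J unfolding in_L1p_def by (auto intro: le_less_trans)
    have "enn2real ?J \<le> enn2real (ennreal (C powr s) * I)" using J fin by (intro enn2real_mono) auto
    also have "\<dots> = C powr s * enn2real I" by (simp add: enn2real_mult)
    finally have "L1p_seminorm V s (f \<circ> \<psi>) \<le> (C powr s * enn2real I) powr (1/s)"
      unfolding L1p_seminorm_def using s by (intro powr_mono2) auto
    also have "\<dots> = (C powr s) powr (1/s) * K" unfolding K_def by (rule powr_mult)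
    also have "(C powr s) powr (1/s) = C" using s C(1) by (simp add: powr_powr)
    finally have "L1p_seminorm V s (f \<circ> \<psi>) \<le> C * K" .
    then show ?thesis using in_L by (simp only: mult.commute[of K C] simp_thms)
  qed
  show ?thesis unfolding bdd_comp_op_inf_def
  proof (intro exI[of _ K] allI impI, elim conjE)
    fix f assume f: "continuous_on U f" "in_L1inf U f"
    let ?S = "{C. C \<ge> 0 \<and> (AE x in lebesgue. x \<in> U \<longrightarrow> norm (wgrad U f x) \<le> C)}"
    obtain C where C: "C \<ge> 0" "AE x in lebesgue. x \<in> U \<longrightarrow> norm (wgrad U f x) \<le> C" using L1inf_bound[OF f(2)] by blast
    \<comment> \<open>Passing from each admissible \<open>C\<close> to the infimum divides by
      \<open>K\<close>, so \<open>K = 0\<close> is treated apart.\<close>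
    have "L1p_seminorm V s (f \<circ> \<psi>) \<le> K * Inf ?S"
    proof (cases "K = 0")
      case True
      then show ?thesis using main[OF f C] by simp
    next
      case False
      have "L1p_seminorm V s (f \<circ> \<psi>) / K \<le> Inf ?S"
      proof (rule cInf_greatest)
        show "?S \<noteq> {}" using C by blast
        fix C assume "C \<in> ?S"
        then have "L1p_seminorm V s (f \<circ> \<psi>) \<le> K * C" using main[OF f] by blast
        then show "L1p_seminorm V s (f \<circ> \<psi>) / K \<le> C" using False K0 by (simp add: divide_le_eq mult.commute)
      qed
      then show ?thesis using False K0 by (simp add: divide_le_eq mult.commute)
    qed
    then show "in_L1p V s (f \<circ> \<psi>) \<and> L1p_seminorm V s (f \<circ> \<psi>) \<le> K * L1inf_seminorm U f"
      using main[OF f C] by (simp add: L1inf_seminorm_def)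
  qed
qed

lemma bdd_comp_op_imp_map_in_L1p:
  fixes \<psi> :: "real^'n::finite \<Rightarrow> real^'n"
  assumes U: "open U" and b: "bdd_comp_op_inf V \<psi> U s"
  shows "map_in_L1p V s \<psi>"
  unfolding map_in_L1p_def
proof
  fix i
  have w: "weak_grad U (\<lambda>x. x $ i) (\<lambda>x. axis i 1)"
    by (rule weak_grad_C1) (auto simp: inner_axis' intro!: bounded_linear_imp_has_derivative bounded_linear_vec_nth)
  then have wd: "weakly_diff U (\<lambda>x. x $ i)" by (auto simp: weakly_diff_def)
  have "AE x in lebesgue. x \<in> U \<longrightarrow> norm (wgrad U (\<lambda>x. x $ i) x) \<le> 1"
    using weak_grad_unique[OF weakly_diff_wgrad[OF wd] w U] by eventually_elim (auto simp: norm_axis_1)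
  then have "in_L1inf U (\<lambda>x. x $ i)" using wd by (auto simp: in_L1inf_def)
  moreover have "continuous_on U (\<lambda>x. x $ i)" by (intro continuous_intros)
  ultimately have "in_L1p V s ((\<lambda>x. x $ i) \<circ> \<psi>)" using b unfolding bdd_comp_op_inf_def by blast
  then show "in_L1p V s (\<lambda>y. \<psi> y $ i)" by (simp add: comp_def)
qed

text \<open>Everything happens on \<open>S\<close>, where the weak Jacobi matrix of
  \<open>\<phi>\<close> is an invertible classical derivative: off \<open>S\<close> and the null set
  \<open>Z\<close> the integrand is 0 by the definition of \<open>inner_dist\<close>. The finite
  integral of \<open>grad_sum\<close> over the image of \<open>S\<close> is pulled back to
  \<open>S\<close>.\<close>

theorem inner_dist_finite:
  fixes \<phi> \<psi> :: "real^'n::finite \<Rightarrow> real^'n"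
  assumes U: "open U" and V: "open V" and hom: "homeomorphism U V \<phi> \<psi>"
    and \<phi>: "map_in_L1inf U \<phi>" and \<psi>: "map_in_L1p V s \<psi>" and s: "s > 0"
  shows "(\<integral>\<^sup>+ x\<in>U. ennreal (inner_dist s U \<phi> x powr s) \<partial>lebesgue) < \<infinity>"
proof -
  have c: "continuous_on U \<phi>" "continuous_on V \<psi>" and im: "\<phi> ` U = V" "\<psi> ` V = U"
    and inv: "\<And>x. x \<in> U \<Longrightarrow> \<psi> (\<phi> x) = x" "\<And>y. y \<in> V \<Longrightarrow> \<phi> (\<psi> y) = y"
    using hom by (auto simp: homeomorphism_def)
  let ?A = "weak_jac U \<phi>"
  define Q where "Q x \<longleftrightarrow> (\<phi> has_derivative (\<lambda>h. ?A x *v h)) (at x)" for x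
  define Z where "Z = {x \<in> space lebesgue. \<not> (x \<in> U \<longrightarrow> Q x)}"
  have Z: "Z \<in> null_sets lebesgue"
    using map_L1inf_AE_has_derivative[OF U c(1) \<phi>] unfolding Z_def Q_def by (simp add: completion.AE_iff_null_sets)
  define S where "S = {x \<in> U. jac_det U \<phi> x \<noteq> 0} - Z"
  have S: "S \<in> sets lebesgue"
  proof -
    have "weak_grad U (\<lambda>x. \<phi> x $ k) (wgrad U (\<lambda>x. \<phi> x $ k))" for k
      using \<phi> by (intro weakly_diff_wgrad) (simp add: map_in_L1inf_def in_L1inf_def)
    then show ?thesis using jac_det_measurable[OF U] Z by (auto simp: S_def)
  qed
  have SU: "S \<subseteq> U" and SQ: "\<And>x. x \<in> S \<Longrightarrow> Q x" and Sd: "\<And>x. x \<in> S \<Longrightarrow> det (?A x) \<noteq> 0"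
    by (auto simp: S_def Z_def jac_det_def)
  have D: "(\<phi> has_derivative (\<lambda>h. ?A x *v h)) (at x)" if "x \<in> S" for x using SQ[OF that] by (simp add: Q_def)
  define B where "B x = matrix_inv (?A x)" for x
  have BA: "B x ** ?A x = mat 1" if "x \<in> S" for x unfolding B_def by (rule matrix_inv_mult[OF Sd[OF that]])
  define q where "q x = (\<Sum>i\<in>UNIV. norm (B x $ i))" for x
  \<comment> \<open>Differentiability of \<open>\<phi>\<close> at the single point \<open>x\<close>
    suffices, because the inverse is already known to be continuous.\<close>
  have D\<psi>: "(\<psi> has_derivative (\<lambda>h. B x *v h)) (at (\<phi> x))" if x: "x \<in> S" for x
  proof (rule has_derivative_inverse_basic)
    have xU: "x \<in> U" using x SU by blast
    show "(\<phi> has_derivative (\<lambda>h. ?A x *v h)) (at (\<psi> (\<phi> x)))" using D[OF x] inv(1)[OF xU] by simp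
    show "bounded_linear ((*v) (B x))" by (rule matrix_vector_mul_bounded_linear)
    show "(*v) (B x) \<circ> (*v) (?A x) = id" by (simp add: fun_eq_iff matrix_vector_mul_assoc BA[OF x])
    show "open V" by (rule V)
    show "\<phi> x \<in> V" using im(1) xU by blast
    then show "continuous (at (\<phi> x)) \<psi>" using c(2) V by (simp add: continuous_on_eq_continuous_at)
    show "\<phi> (\<psi> z) = z" if "z \<in> V" for z using inv(2)[OF that] .
  qed
  have eqAE: "AE y in lebesgue. y \<in> \<phi> ` S \<longrightarrow> grad_sum V \<psi> y = q (\<psi> y)"
  proof -
    have "AE y in lebesgue. \<forall>k\<in>UNIV. y \<in> V \<longrightarrow> (\<forall>a. ((\<lambda>y. \<psi> y $ k) has_derivative (\<lambda>h. a \<bullet> h)) (at y) \<longrightarrow> wgrad V (\<lambda>y. \<psi> y $ k) y = a)"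
      by (intro AE_finite_allI AE_weak_grad_eq_derivative map_in_L1p_weak_grad[OF \<psi>] V) simp
    then show ?thesis
    proof eventually_elim
      case (elim y)
      show ?case
      proof
        assume "y \<in> \<phi> ` S"
        then obtain x where x: "x \<in> S" "y = \<phi> x" by blast
        have xU: "x \<in> U" using x SU by blast
        have yV: "y \<in> V" using x(2) im(1) xU by blast
        have "wgrad V (\<lambda>y. \<psi> y $ k) y = B x $ k" for k
        proof -
          have "((\<lambda>y. \<psi> y $ k) has_derivative (\<lambda>h. (B x *v h) $ k)) (at y)"
            unfolding x(2) by (rule bounded_linear.has_derivative[OF bounded_linear_vec_nth D\<psi>[OF x(1)]])
          then have "((\<lambda>y. \<psi> y $ k) has_derivative (\<lambda>h. B x $ k \<bullet> h)) (at y)"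
            by (simp add: matrix_vector_mul_component)
          then show ?thesis using elim yV by blast
        qed
        then show "grad_sum V \<psi> y = q (\<psi> y)" by (simp add: grad_sum_def q_def x(2) inv(1)[OF xU])
      qed
    qed
  qed
  have \<phi>S: "\<phi> ` S \<in> sets lebesgue"
  proof (rule differentiable_image_in_sets_lebesgue[OF S order_refl])
    show "\<phi> differentiable_on S"
      unfolding differentiable_on_def differentiable_def using D has_derivative_at_withinI by blast
  qed
  have f0: "set_integrable lebesgue (\<phi> ` S) (\<lambda>y. grad_sum V \<psi> y powr s)"
  proof -
    have "integrable lebesgue (\<lambda>y. indicator V y * grad_sum V \<psi> y powr s)"
    proof (rule integrableI_bounded)
      show "(\<lambda>y. indicator V y * grad_sum V \<psi> y powr s) \<in> borel_measurable lebesgue" by (rule grad_sum_measurable[OF V \<psi>])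
      have "(\<integral>\<^sup>+ y. ennreal (norm (indicator V y * grad_sum V \<psi> y powr s)) \<partial>lebesgue) = (\<integral>\<^sup>+ y\<in>V. ennreal (grad_sum V \<psi> y powr s) \<partial>lebesgue)"
      proof (rule nn_integral_cong)
        fix y show "ennreal (norm (indicator V y * grad_sum V \<psi> y powr s)) = ennreal (grad_sum V \<psi> y powr s) * indicator V y"
          by (cases "y \<in> V") simp_all
      qed
      then show "(\<integral>\<^sup>+ y. ennreal (norm (indicator V y * grad_sum V \<psi> y powr s)) \<partial>lebesgue) < \<infinity>"
        using grad_sum_finite[OF V \<psi>] s by simp
    qed
    then have "set_integrable lebesgue V (\<lambda>y. grad_sum V \<psi> y powr s)" by (simp add: set_integrable_def)
    then show ?thesis by (rule set_integrable_subset[OF _ \<phi>S]) (use SU im(1) in blast)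
  qed
  \<comment> \<open>Weak and classical derivative are exchanged before changing variables, since the
    exceptional null set lies on the image side. After the substitution
    \<open>q (\<psi> (\<phi> x))\<close> is exactly \<open>q x\<close>, at every point of
    \<open>S\<close>.\<close>
  have "set_integrable lebesgue (\<phi> ` S) (\<lambda>y. q (\<psi> y) powr s)"
    unfolding set_integrable_def
  proof (rule integrable_cong_AE_imp[OF f0[unfolded set_integrable_def]])
    show eq: "AE y in lebesgue. indicator (\<phi> ` S) y *\<^sub>R grad_sum V \<psi> y powr s = indicator (\<phi> ` S) y *\<^sub>R q (\<psi> y) powr s"
      using eqAE
    proof eventually_elim
      case (elim y)
      then show ?case by (cases "y \<in> \<phi> ` S") simp_all
    qed
    show "(\<lambda>y. indicator (\<phi> ` S) y *\<^sub>R q (\<psi> y) powr s) \<in> borel_measurable lebesgue"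
      by (rule borel_measurable_AE[OF borel_measurable_integrable[OF f0[unfolded set_integrable_def]] eq])
  qed
  moreover have "inj_on \<phi> S" by (rule inj_on_inverseI[of S \<psi>]) (use inv(1) SU in blast)
  ultimately have "set_integrable lebesgue S (\<lambda>x. \<bar>det (?A x)\<bar> * q (\<psi> (\<phi> x)) powr s)"
    by (intro set_integrable_change_of_variables[OF S D])
  then have int: "integrable lebesgue (\<lambda>x. indicator S x *\<^sub>R (\<bar>det (?A x)\<bar> * q (\<psi> (\<phi> x)) powr s))" by (simp add: set_integrable_def)
  have "(\<integral>\<^sup>+ x\<in>U. ennreal (inner_dist s U \<phi> x powr s) \<partial>lebesgue)
     \<le> (\<integral>\<^sup>+ x. ennreal (norm (indicator S x *\<^sub>R (\<bar>det (?A x)\<bar> * q (\<psi> (\<phi> x)) powr s))) \<partial>lebesgue)"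
  proof (rule nn_integral_mono_AE, rule AE_I'[OF Z], rule subsetI, rule ccontr)
    fix x assume x: "x \<in> {x \<in> space lebesgue. \<not> ennreal (inner_dist s U \<phi> x powr s) * indicator U x
      \<le> ennreal (norm (indicator S x *\<^sub>R (\<bar>det (?A x)\<bar> * q (\<psi> (\<phi> x)) powr s)))}" "x \<notin> Z"
    have "ennreal (inner_dist s U \<phi> x powr s) * indicator U x
      \<le> ennreal (norm (indicator S x *\<^sub>R (\<bar>det (?A x)\<bar> * q (\<psi> (\<phi> x)) powr s)))"
    proof (cases "x \<in> S")
      case True
      then have xU: "x \<in> U" using SU by blast
      let ?m = "min_stretch (?A x)"
      have q: "q x > 0" "?m \<ge> 1 / q x"
        using inverse_min_stretch_le[OF BA[OF True]] by (simp_all add: q_def)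
      have "0 < 1 / q x" using q(1) by simp
      then have m: "?m > 0" using q(2) by linarith
      have "1 / ?m \<le> q x" using q m by (simp add: field_simps)
      then have le: "(1 / ?m) powr s \<le> q x powr s" using m s by (intro powr_mono2) auto
      have "inner_dist s U \<phi> x powr s = (\<bar>det (?A x)\<bar> powr (1/s) * (1 / ?m)) powr s"
        using Sd[OF True] by (simp add: inner_dist_def jac_det_def)
      also have "\<dots> = (\<bar>det (?A x)\<bar> powr (1/s)) powr s * (1 / ?m) powr s"
        by (rule powr_mult)
      also have "(\<bar>det (?A x)\<bar> powr (1/s)) powr s = \<bar>det (?A x)\<bar>" using s by (simp add: powr_powr)
      also have "\<bar>det (?A x)\<bar> * (1 / ?m) powr s \<le> \<bar>det (?A x)\<bar> * q x powr s" using le by (rule mult_left_mono) simp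
      finally show ?thesis using True xU by (simp add: inv(1)[OF xU] ennreal_leI)
    next
      case False
      then have "x \<in> U \<Longrightarrow> jac_det U \<phi> x = 0" using x(2) by (auto simp: S_def)
      then show ?thesis by (cases "x \<in> U") (simp_all add: inner_dist_def)
    qed
    then show False using x(1) by simp
  qed
  also have "\<dots> < \<infinity>" using int by (simp add: integrable_iff_bounded)
  finally show ?thesis .
qed

theorem theorem3p4:
  fixes \<phi> \<psi> :: "real^'n::finite \<Rightarrow> real^'n" and \<Omega> \<Omega>' :: "(real^'n) set" and s :: real
  assumes "open \<Omega>" and "connected \<Omega>" and "bounded \<Omega>"
      and "open \<Omega>'" and "connected \<Omega>'" and "bounded \<Omega>'"
      and "homeomorphism \<Omega> \<Omega>' \<phi> \<psi>"
      and "finite_distortion \<Omega> \<phi>"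
      and "map_in_L1inf \<Omega> \<phi>"
      and "1 \<le> s"
  shows "bdd_comp_op_inf \<Omega>' \<psi> \<Omega> s \<longleftrightarrow>
           map_in_L1p \<Omega>' s \<psi> \<and> luzin_N_inv \<Omega>' \<psi> \<and>
           (\<integral>\<^sup>+ x \<in> \<Omega>. ennreal (inner_dist s \<Omega> \<phi> x powr s) \<partial>lebesgue) < \<infinity>"
proof
  have s: "s > 0" using assms(10) by simp
  have c: "continuous_on \<Omega> \<phi>" "continuous_on \<Omega>' \<psi>" and im: "\<phi> ` \<Omega> = \<Omega>'" "\<psi> ` \<Omega>' = \<Omega>"
    and inv: "\<And>x. x \<in> \<Omega> \<Longrightarrow> \<psi> (\<phi> x) = x" "\<And>y. y \<in> \<Omega>' \<Longrightarrow> \<phi> (\<psi> y) = y"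
    using assms(7) by (auto simp: homeomorphism_def)
  {
    assume "bdd_comp_op_inf \<Omega>' \<psi> \<Omega> s"
    then have \<psi>: "map_in_L1p \<Omega>' s \<psi>" by (rule bdd_comp_op_imp_map_in_L1p[OF assms(1)])
    have "luzin_N_inv \<Omega>' \<psi>" unfolding luzin_N_inv_def
    proof (intro allI impI)
      fix E :: "(real^'n) set" assume E: "E \<in> null_sets lebesgue"
      \<comment> \<open>Pulling back by \<open>\<psi>\<close> is pushing forward by
        \<open>\<phi>\<close>, so the condition becomes the Luzin property of \<open>\<phi>\<close>;
        the intersection is taken because \<open>E\<close> is an arbitrary null set of the whole
        space.\<close>
      have "{y \<in> \<Omega>'. \<psi> y \<in> E} = \<phi> ` (E \<inter> \<Omega>)"
      proof (intro equalityI subsetI)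
        fix y assume "y \<in> {y \<in> \<Omega>'. \<psi> y \<in> E}"
        then have "\<psi> y \<in> E \<inter> \<Omega>" "y = \<phi> (\<psi> y)" using im(2) inv(2) by auto
        then show "y \<in> \<phi> ` (E \<inter> \<Omega>)" by blast
      next
        fix y assume "y \<in> \<phi> ` (E \<inter> \<Omega>)"
        then show "y \<in> {y \<in> \<Omega>'. \<psi> y \<in> E}" using im(1) inv(1) by auto
      qed
      moreover have "E \<inter> \<Omega> \<in> null_sets lebesgue"
        using E assms(1) by (intro null_set_Int2) auto
      ultimately show "{y \<in> \<Omega>'. \<psi> y \<in> E} \<in> null_sets lebesgue"
        using map_L1inf_null_image[OF assms(1) c(1) assms(9)] by simp
    qed
    with \<psi> show "map_in_L1p \<Omega>' s \<psi> \<and> luzin_N_inv \<Omega>' \<psi> \<and>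
           (\<integral>\<^sup>+ x \<in> \<Omega>. ennreal (inner_dist s \<Omega> \<phi> x powr s) \<partial>lebesgue) < \<infinity>"
      using inner_dist_finite[OF assms(1,4,7,9) \<psi> s] by blast
  next
    assume "map_in_L1p \<Omega>' s \<psi> \<and> luzin_N_inv \<Omega>' \<psi> \<and>
           (\<integral>\<^sup>+ x \<in> \<Omega>. ennreal (inner_dist s \<Omega> \<phi> x powr s) \<partial>lebesgue) < \<infinity>"
    then show "bdd_comp_op_inf \<Omega>' \<psi> \<Omega> s"
      using L1p_luzin_imp_bdd_comp_op[OF assms(4,1) c(2)] im(2) s by auto
  }
qed

end
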